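(* There exists a constant $C_0>0$ such that $$\sup_{x\in\partial\Omega(t)}|d(x,\partial\Omega_0)|\le C_0\,t$$ for all sufficiently small $t>0$.
   Context: Let $N\ge 2$ be an integer, $\lambda\in\mathbb{R}$, and let $\Omega_0\subset\mathbb{R}^N$ be a compact set whose boundary $\partial\Omega_0$ is of class $C^5$. For $x\in\mathbb{R}^N$, $t>0$ put $$G_{N,\lambda}(x,t)=(2\pi)^{-N}\int_{\mathbb{R}^N}e^{-(|\xi|^4+\lambda|\xi|^2)t+\mathbf{i}\langle x,\xi\rangle}\,d\xi ,$$ the fundamental solution of $\partial_t+(-\Delta)^2+\lambda(-\Delta)$, and let $u(x,t)=\int_{\Omega_0}G_{N,\lambda}(x-y,t)\,dy$ be the solution of $u_t=-\Delta^2u+\lambda\Delta u$ in $\mathbb{R}^N\times(0,\infty)$ with initial datum the indicator function $\chi_{\Omega_0}$. For $b>0$ set $u_b(x,t):=u(x,b^4t)$. Let $a>0$ be the constant with $18a^4/11=1$ and define the threshold function $$U(x,t):=u_{3a}(x,t)-3u_{2a}(x,t)+3u_a(x,t)$$ and the set $\Omega(t):=\{x\in\mathbb{R}^N : U(x,t)\ge \tfrac12\}$, with boundary $\partial\Omega(t)$. The signed distance to $\partial\Omega_0$ is $d(y,\partial\Omega_0):=\inf_{x\in\partial\Omega_0}|y-x|$ for $y\in\Omega_0$ and $d(y,\partial\Omega_0):=-\inf_{x\in\partial\Omega_0}|y-x|$ for $y\in\mathbb{R}^N\setminus\Omega_0$. *)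

theory Defs
  imports "HOL-Analysis.Analysis"
begin

primrec C_k :: "nat \<Rightarrow> ('a::real_normed_vector \<Rightarrow> 'b::real_normed_vector) \<Rightarrow> bool" where
  "C_k 0 f \<longleftrightarrow> continuous_on UNIV f"
| "C_k (Suc k) f \<longleftrightarrow>
     (\<forall>x. f differentiable (at x)) \<and> (\<forall>v. C_k k (\<lambda>x. frechet_derivative f (at x) v))"

text \<open>
  The boundary of the closed set \<open>A\<close> is of class \<open>C\<^sup>k\<close>: near each boundary point, after a rigid
  motion, \<open>A\<close> is the closed region on one side of the graph of a \<open>C\<^sup>k\<close> function of \<open>N - 1\<close>
  variables. The unit vector \<open>\<nu>\<close> is the direction of the last coordinate axis and
  \<open>x - (x \<bullet> \<nu>) *\<^sub>R \<nu>\<close> collects the other \<open>N - 1\<close> coordinates of \<open>x\<close>. Only the values of \<open>\<gamma>\<close> on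
  the hyperplane orthogonal to \<open>\<nu>\<close> matter; a \<open>C\<^sup>k\<close> function on that hyperplane extends to a
  \<open>C\<^sup>k\<close> function on the whole space, constant in the direction \<open>\<nu>\<close>.
\<close>

definition C_k_boundary :: "nat \<Rightarrow> 'a::euclidean_space set \<Rightarrow> bool" where
  "C_k_boundary k A \<longleftrightarrow>
     (\<forall>p\<in>frontier A. \<exists>r>0. \<exists>\<nu> \<gamma>. norm \<nu> = 1 \<and> C_k k (\<gamma> :: 'a \<Rightarrow> real) \<and>
        A \<inter> ball p r = {x \<in> ball p r. x \<bullet> \<nu> \<ge> \<gamma> (x - (x \<bullet> \<nu>) *\<^sub>R \<nu>)})"

definition G_kernel :: "real \<Rightarrow> real ^ 'n \<Rightarrow> real \<Rightarrow> complex" where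
  "G_kernel l x t = complex_of_real (1 / (2 * pi) ^ CARD('n)) *
     (LINT \<xi>|lborel. exp (complex_of_real (- (norm \<xi> ^ 4 + l * norm \<xi> ^ 2) * t)
                          + \<i> * complex_of_real (x \<bullet> \<xi>)))"

text \<open>The kernel is real-valued, so taking its real part below loses nothing.\<close>

lemma G_kernel_real:
  fixes x :: "real ^ 'n"
  shows "G_kernel l x t \<in> \<real>"
proof -
  let ?f = "\<lambda>\<xi>. exp (complex_of_real (- (norm \<xi> ^ 4 + l * norm \<xi> ^ 2) * t)
                          + \<i> * complex_of_real (x \<bullet> \<xi>))"
  have m: "?f \<in> borel_measurable borel"
    by (intro borel_measurable_continuous_onI continuous_intros)
  have "cnj (LINT \<xi>|lborel. ?f \<xi>) = (LINT \<xi>|lborel. cnj (?f \<xi>))"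
    by simp
  also have "\<dots> = (LINT \<xi>|lborel. ?f (- \<xi>))"
    by (simp add: exp_cnj)
  also have "\<dots> = (LINT \<xi>|distr lborel borel uminus. ?f \<xi>)"
    using m by (subst integral_distr) auto
  also have "\<dots> = (LINT \<xi>|lborel. ?f \<xi>)"
  proof -
    have "distr lborel borel uminus = (lborel :: (real ^ 'n) measure)"
      by (subst lborel_affine[of "-1" 0]) (auto simp: density_1 one_ennreal_def[symmetric])
    then show ?thesis by simp
  qed
  finally have "(LINT \<xi>|lborel. ?f \<xi>) \<in> \<real>"
    by (simp only: Reals_cnj_iff)
  then show ?thesis
    unfolding G_kernel_def by (intro Reals_mult) auto
qed

definition u_sol :: "real \<Rightarrow> (real ^ 'n) set \<Rightarrow> real ^ 'n \<Rightarrow> real \<Rightarrow> real" where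
  "u_sol l \<Omega>\<^sub>0 x t = (LINT y:\<Omega>\<^sub>0|lborel. Re (G_kernel l (x - y) t))"

definition u_scaled :: "real \<Rightarrow> (real ^ 'n) set \<Rightarrow> real \<Rightarrow> real ^ 'n \<Rightarrow> real \<Rightarrow> real" where
  "u_scaled l \<Omega>\<^sub>0 b x t = u_sol l \<Omega>\<^sub>0 x (b ^ 4 * t)"

definition U_threshold :: "real \<Rightarrow> (real ^ 'n) set \<Rightarrow> real \<Rightarrow> real ^ 'n \<Rightarrow> real \<Rightarrow> real" where
  "U_threshold l \<Omega>\<^sub>0 a x t =
     u_scaled l \<Omega>\<^sub>0 (3 * a) x t - 3 * u_scaled l \<Omega>\<^sub>0 (2 * a) x t + 3 * u_scaled l \<Omega>\<^sub>0 a x t"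

definition Omega :: "real \<Rightarrow> (real ^ 'n) set \<Rightarrow> real \<Rightarrow> real \<Rightarrow> (real ^ 'n) set" where
  "Omega l \<Omega>\<^sub>0 a t = {x. U_threshold l \<Omega>\<^sub>0 a x t \<ge> 1 / 2}"

definition signed_dist :: "'a::metric_space set \<Rightarrow> 'a \<Rightarrow> real" where
  "signed_dist A y = (if y \<in> A then infdist y (frontier A) else - infdist y (frontier A))"

end

theory Submission
  imports Defs "HOL-Probability.Probability" "HOL-Complex_Analysis.Complex_Analysis"
begin

text \<open>
  Put \<open>h = root 4 t\<close> and \<open>\<epsilon> = b h\<close>. After rescaling, \<open>u(x, \<epsilon>\<^sup>4)\<close> is the average of the indicator of the domain over
  \<open>x + \<epsilon> z\<close>, weighted with the rescaled kernel \<open>K(z)\<close>, the inverse Fourier transform of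
  \<open>exp (- |\<xi>|\<^sup>4 - \<mu> |\<xi>|\<^sup>2)\<close> with \<open>\<mu> = \<lambda> \<epsilon>\<^sup>2\<close>. This kernel changes sign, but it decays exponentially and has
  integral one.

  A point whose distance to the boundary exceeds a large multiple of \<open>h\<close> therefore has a value of \<open>U\<close> close to
  0 or to 1, and it cannot lie on the level set \<open>U = 1/2\<close> (\<open>U_threshold_far\<close>). Near the boundary the domain is
  the region above the graph of a function \<open>\<gamma>\<close>. Let \<open>\<phi>\<close> be the vertical distance from \<open>x\<close> to the graph. Seen at
  scale \<open>\<epsilon>\<close> around \<open>x\<close>, the graph is a hyperplane shifted by \<open>\<sigma> = \<phi> / \<epsilon>\<close>, perturbed by \<open>\<epsilon> Q + \<epsilon>\<^sup>2 c + O(\<epsilon>\<^sup>3)\<close>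
  with \<open>Q\<close> the quadratic and \<open>c\<close> the cubic part of \<open>\<gamma>\<close>. Expanding the average (\<open>graph_expansion\<close>,
  \<open>chart_expansion\<close>) gives

    \<open>u(x, \<epsilon>\<^sup>4) = 1/2 + S(\<phi> / (\<epsilon> s)) / 2 - \<epsilon> q + O(\<epsilon>\<^sup>3 + |\<phi>|)\<close>.

  Here the term of order \<open>\<epsilon>\<^sup>2\<close> is absent because its integrand is odd, \<open>q\<close> is a curvature term independent of
  \<open>\<epsilon>\<close>, \<open>s\<close> is the norm of the normal \<open>\<nu> - \<nabla>\<gamma>\<close>, and \<open>S\<close> is the odd function \<open>sgn_average\<close> that describes a half-space.
  The coefficients \<open>1, -3, 3\<close> at the scales \<open>3 a h, 2 a h, a h\<close> sum up to one and annihilate the curvature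
  term, since \<open>3 - 3 * 2 + 3 = 0\<close>. So on the level set \<open>U = 1/2\<close> the combination
  \<open>S(y/3) - 3 S(y/2) + 3 S(y)\<close> with \<open>y = \<phi> / (a h s)\<close> is \<open>O(h\<^sup>3 + |\<phi>|)\<close>. If it is bounded below by a multiple
  of \<open>|y|\<close>, then \<open>|\<phi>| / h = O(h\<^sup>3 + |\<phi>|)\<close>, that is \<open>|\<phi>| = O(h\<^sup>4) = O(t)\<close>.

  This lower bound (\<open>sgn_average_threshold_lower\<close>) is the crucial point, since \<open>K\<close> is not positive.
  An integration by parts on the Fourier side writes the combination as an average with positive weights of
  \<open>P(y \<tau>)\<close> over \<open>\<tau> > 0\<close>, where \<open>P(x) = Si(x/3) - 3 Si(x/2) + 3 Si(x)\<close> with the sine integral \<open>Si\<close>, and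
  \<open>P > 0\<close> on the positive half-line (\<open>threshold_Si_pos\<close>).

  A vertical distance in a chart replaces the distance to the boundary throughout, because only an upper bound
  for the latter is needed. All constants in a chart are uniform, and finitely many charts cover the compact boundary.
\<close>


section \<open>Integration over a Euclidean space\<close>

text \<open>
  The \<open>l\<^sup>1\<close> norm is at most the dimension times the Euclidean norm, so a product of one-dimensional
  exponentials is an integrable majorant.
\<close>

lemma integrable_exp_norm:
  fixes c :: real
  assumes "c > 0"
  shows "integrable lborel (\<lambda>z::'a::euclidean_space. exp (- c * norm z))"
proof -
  let ?d = "c / DIM('a)"
  have d: "?d > 0" using assms by simp
  have 1: "integrable lborel (\<lambda>x::real. exp (- ?d * \<bar>x\<bar>))"
  proof -
    have a: "set_integrable lborel {0<..} (\<lambda>x::real. exp (- (x * ?d)))"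
      by (rule integrable_I0i_exp_mscale[OF d])
    have b: "set_integrable lborel {..<0} (\<lambda>x::real. exp (x * ?d))"
    proof -
      have "integrable lborel (\<lambda>x::real. (\<lambda>x. indicator {0<..} x *\<^sub>R exp (- (x * ?d))) (0 + (-1) * x))"
        by (rule lborel_integrable_real_affine) (use a in \<open>auto simp: set_integrable_def\<close>)
      then show ?thesis
        unfolding set_integrable_def
        by (rule Bochner_Integration.integrable_cong[THEN iffD1, rotated 2]) (auto split: split_indicator)
    qed
    have "integrable lborel (\<lambda>x::real. indicator {0<..} x *\<^sub>R exp (- (x * ?d)) + indicator {..<0} x *\<^sub>R exp (x * ?d))"
      using a b unfolding set_integrable_def by (rule Bochner_Integration.integrable_add)
    moreover have "AE x in lborel. indicator {0<..} x *\<^sub>R exp (- (x * ?d)) + indicator {..<0} x *\<^sub>R exp (x * ?d)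
        = exp (- ?d * \<bar>x\<bar>)"
      using AE_lborel_singleton[of "0::real"]
      by eventually_elim (auto split: split_indicator simp: mult.commute)
    ultimately show ?thesis
      by (subst (asm) integrable_cong_AE) auto
  qed
  have "(\<integral>\<^sup>+x. ennreal (\<Prod>b\<in>Basis. exp (- ?d * \<bar>(x::'a) \<bullet> b\<bar>)) \<partial>lborel) = (\<integral>\<^sup>+x. (\<Prod>b\<in>Basis. ennreal (exp (- ?d * \<bar>(x::'a) \<bullet> b\<bar>))) \<partial>lborel)"
    by (simp add: prod_ennreal)
  also have "\<dots> = (\<Prod>b\<in>(Basis::'a set). (\<integral>\<^sup>+x. ennreal (exp (- ?d * \<bar>x\<bar>)) \<partial>lborel))"
    by (rule nn_integral_lborel_prod) auto
  also have "\<dots> < \<infinity>"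
    using 1[unfolded integrable_iff_bounded] by (auto simp: power_less_top_ennreal)
  finally have fin: "(\<integral>\<^sup>+x. ennreal (\<Prod>b\<in>Basis. exp (- ?d * \<bar>(x::'a) \<bullet> b\<bar>)) \<partial>lborel) < \<infinity>" .
  have "integrable lborel (\<lambda>x::'a. \<Prod>b\<in>Basis. exp (- ?d * \<bar>x \<bullet> b\<bar>))"
    unfolding integrable_iff_bounded using fin by (simp add: prod_nonneg)
  then show ?thesis
  proof (rule Bochner_Integration.integrable_bound)
    show "AE x in lborel. norm (exp (- c * norm (x::'a))) \<le> norm (\<Prod>b\<in>Basis. exp (- ?d * \<bar>x \<bullet> b\<bar>))"
    proof (rule AE_I2)
      fix x :: 'a
      have "(\<Sum>b\<in>(Basis::'a set). \<bar>x \<bullet> b\<bar>) \<le> (\<Sum>b\<in>(Basis::'a set). norm x)"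
        by (intro sum_mono) (simp add: Basis_le_norm)
      then have "(\<Sum>b\<in>(Basis::'a set). \<bar>x \<bullet> b\<bar>) \<le> DIM('a) * norm x" by simp
      then have "?d * (\<Sum>b\<in>(Basis::'a set). \<bar>x \<bullet> b\<bar>) \<le> ?d * (DIM('a) * norm x)"
        using d by (intro mult_left_mono) auto
      then show "norm (exp (- c * norm x)) \<le> norm (\<Prod>b\<in>Basis. exp (- ?d * \<bar>x \<bullet> b\<bar>))"
        by (simp add: exp_sum[symmetric] sum_distrib_left sum_negf)
    qed
  qed auto
qed

lemma lborel_integral_affine:
  fixes f :: "'a::euclidean_space \<Rightarrow> 'b::{banach, second_countable_topology}"
  assumes c: "c \<noteq> 0" and f[measurable]: "f \<in> borel_measurable borel"
  shows "integral\<^sup>L lborel f = \<bar>c\<bar> ^ DIM('a) *\<^sub>R (LBINT x. f (t + c *\<^sub>R x))"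
  by (subst lborel_affine[OF c, of t]) (simp add: integral_density integral_distr)

lemma lborel_integrable_affine:
  fixes f :: "'a::euclidean_space \<Rightarrow> 'b::{banach, second_countable_topology}"
  assumes c: "c \<noteq> 0" and f: "integrable lborel f"
  shows "integrable lborel (\<lambda>x. f (t + c *\<^sub>R x))"
proof -
  have [measurable]: "f \<in> borel_measurable borel" using borel_measurable_integrable[OF f] by simp
  have "integrable lborel (\<lambda>x. \<bar>c\<bar> ^ DIM('a) *\<^sub>R f (t + c *\<^sub>R x))"
    using f by (subst (asm) lborel_affine[OF c, of t]) (simp add: integrable_density integrable_distr_eq)
  then have "integrable lborel (\<lambda>x. inverse (\<bar>c\<bar> ^ DIM('a)) *\<^sub>R \<bar>c\<bar> ^ DIM('a) *\<^sub>R f (t + c *\<^sub>R x))"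
    by (rule integrable_scaleR_right)
  then show ?thesis using c by simp
qed

lemma lborel_integral_translate:
  fixes f :: "'a::euclidean_space \<Rightarrow> 'b::{banach, second_countable_topology}"
  assumes "f \<in> borel_measurable borel"
  shows "(LBINT x. f (x + t)) = integral\<^sup>L lborel f"
  using lborel_integral_affine[of 1 f t] assms by (simp add: add.commute)

lemma lborel_integrable_translate:
  fixes f :: "'a::euclidean_space \<Rightarrow> 'b::{banach, second_countable_topology}"
  assumes "integrable lborel f"
  shows "integrable lborel (\<lambda>x. f (x + t))"
  using lborel_integrable_affine[of 1 f t] assms by (simp add: add.commute)

lemma lborel_integral_reflect:
  fixes f :: "'a::euclidean_space \<Rightarrow> 'b::{banach, second_countable_topology}"
  assumes "f \<in> borel_measurable borel"
  shows "(LBINT x. f (- x)) = integral\<^sup>L lborel f"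
  using lborel_integral_affine[of "-1" f 0] assms by simp

lemma lborel_integral_odd:
  fixes f :: "'a::euclidean_space \<Rightarrow> real"
  assumes "f \<in> borel_measurable borel" and "\<And>x. f (- x) = - f x"
  shows "(LBINT x. f x) = 0"
  using lborel_integral_reflect[OF assms(1)] by (simp add: assms(2))

lemma swap_integral_unit_interval:
  fixes f :: "real \<Rightarrow> 'a::euclidean_space \<Rightarrow> complex"
  assumes [measurable]: "(\<lambda>p. f (fst p) (snd p)) \<in> borel_measurable (borel \<Otimes>\<^sub>M borel)"
    and D: "integrable lborel D"
    and b: "\<And>s x. 0 \<le> s \<Longrightarrow> s \<le> 1 \<Longrightarrow> norm (f s x) \<le> D (x + v s)"
  shows "(LBINT x. (LBINT s. indicator {0..1} s *\<^sub>R f s x))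
       = (LBINT s. indicator {0..1} s *\<^sub>R (LBINT x. f s x))"
    and "integrable lborel (\<lambda>x. \<integral>s. indicator {0..1} s *\<^sub>R f s x \<partial>lborel)"
proof -
  have [measurable]: "D \<in> borel_measurable borel" using borel_measurable_integrable[OF D] by simp
  have Dn: "integrable lborel (\<lambda>x. norm (D x))" using D by simp
  have fi: "integrable lborel (f s)" if "0 \<le> s" "s \<le> 1" for s
  proof (rule Bochner_Integration.integrable_bound[OF lborel_integrable_translate[OF D, of "v s"]])
    show "f s \<in> borel_measurable lborel"
    proof -
      have "(\<lambda>x::'a. (s, x)) \<in> measurable borel (borel \<Otimes>\<^sub>M borel)" by measurable
      from measurable_compose[OF this assms(1)] show ?thesis by simp
    qed
    show "AE x in lborel. norm (f s x) \<le> norm (D (x + v s))"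
      using b[OF that] by (intro AE_I2) (smt (verit, best) real_norm_def)
  qed
  have fn: "(LBINT x. norm (f s x)) \<le> (LBINT x. norm (D x))" if "0 \<le> s" "s \<le> 1" for s
  proof -
    have "(LBINT x. norm (f s x)) \<le> (LBINT x. norm (D (x + v s)))"
      using b[OF that] fi[OF that] lborel_integrable_translate[OF D, of "v s"]
      by (intro integral_mono) (auto intro: order_trans[OF _ abs_ge_self])
    also have "\<dots> = (LBINT x. norm (D x))"
      by (rule lborel_integral_translate) simp
    finally show ?thesis .
  qed
  let ?g = "\<lambda>(s, x). indicator {0..1} s *\<^sub>R f s x"
  have m: "?g \<in> borel_measurable (lborel \<Otimes>\<^sub>M lborel)"
    by (simp add: case_prod_beta') measurable
  have int: "integrable (lborel \<Otimes>\<^sub>M lborel) ?g"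
  proof (rule lborel_pair.Fubini_integrable[OF m])
    show "integrable lborel (\<lambda>s. \<integral>x. norm (?g (s, x)) \<partial>lborel)"
    proof (rule Bochner_Integration.integrable_bound)
      show "integrable lborel (\<lambda>s::real. indicator {0..1} s *\<^sub>R (LBINT x. norm (D x)))"
        by (simp add: integrable_mult_left_iff)
      show "(\<lambda>s. \<integral>x. norm (?g (s, x)) \<partial>lborel) \<in> borel_measurable lborel"
        by (simp add: case_prod_beta') measurable
      show "AE s in lborel. norm (LBINT x. norm (?g (s, x)))
          \<le> norm (indicator {0..1} s *\<^sub>R (LBINT x. norm (D x)))"
        using fn by (intro AE_I2) (auto split: split_indicator simp: integral_nonneg_AE)
    qed
    show "AE s in lborel. integrable lborel (\<lambda>x. ?g (s, x))"
      using fi by (intro AE_I2) (auto split: split_indicator)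
  qed
  have "(LBINT x. (LBINT s. (\<lambda>s x. indicator {0..1} s *\<^sub>R f s x) s x))
      = (LBINT s. (LBINT x. (\<lambda>s x. indicator {0..1} s *\<^sub>R f s x) s x))"
    by (rule lborel_pair.Fubini_integral[OF int])
  also have "\<dots> = (LBINT s. indicator {0..1} s *\<^sub>R (LBINT x. f s x))"
    by simp
  finally show "(LBINT x. (LBINT s. indicator {0..1} s *\<^sub>R f s x))
       = (LBINT s. indicator {0..1} s *\<^sub>R (LBINT x. f s x))" by simp
  show "integrable lborel (\<lambda>x. \<integral>s. indicator {0..1} s *\<^sub>R f s x \<partial>lborel)"
    using lborel_pair.integrable_snd[OF int] by simp
qed

text \<open>
  Cauchy's theorem on the unit square for \<open>w \<mapsto> h x w\<close>, integrated over \<open>x\<close>. The two vertical sides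
  differ by the translation by \<open>\<zeta>\<close> and cancel; the horizontal sides are averages over translations and
  give the two integrals. In this way a shift of the integration domain into the complex direction \<open>\<i> \<zeta>\<close> needs no
  coordinates and no differentiation under the integral.
\<close>

lemma contour_shift:
  fixes h :: "'a::euclidean_space \<Rightarrow> complex \<Rightarrow> complex"
  assumes hol: "\<And>x. h x holomorphic_on UNIV"
    and tr: "\<And>x s w. h x (of_real s + w) = h (x + s *\<^sub>R \<zeta>) w"
    and cont: "continuous_on UNIV (\<lambda>p. h (fst p) (snd p))"
    and D: "integrable lborel D"
    and dom: "\<And>x t. 0 \<le> t \<Longrightarrow> t \<le> 1 \<Longrightarrow> norm (h x (\<i> * of_real t)) \<le> D x"
  shows "(LBINT x. h x \<i>) = (LBINT x. h x 0)"
proof -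
  have hm: "(\<lambda>x. h (a x) (b x)) \<in> borel_measurable N"
    if "a \<in> borel_measurable N" "b \<in> borel_measurable N" for a b and N :: "'x measure"
  proof -
    have "(\<lambda>x. (a x, b x)) \<in> borel_measurable N"
      using that by (rule borel_measurable_Pair)
    then have "(\<lambda>x. (\<lambda>p. h (fst p) (snd p)) (a x, b x)) \<in> borel_measurable N"
      by (rule borel_measurable_continuous_on[OF cont])
    then show ?thesis by simp
  qed
  have fub: "(LBINT x. (LBINT s. indicator {0..1} s *\<^sub>R h x (of_real (p s) + \<i> * of_real (q s))))
       = (LBINT s. indicator {0..1} s *\<^sub>R (LBINT x. h x (\<i> * of_real (q s)))) \<and>
      integrable lborel (\<lambda>x. \<integral>s. indicator {0..1} s *\<^sub>R h x (of_real (p s) + \<i> * of_real (q s)) \<partial>lborel)"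
    if [measurable]: "p \<in> borel_measurable borel" "q \<in> borel_measurable borel"
      and q: "\<And>s. 0 \<le> s \<Longrightarrow> s \<le> 1 \<Longrightarrow> 0 \<le> q s \<and> q s \<le> 1" for p q :: "real \<Rightarrow> real"
  proof -
    define f where "f = (\<lambda>s x. h x (of_real (p s) + \<i> * of_real (q s)))"
    have m: "(\<lambda>p. f (fst p) (snd p)) \<in> borel_measurable (borel \<Otimes>\<^sub>M borel)"
      unfolding f_def by (intro hm) measurable
    have bd: "norm (f s x) \<le> D (x + p s *\<^sub>R \<zeta>)" if "0 \<le> s" "s \<le> 1" for s x
      using dom[of "q s" "x + p s *\<^sub>R \<zeta>"] q[OF that] by (simp add: f_def tr)
    have "(LBINT x. f s x) = (LBINT x. h x (\<i> * of_real (q s)))" for s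
      unfolding f_def tr by (rule lborel_integral_translate) (intro hm, auto)
    then show ?thesis
      using swap_integral_unit_interval[OF m D bd] by (simp add: f_def)
  qed
  have one: "(LBINT s. indicator {0..1} (s::real) *\<^sub>R c) = c" for c :: complex
  proof -
    have "(LBINT s. indicator {0..1} (s::real) *\<^sub>R c) = (\<lambda>s. s *\<^sub>R c) 1 - (\<lambda>s. s *\<^sub>R c) 0"
      by (rule integral_FTC_atLeastAtMost) (auto intro!: derivative_eq_intros)
    then show ?thesis by simp
  qed
  \<comment> \<open>The identity between the four sides follows from a primitive of the entire function.\<close>
  have rect: "(LBINT s. indicator {0..1} s *\<^sub>R h x (of_real s + \<i> * of_real 1))
        - (LBINT s. indicator {0..1} s *\<^sub>R h x (of_real s + \<i> * of_real 0))
      = \<i> * ((LBINT s. indicator {0..1} s *\<^sub>R h x (of_real 1 + \<i> * of_real s))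
        - (LBINT s. indicator {0..1} s *\<^sub>R h x (of_real 0 + \<i> * of_real s)))" for x
  proof -
    obtain g where g: "\<And>w. (g has_field_derivative h x w) (at w)"
      using holomorphic_convex_primitive'[OF convex_UNIV open_UNIV hol[of x]] by auto
    have ch: "continuous_on UNIV (h x)"
      using hol[of x] by (rule holomorphic_on_imp_continuous_on)
    have hor: "(LBINT s. indicator {0..1} s *\<^sub>R h x (of_real s + \<i> * of_real t))
        = g (1 + \<i> * of_real t) - g (\<i> * of_real t)" for t
    proof -
      have "(LBINT s. indicator {0..1} s *\<^sub>R h x (of_real s + \<i> * of_real t))
          = (\<lambda>s. g (of_real s + \<i> * of_real t)) 1 - (\<lambda>s. g (of_real s + \<i> * of_real t)) 0"
      proof (rule integral_FTC_atLeastAtMost)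
        show "((\<lambda>s. g (of_real s + \<i> * of_real t)) has_vector_derivative h x (of_real s + \<i> * of_real t))
              (at s within {0..1})" for s
        proof -
          have "((\<lambda>s::real. of_real s + \<i> * of_real t) has_vector_derivative 1) (at s within {0..1})"
            by (auto intro!: derivative_eq_intros)
          from field_vector_diff_chain_within[OF this, of g "h x (of_real s + \<i> * of_real t)"]
          show ?thesis using g by (auto simp: o_def intro: has_field_derivative_at_within)
        qed
        show "continuous_on {0..1} (\<lambda>s. h x (of_real s + \<i> * of_real t))"
          by (intro continuous_on_compose2[OF ch] continuous_intros) auto
      qed auto
      then show ?thesis by simp
    qed
    have ver: "\<i> * (LBINT s. indicator {0..1} s *\<^sub>R h x (of_real t + \<i> * of_real s))
        = g (of_real t + \<i>) - g (of_real t)" for t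
    proof -
      have "(LBINT s. indicator {0..1} s *\<^sub>R (\<i> * h x (of_real t + \<i> * of_real s)))
          = (\<lambda>s. g (of_real t + \<i> * of_real s)) 1 - (\<lambda>s. g (of_real t + \<i> * of_real s)) 0"
      proof (rule integral_FTC_atLeastAtMost)
        show "((\<lambda>s. g (of_real t + \<i> * of_real s)) has_vector_derivative \<i> * h x (of_real t + \<i> * of_real s))
              (at s within {0..1})" for s
        proof -
          have "((\<lambda>s::real. of_real t + \<i> * of_real s) has_vector_derivative \<i>) (at s within {0..1})"
            by (auto intro!: derivative_eq_intros)
          from field_vector_diff_chain_within[OF this, of g "h x (of_real t + \<i> * of_real s)"]
          show ?thesis using g by (auto simp: o_def intro: has_field_derivative_at_within)
        qed
        show "continuous_on {0..1} (\<lambda>s. \<i> * h x (of_real t + \<i> * of_real s))"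
          by (intro continuous_intros continuous_on_compose2[OF ch]) auto
      qed auto
      also have "(LBINT s. indicator {0..1} s *\<^sub>R (\<i> * h x (of_real t + \<i> * of_real s)))
          = \<i> * (LBINT s. indicator {0..1} s *\<^sub>R h x (of_real t + \<i> * of_real s))"
        by (subst integral_mult_right_zero[symmetric]) (simp add: mult.left_commute scaleR_conv_of_real)
      finally show ?thesis by simp
    qed
    show ?thesis
      unfolding hor right_diff_distrib ver by (simp add: algebra_simps)
  qed
  let ?I = "\<lambda>(p::real\<Rightarrow>real) (q::real\<Rightarrow>real) x. (LBINT s. indicator {0..1} s *\<^sub>R h x (of_real (p s) + \<i> * of_real (q s)))"
  let ?J = "\<lambda>(q::real\<Rightarrow>real). (LBINT s. indicator {0..1} s *\<^sub>R (LBINT x. h x (\<i> * of_real (q s))))"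
  have f: "integrable lborel (?I p q) \<and> integral\<^sup>L lborel (?I p q) = ?J q"
    if "p \<in> borel_measurable borel" "q \<in> borel_measurable borel"
      and "\<And>s. 0 \<le> s \<Longrightarrow> s \<le> 1 \<Longrightarrow> 0 \<le> q s \<and> q s \<le> 1" for p q :: "real \<Rightarrow> real"
    using fub[OF that] by blast
  have f1: "integrable lborel (?I (\<lambda>s. s) (\<lambda>_. 1)) \<and> integral\<^sup>L lborel (?I (\<lambda>s. s) (\<lambda>_. 1)) = ?J (\<lambda>_. 1)"
    by (rule f) auto
  have f2: "integrable lborel (?I (\<lambda>s. s) (\<lambda>_. 0)) \<and> integral\<^sup>L lborel (?I (\<lambda>s. s) (\<lambda>_. 0)) = ?J (\<lambda>_. 0)"
    by (rule f) auto
  have f3: "integrable lborel (?I (\<lambda>_. 1) (\<lambda>s. s)) \<and> integral\<^sup>L lborel (?I (\<lambda>_. 1) (\<lambda>s. s)) = ?J (\<lambda>s. s)"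
    by (rule f) auto
  have f4: "integrable lborel (?I (\<lambda>_. 0) (\<lambda>s. s)) \<and> integral\<^sup>L lborel (?I (\<lambda>_. 0) (\<lambda>s. s)) = ?J (\<lambda>s. s)"
    by (rule f) auto
  have "?J (\<lambda>_. 1) - ?J (\<lambda>_. 0) = (LBINT x. ?I (\<lambda>s. s) (\<lambda>_. 1) x - ?I (\<lambda>s. s) (\<lambda>_. 0) x)"
    using f1 f2 by (simp only: Bochner_Integration.integral_diff)
  also have "\<dots> = (LBINT x. \<i> * (?I (\<lambda>_. 1) (\<lambda>s. s) x - ?I (\<lambda>_. 0) (\<lambda>s. s) x))"
    by (simp only: rect)
  also have "\<dots> = \<i> * (?J (\<lambda>s. s) - ?J (\<lambda>s. s))"
    using f3 f4 by (simp only: integral_mult_right_zero Bochner_Integration.integral_diff)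
  finally have "?J (\<lambda>_. 1) = ?J (\<lambda>_. 0)"
    by (simp only: diff_self mult_zero_right right_minus_eq)
  then show ?thesis
    unfolding one by (simp only: of_real_1 of_real_0 mult_1_right mult_zero_right)
qed

lemma gaussian_integral:
  shows "integrable lborel (\<lambda>z::'a::euclidean_space. exp (- (norm z)\<^sup>2 / 2))"
    and "(LBINT z. exp (- (norm (z::'a))\<^sup>2 / 2)) = sqrt (2 * pi) ^ DIM('a)"
proof -
  have e: "exp (- x\<^sup>2 / 2) = sqrt (2 * pi) * std_normal_density x" for x :: real
    by (simp add: normal_density_def)
  have "has_bochner_integral lborel (\<lambda>x::real. exp (- x\<^sup>2 / 2)) (sqrt (2 * pi))"
    unfolding e has_bochner_integral_iff by (simp add: integral_normal_density)
  then have 1: "(\<integral>\<^sup>+x. ennreal (exp (- x\<^sup>2 / 2)) \<partial>lborel) = ennreal (sqrt (2 * pi))" for x :: real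
    by (subst nn_integral_eq_integral) (auto simp: has_bochner_integral_iff)
  have n: "exp (- (norm z)\<^sup>2 / 2) = (\<Prod>b\<in>Basis. exp (- (z \<bullet> b)\<^sup>2 / 2))" for z :: 'a
    using euclidean_inner[of z z]
    by (simp add: exp_sum[symmetric] sum_negf sum_divide_distrib[symmetric] power2_norm_eq_inner)
      (simp add: power2_eq_square)
  have "(\<integral>\<^sup>+z. ennreal (exp (- (norm (z::'a))\<^sup>2 / 2)) \<partial>lborel)
      = (\<integral>\<^sup>+z. (\<Prod>b\<in>Basis. ennreal (exp (- ((z::'a) \<bullet> b)\<^sup>2 / 2))) \<partial>lborel)"
    unfolding n by (simp add: prod_ennreal)
  also have "\<dots> = (\<Prod>b\<in>(Basis::'a set). (\<integral>\<^sup>+x. ennreal (exp (- x\<^sup>2 / 2)) \<partial>lborel))"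
    by (rule nn_integral_lborel_prod) auto
  also have "\<dots> = ennreal (sqrt (2 * pi) ^ DIM('a))"
    unfolding 1 by (simp add: ennreal_power)
  finally have 2: "(\<integral>\<^sup>+z. ennreal (exp (- (norm (z::'a))\<^sup>2 / 2)) \<partial>lborel) = ennreal (sqrt (2 * pi) ^ DIM('a))" .
  then have "has_bochner_integral lborel (\<lambda>z::'a. exp (- (norm z)\<^sup>2 / 2)) (sqrt (2 * pi) ^ DIM('a))"
    by (intro has_bochner_integral_nn_integral) auto
  then show "integrable lborel (\<lambda>z::'a::euclidean_space. exp (- (norm z)\<^sup>2 / 2))"
    and "(LBINT z. exp (- (norm (z::'a))\<^sup>2 / 2)) = sqrt (2 * pi) ^ DIM('a)"
    by (auto simp: has_bochner_integral_iff)
qed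

text \<open>
  Completing the square turns the oscillating factor into a shift by the imaginary vector \<open>- \<i> \<eta>\<close>.
\<close>

lemma gaussian_fourier:
  fixes \<eta> :: "'a::euclidean_space"
  shows "(LBINT z. exp (\<i> * of_real (z \<bullet> \<eta>)) * of_real (exp (- (norm z)\<^sup>2 / 2)))
    = (of_real (sqrt (2 * pi) ^ DIM('a) * exp (- (norm \<eta>)\<^sup>2 / 2)) :: complex)"
proof -
  define h where "h = (\<lambda>z w. exp (- (of_real ((norm z)\<^sup>2) - 2 * w * of_real (z \<bullet> \<eta>) + w\<^sup>2 * of_real ((norm \<eta>)\<^sup>2)) / 2 :: complex))"
  have "(LBINT z. h z \<i>) = (LBINT z. h z 0)"
  proof (rule contour_shift[where \<zeta> = "- \<eta>"])
    show "h x holomorphic_on UNIV" for x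
      unfolding h_def by (intro holomorphic_intros) auto
    show "h x (of_real s + w) = h (x + s *\<^sub>R - \<eta>) w" for x s w
    proof -
      have a: "(norm (x + s *\<^sub>R - \<eta>))\<^sup>2 = (norm x)\<^sup>2 - 2 * s * (x \<bullet> \<eta>) + s\<^sup>2 * (norm \<eta>)\<^sup>2"
        unfolding power2_norm_eq_inner
        by (simp add: inner_diff_left inner_diff_right inner_commute[of \<eta> x] algebra_simps power2_eq_square)
      have b: "(x + s *\<^sub>R - \<eta>) \<bullet> \<eta> = x \<bullet> \<eta> - s * (norm \<eta>)\<^sup>2"
        by (simp add: power2_norm_eq_inner inner_diff_left)
      show ?thesis
        unfolding h_def a b by (simp add: algebra_simps power2_eq_square)
    qed
    show "continuous_on UNIV (\<lambda>p. h (fst p) (snd p))"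
      unfolding h_def by (intro continuous_intros) auto
    show "integrable lborel (\<lambda>z. exp ((norm \<eta>)\<^sup>2 / 2) * exp (- (norm z)\<^sup>2 / 2))"
      by (intro integrable_mult_right gaussian_integral)
    show "norm (h z (\<i> * of_real t)) \<le> exp ((norm \<eta>)\<^sup>2 / 2) * exp (- (norm z)\<^sup>2 / 2)"
      if "0 \<le> t" "t \<le> 1" for z t
    proof -
      have "t\<^sup>2 * (norm \<eta>)\<^sup>2 \<le> 1 * (norm \<eta>)\<^sup>2"
        using that by (intro mult_right_mono) (auto simp: power_le_one)
      then show ?thesis
        by (simp add: h_def exp_add[symmetric] power_mult_distrib field_simps flip: of_real_power)
    qed
  qed
  moreover have "h z \<i> = exp (of_real ((norm \<eta>)\<^sup>2 / 2)) * (exp (\<i> * of_real (z \<bullet> \<eta>)) * of_real (exp (- (norm z)\<^sup>2 / 2)))" for z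
    by (simp add: h_def exp_of_real[symmetric] exp_add[symmetric] field_simps)
  moreover have "(LBINT z. h z 0) = of_real (sqrt (2 * pi) ^ DIM('a))"
  proof -
    have "h z 0 = of_real (exp (- (norm z)\<^sup>2 / 2))" for z
      by (simp add: h_def exp_of_real[symmetric])
    then have "(LBINT z. h z 0) = of_real (LBINT z. exp (- (norm (z::'a))\<^sup>2 / 2))"
      by (simp only: integral_complex_of_real)
    then show ?thesis by (simp only: gaussian_integral)
  qed
  ultimately have "exp (of_real ((norm \<eta>)\<^sup>2 / 2)) * (LBINT z. exp (\<i> * of_real (z \<bullet> \<eta>)) * of_real (exp (- (norm z)\<^sup>2 / 2)))
      = (of_real (sqrt (2 * pi) ^ DIM('a)) :: complex)"
    by simp
  then have "exp (- of_real ((norm \<eta>)\<^sup>2 / 2)) * (exp (of_real ((norm \<eta>)\<^sup>2 / 2)) * (LBINT z. exp (\<i> * of_real (z \<bullet> \<eta>)) * of_real (exp (- (norm z)\<^sup>2 / 2))))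
      = (exp (- of_real ((norm \<eta>)\<^sup>2 / 2)) * of_real (sqrt (2 * pi) ^ DIM('a)) :: complex)"
    by simp
  then show ?thesis
    unfolding mult.assoc[symmetric] exp_add[symmetric] of_real_mult
    by (simp add: exp_of_real[symmetric])
qed


section \<open>The biharmonic kernel\<close>

text \<open>
  The left-hand side collects what a shift by an imaginary vector of length at most one and a multiplier of
  controlled growth cost; the quartic decay outweighs it. The constant is chosen for simplicity.
\<close>

lemma quartic_exponent_bound:
  fixes X :: real
  shows "2 * X\<^sup>2 + 3 * X - X ^ 4 + 6 * X\<^sup>2 \<le> 27 - X"
proof -
  have "0 \<le> (X\<^sup>2 - 5)\<^sup>2 + 2 * (X - 1)\<^sup>2" by simp
  then show ?thesis by (simp add: power2_eq_square power4_eq_xxxx algebra_simps)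
qed

lemma quartic_exponent_bound':
  fixes X :: real
  shows "2 * X\<^sup>2 + 3 * X - X ^ 4 \<le> 27 - X"
  using quartic_exponent_bound[of X] zero_le_power2[of X] by linarith

lemma integrable_quartic:
  fixes m :: "'a::euclidean_space \<Rightarrow> 'b::{real_normed_algebra_1, banach, second_countable_topology}"
  assumes [measurable]: "m \<in> borel_measurable borel"
    and "\<And>x. norm (m x) \<le> B * exp (2 * (norm x)\<^sup>2 + 3 * norm x)"
  shows "integrable lborel (\<lambda>x. m x * of_real (exp (- (norm x ^ 4))))"
    and "norm (m x * of_real (exp (- (norm x ^ 4)))) \<le> B * exp 27 * exp (- norm x)"
proof -
  have *: "norm (m x * of_real (exp (- (norm x ^ 4)))) \<le> B * exp 27 * exp (- norm x)" for x
  proof -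
    have B: "0 \<le> B"
      using order_trans[OF norm_ge_zero assms(2)[of 0]] by simp
    have "norm (m x * of_real (exp (- (norm x ^ 4)))) \<le> norm (m x) * norm (of_real (exp (- (norm x ^ 4))) :: 'b)"
      by (rule norm_mult_ineq)
    also have "\<dots> = norm (m x) * exp (- (norm x ^ 4))" by simp
    also have "\<dots> \<le> B * exp (2 * (norm x)\<^sup>2 + 3 * norm x) * exp (- (norm x ^ 4))"
      by (intro mult_right_mono assms(2)) simp
    also have "\<dots> = B * exp (2 * (norm x)\<^sup>2 + 3 * norm x - norm x ^ 4)"
      by (simp add: exp_diff exp_minus field_simps)
    also have "\<dots> \<le> B * exp (27 - norm x)"
      using quartic_exponent_bound'[of "norm x"] B by (intro mult_left_mono) auto
    finally show ?thesis by (simp add: exp_diff exp_minus field_simps)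
  qed
  show "norm (m x * of_real (exp (- (norm x ^ 4)))) \<le> B * exp 27 * exp (- norm x)" by (rule *)
  show "integrable lborel (\<lambda>x. m x * of_real (exp (- (norm x ^ 4))))"
  proof (rule Bochner_Integration.integrable_bound)
    show "integrable lborel (\<lambda>x::'a. B * exp 27 * exp (- norm x))"
      using integrable_exp_norm[of 1, where 'a='a] by simp
    show "AE x in lborel. norm (m x * of_real (exp (- (norm x ^ 4)))) \<le> norm (B * exp 27 * exp (- norm x))"
      using * by (intro AE_I2) (metis abs_ge_self order_trans real_norm_def)
    show "(\<lambda>x. m x * of_real (exp (- (norm x ^ 4)))) \<in> borel_measurable lborel"
      by measurable
  qed
qed

text \<open>
  The holomorphic extension of \<open>w \<mapsto> (norm (x + w *\<^sub>R \<zeta>))\<^sup>2\<close> from real to complex \<open>w\<close>, for a unit vector \<open>\<zeta>\<close>.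
\<close>

definition csq :: "'a::euclidean_space \<Rightarrow> 'a \<Rightarrow> complex \<Rightarrow> complex" where
  "csq \<zeta> x w = of_real ((norm x)\<^sup>2) + 2 * w * of_real (x \<bullet> \<zeta>) + w\<^sup>2"

lemma csq_translate:
  assumes "norm \<zeta> = 1"
  shows "csq \<zeta> x (of_real s + w) = csq \<zeta> (x + s *\<^sub>R \<zeta>) w"
proof -
  have [simp]: "\<zeta> \<bullet> \<zeta> = 1" using assms by (simp add: norm_eq_1)
  have a: "(norm (x + s *\<^sub>R \<zeta>))\<^sup>2 = (norm x)\<^sup>2 + 2 * s * (x \<bullet> \<zeta>) + s\<^sup>2"
    unfolding power2_norm_eq_inner
    by (simp add: inner_add_left inner_add_right inner_commute[of \<zeta> x] algebra_simps power2_eq_square)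
  have b: "(x + s *\<^sub>R \<zeta>) \<bullet> \<zeta> = x \<bullet> \<zeta> + s"
    by (simp add: inner_add_left)
  show ?thesis
    unfolding csq_def a b by (simp add: algebra_simps power2_eq_square)
qed

lemma csq_imag:
  assumes "norm \<zeta> = 1" "0 \<le> t" "t \<le> 1"
  shows "norm (csq \<zeta> x (\<i> * of_real t)) \<le> (norm x)\<^sup>2 + 1"
    and "Re ((csq \<zeta> x (\<i> * of_real t))\<^sup>2) \<ge> norm x ^ 4 - 6 * (norm x)\<^sup>2"
proof -
  let ?X = "norm x" and ?b = "2 * t * (x \<bullet> \<zeta>)"
  have c: "csq \<zeta> x (\<i> * of_real t) = Complex (?X\<^sup>2 - t\<^sup>2) ?b"
    by (simp add: csq_def complex_eq_iff power2_eq_square)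
  have xz: "(x \<bullet> \<zeta>)\<^sup>2 \<le> ?X\<^sup>2"
    using Cauchy_Schwarz_ineq2[of x \<zeta>] assms(1) by (simp add: abs_le_square_iff[symmetric])
  have b2: "?b\<^sup>2 \<le> 4 * t\<^sup>2 * ?X\<^sup>2"
    using mult_left_mono[OF xz, of "4 * t\<^sup>2"] by (simp add: power2_eq_square algebra_simps)
  have t2: "t\<^sup>2 \<le> 1" using assms by (simp add: power_le_one)
  have tx: "t\<^sup>2 * ?X\<^sup>2 \<le> ?X\<^sup>2" using mult_right_mono[OF t2, of "?X\<^sup>2"] by simp
  have "(norm (csq \<zeta> x (\<i> * of_real t)))\<^sup>2 = (?X\<^sup>2 - t\<^sup>2)\<^sup>2 + ?b\<^sup>2"
    unfolding c by (simp add: cmod_def)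
  also have "\<dots> \<le> (?X\<^sup>2 - t\<^sup>2)\<^sup>2 + 4 * t\<^sup>2 * ?X\<^sup>2" using b2 by simp
  also have "\<dots> = (?X\<^sup>2 + t\<^sup>2)\<^sup>2" by (simp add: power2_eq_square algebra_simps)
  finally have "norm (csq \<zeta> x (\<i> * of_real t)) \<le> ?X\<^sup>2 + t\<^sup>2"
    by (rule power2_le_imp_le) simp
  then show "norm (csq \<zeta> x (\<i> * of_real t)) \<le> ?X\<^sup>2 + 1" using t2 by simp
  have "Re ((csq \<zeta> x (\<i> * of_real t))\<^sup>2) = (?X\<^sup>2 - t\<^sup>2)\<^sup>2 - ?b\<^sup>2"
    unfolding c by (simp add: power2_eq_square)
  moreover have "(?X\<^sup>2 - t\<^sup>2)\<^sup>2 = ?X ^ 4 - 2 * (t\<^sup>2 * ?X\<^sup>2) + (t\<^sup>2)\<^sup>2"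
    by (simp add: power2_eq_square power4_eq_xxxx algebra_simps)
  moreover have "0 \<le> (t\<^sup>2)\<^sup>2" by simp
  ultimately show "Re ((csq \<zeta> x (\<i> * of_real t))\<^sup>2) \<ge> ?X ^ 4 - 6 * ?X\<^sup>2"
    using b2 tx by linarith
qed

text \<open>
  The exponential decay in \<open>z = r *\<^sub>R \<zeta>\<close> comes from a shift of the frequency variable by \<open>\<i> \<zeta>\<close>:
  the factor \<open>exp (\<i> z \<bullet> x)\<close> then picks up \<open>exp (- r)\<close>, while the quartic exponential stays integrable.
\<close>

lemma fourier_decay:
  fixes m :: "'a::euclidean_space \<Rightarrow> complex \<Rightarrow> complex"
  assumes z: "norm \<zeta> = 1" and r: "0 \<le> r"
    and hol: "\<And>x. m x holomorphic_on UNIV"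
    and tr: "\<And>x s w. m x (of_real s + w) = m (x + s *\<^sub>R \<zeta>) w"
    and cont: "continuous_on UNIV (\<lambda>p. m (fst p) (snd p))"
    and bd: "\<And>x t. 0 \<le> t \<Longrightarrow> t \<le> 1 \<Longrightarrow> norm (m x (\<i> * of_real t)) \<le> B * exp (2 * (norm x)\<^sup>2 + 3 * norm x)"
  shows "norm (LBINT x. m x 0 * of_real (exp (- (norm x ^ 4))) * exp (\<i> * of_real ((r *\<^sub>R \<zeta>) \<bullet> x)))
    \<le> B * exp 27 * (LBINT x. exp (- norm (x::'a))) * exp (- r)"
proof -
  define h where "h = (\<lambda>x w. m x w * exp (- (csq \<zeta> x w)\<^sup>2) * exp (\<i> * of_real r * (of_real (\<zeta> \<bullet> x) + w)))"
  have zz: "\<zeta> \<bullet> \<zeta> = 1" using z by (simp add: norm_eq_1)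
  have B: "0 \<le> B" using order_trans[OF norm_ge_zero bd[of 0 0]] by simp
  have hb: "norm (h x (\<i> * of_real t)) \<le> B * exp 27 * exp (- norm x) * exp (- r * t)"
    if t: "0 \<le> t" "t \<le> 1" for x t
  proof -
    have "norm (h x (\<i> * of_real t)) = norm (m x (\<i> * of_real t)) * exp (- Re ((csq \<zeta> x (\<i> * of_real t))\<^sup>2)) * exp (- r * t)"
      by (simp add: h_def norm_mult)
    also have "\<dots> \<le> (B * exp (2 * (norm x)\<^sup>2 + 3 * norm x)) * exp (- (norm x ^ 4 - 6 * (norm x)\<^sup>2)) * exp (- r * t)"
      using csq_imag(2)[OF z t, of x] bd[OF t] B by (intro mult_mono) auto
    also have "\<dots> = B * exp (2 * (norm x)\<^sup>2 + 3 * norm x - norm x ^ 4 + 6 * (norm x)\<^sup>2) * exp (- r * t)"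
      by (simp add: exp_add[symmetric] exp_diff exp_minus field_simps)
    also have "\<dots> \<le> B * exp (27 - norm x) * exp (- r * t)"
      using quartic_exponent_bound[of "norm x"] B by (intro mult_right_mono mult_left_mono) auto
    finally show ?thesis by (simp add: exp_diff exp_minus field_simps)
  qed
  have eI: "integrable lborel (\<lambda>x::'a. exp (- norm x))" using integrable_exp_norm[of 1] by simp
  have sh: "(LBINT x. h x \<i>) = (LBINT x. h x 0)"
  proof (rule contour_shift)
    show "h x holomorphic_on UNIV" for x
      unfolding h_def csq_def by (intro holomorphic_intros hol)
    show "h x (of_real s + w) = h (x + s *\<^sub>R \<zeta>) w" for x s w
      unfolding h_def tr csq_translate[OF z] by (simp add: inner_add_right zz algebra_simps)
    show "continuous_on UNIV (\<lambda>p. h (fst p) (snd p))"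
      unfolding h_def csq_def by (intro continuous_intros cont)
    show "integrable lborel (\<lambda>x::'a. B * exp 27 * exp (- norm x))"
      using eI by simp
    show "norm (h x (\<i> * of_real t)) \<le> B * exp 27 * exp (- norm x)" if "0 \<le> t" "t \<le> 1" for x t
    proof -
      have "B * exp 27 * exp (- norm x) * exp (- r * t) \<le> B * exp 27 * exp (- norm x) * 1"
        using that r B by (intro mult_left_mono) auto
      then show ?thesis using hb[OF that, of x] by linarith
    qed
  qed
  have "h x 0 = m x 0 * of_real (exp (- (norm x ^ 4))) * exp (\<i> * of_real ((r *\<^sub>R \<zeta>) \<bullet> x))" for x
    by (simp add: h_def csq_def exp_of_real[symmetric] inner_commute mult.assoc flip: power_mult)
  then have "(LBINT x. m x 0 * of_real (exp (- (norm x ^ 4))) * exp (\<i> * of_real ((r *\<^sub>R \<zeta>) \<bullet> x))) = (LBINT x. h x \<i>)"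
    using sh by simp
  moreover have "norm (LBINT x. h x \<i>) \<le> (LBINT x. (B * exp 27 * exp (- r)) * exp (- norm (x::'a)))"
  proof (rule Bochner_Integration.integral_norm_bound_integral[where g = "\<lambda>x. _ * exp (- norm x)"])
    have hb1: "norm (h x \<i>) \<le> B * exp 27 * exp (- r) * exp (- norm x)" for x
      using hb[of 1 x] by (simp add: mult_ac)
    show "integrable lborel (\<lambda>x::'a. B * exp 27 * exp (- r) * exp (- norm x))" using eI by simp
    then show "integrable lborel (\<lambda>x. h x \<i>)"
    proof (rule Bochner_Integration.integrable_bound)
      have "continuous_on UNIV (\<lambda>x. h x \<i>)"
      proof -
        have "continuous_on UNIV (\<lambda>x. m x \<i>)"
          using continuous_on_compose2[OF cont, of UNIV "\<lambda>x. (x, \<i>)"] by (simp add: continuous_intros)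
        then show ?thesis unfolding h_def csq_def by (intro continuous_intros)
      qed
      then show "(\<lambda>x. h x \<i>) \<in> borel_measurable lborel"
        using borel_measurable_continuous_onI by simp
      show "AE x in lborel. norm (h x \<i>) \<le> norm (B * exp 27 * exp (- r) * exp (- norm x))"
        using hb1 by (intro AE_I2) (metis abs_ge_self order_trans real_norm_def)
    qed
    show "norm (h x \<i>) \<le> B * exp 27 * exp (- r) * exp (- norm x)" for x by (rule hb1)
  qed
  ultimately show ?thesis by (simp add: mult_ac)
qed

text \<open>
  The index \<open>j\<close> is the order of differentiation in the direction \<open>\<nu>\<close>.
\<close>

definition kernel_c :: "'a::euclidean_space \<Rightarrow> real \<Rightarrow> nat \<Rightarrow> 'a \<Rightarrow> complex" where
  "kernel_c \<nu> \<mu> j z = of_real (1 / (2 * pi) ^ DIM('a)) *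
     (LBINT x. (\<i> * of_real (x \<bullet> \<nu>)) ^ j * of_real (exp (- (norm x ^ 4 + \<mu> * (norm x)\<^sup>2))) * exp (\<i> * of_real (z \<bullet> x)))"

definition kernel_bound :: "'a::euclidean_space itself \<Rightarrow> real" where
  "kernel_bound _ = exp 28 * (LBINT x. exp (- norm (x::'a)))"

lemma direction_exists: "\<exists>\<zeta>. norm \<zeta> = 1 \<and> z = norm z *\<^sub>R (\<zeta>::'a::euclidean_space)"
proof (cases "z = 0")
  case True
  obtain b :: 'a where "b \<in> Basis" using nonempty_Basis by blast
  then show ?thesis using True by (intro exI[of _ b]) auto
next
  case False
  then show ?thesis by (intro exI[of _ "z /\<^sub>R norm z"]) auto
qed

lemma inverse_pi_power: "0 \<le> 1 / (2 * pi) ^ n" "1 / (2 * pi) ^ n \<le> 1"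
proof -
  have "1 \<le> (2 * pi) ^ n" using pi_gt3 by (intro one_le_power) simp
  then show "0 \<le> 1 / (2 * pi) ^ n" "1 / (2 * pi) ^ n \<le> 1" by (auto simp: field_simps)
qed

lemma kernel_bound_nonneg: "0 \<le> kernel_bound TYPE('a::euclidean_space)"
  by (simp add: kernel_bound_def)

lemma kernel_c_decay:
  fixes \<nu> z :: "'a::euclidean_space"
  assumes \<nu>: "norm \<nu> \<le> 1" and \<mu>: "\<bar>\<mu>\<bar> \<le> 1" and j: "j \<le> 2"
  shows "norm (kernel_c \<nu> \<mu> j z) \<le> kernel_bound TYPE('a) * exp (- norm z)"
proof -
  obtain \<zeta> where z: "norm \<zeta> = 1" and zr: "z = norm z *\<^sub>R \<zeta>" using direction_exists by blast
  have zz: "\<zeta> \<bullet> \<zeta> = 1" using z by (simp add: norm_eq_1)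
  define m where "m = (\<lambda>x w. (\<i> * (of_real (x \<bullet> \<nu>) + w * of_real (\<zeta> \<bullet> \<nu>))) ^ j * exp (- of_real \<mu> * csq \<zeta> x w))"
  have "norm (LBINT x. m x 0 * of_real (exp (- (norm x ^ 4))) * exp (\<i> * of_real ((norm z *\<^sub>R \<zeta>) \<bullet> x)))
    \<le> exp 1 * exp 27 * (LBINT x. exp (- norm (x::'a))) * exp (- norm z)"
  proof (rule fourier_decay[OF z])
    show "m x holomorphic_on UNIV" for x
      unfolding m_def csq_def by (intro holomorphic_intros)
    show "m x (of_real s + w) = m (x + s *\<^sub>R \<zeta>) w" for x s w
      unfolding m_def csq_translate[OF z] by (simp add: inner_add_left algebra_simps)
    show "continuous_on UNIV (\<lambda>p. m (fst p) (snd p))"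
      unfolding m_def csq_def by (intro continuous_intros)
    show "norm (m x (\<i> * of_real t)) \<le> exp 1 * exp (2 * (norm x)\<^sup>2 + 3 * norm x)"
      if t: "0 \<le> t" "t \<le> 1" for x t
    proof -
      have a: "\<bar>x \<bullet> \<nu>\<bar> \<le> norm x" "\<bar>\<zeta> \<bullet> \<nu>\<bar> \<le> 1"
        using Cauchy_Schwarz_ineq2[of x \<nu>] Cauchy_Schwarz_ineq2[of \<zeta> \<nu>] \<nu> z
          mult_left_le[OF \<nu>, of "norm x"] by auto
      have "norm (of_real (x \<bullet> \<nu>) + \<i> * of_real t * of_real (\<zeta> \<bullet> \<nu>) :: complex) \<le> \<bar>x \<bullet> \<nu>\<bar> + t * \<bar>\<zeta> \<bullet> \<nu>\<bar>"
        using t by (intro norm_triangle_le) (simp add: norm_mult)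
      also have "\<dots> \<le> norm x + 1"
        using a t mult_mono[of t 1 "\<bar>\<zeta> \<bullet> \<nu>\<bar>" 1] by simp
      also have "\<dots> \<le> exp (norm x)" using exp_ge_add_one_self[of "norm x"] by (simp add: add.commute)
      finally have "norm (of_real (x \<bullet> \<nu>) + \<i> * of_real t * of_real (\<zeta> \<bullet> \<nu>) :: complex) ^ j \<le> exp (norm x) ^ j"
        by (rule power_mono) simp
      also have "\<dots> \<le> exp (norm x) ^ 2" using j by (intro power_increasing) auto
      also have "\<dots> = exp (2 * norm x)" by (simp add: exp_double)
      finally have 1: "norm (of_real (x \<bullet> \<nu>) + \<i> * of_real t * of_real (\<zeta> \<bullet> \<nu>) :: complex) ^ j \<le> exp (2 * norm x)" .
      have "Re (- of_real \<mu> * csq \<zeta> x (\<i> * of_real t)) \<le> norm (- of_real \<mu> * csq \<zeta> x (\<i> * of_real t))"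
        by (rule complex_Re_le_cmod)
      also have "\<dots> \<le> 1 * ((norm x)\<^sup>2 + 1)"
        unfolding norm_mult norm_minus_cancel norm_of_real using csq_imag(1)[OF z t] \<mu> by (intro mult_mono) auto
      finally have 2: "norm (exp (- of_real \<mu> * csq \<zeta> x (\<i> * of_real t))) \<le> exp ((norm x)\<^sup>2 + 1)"
        by simp
      have "norm (m x (\<i> * of_real t)) \<le> exp (2 * norm x) * exp ((norm x)\<^sup>2 + 1)"
        unfolding m_def norm_mult norm_power using 1 2
        by (intro mult_mono) (auto simp: norm_mult)
      also have "\<dots> \<le> exp 1 * exp (2 * (norm x)\<^sup>2 + 3 * norm x)"
        by (simp add: exp_add[symmetric])
      finally show ?thesis .
    qed
  qed simp
  also have "(\<lambda>x. m x 0 * of_real (exp (- (norm x ^ 4))) * exp (\<i> * of_real ((norm z *\<^sub>R \<zeta>) \<bullet> x)))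
      = (\<lambda>x. (\<i> * of_real (x \<bullet> \<nu>)) ^ j * of_real (exp (- (norm x ^ 4 + \<mu> * (norm x)\<^sup>2))) * exp (\<i> * of_real (z \<bullet> x)))"
    using zr by (auto simp: m_def csq_def exp_of_real[symmetric] exp_add[symmetric] exp_diff exp_minus field_simps fun_eq_iff)
  finally have "1 / (2 * pi) ^ DIM('a) * norm (LBINT x. (\<i> * of_real (x \<bullet> \<nu>)) ^ j * of_real (exp (- (norm x ^ 4 + \<mu> * (norm x)\<^sup>2))) * exp (\<i> * of_real (z \<bullet> x)))
    \<le> 1 * (exp 1 * exp 27 * (LBINT x. exp (- norm (x::'a))) * exp (- norm z))"
    using inverse_pi_power[of "DIM('a)"] by (intro mult_mono) auto
  then show ?thesis
    unfolding kernel_c_def norm_mult norm_of_real kernel_bound_def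
    using inverse_pi_power[of "DIM('a)"] by (simp add: exp_add[symmetric])
qed

lemma kernel_c_integrand:
  fixes \<nu> z :: "'a::euclidean_space"
  assumes \<nu>: "norm \<nu> \<le> 1" and \<mu>: "\<bar>\<mu>\<bar> \<le> 1" and j: "j \<le> 3"
  shows "integrable lborel (\<lambda>x. (\<i> * of_real (x \<bullet> \<nu>)) ^ j * of_real (exp (- (norm x ^ 4 + \<mu> * (norm x)\<^sup>2))) * exp (\<i> * of_real (z \<bullet> x)))"
    and "integrable lborel (\<lambda>x::'a. norm x ^ j * exp (- (norm x ^ 4 + \<mu> * (norm x)\<^sup>2)))"
    and "(LBINT x. norm (x::'a) ^ j * exp (- (norm x ^ 4 + \<mu> * (norm x)\<^sup>2))) \<le> kernel_bound TYPE('a)"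
    and "norm x ^ j * exp (- (norm x ^ 4 + \<mu> * (norm x)\<^sup>2)) \<le> exp 28 * exp (- norm (x::'a))"
proof -
  let ?m = "\<lambda>x::'a. norm x ^ j * exp (- \<mu> * (norm x)\<^sup>2)"
  have e: "norm x ^ j * exp (- (norm x ^ 4 + \<mu> * (norm x)\<^sup>2)) = ?m x * of_real (exp (- (norm x ^ 4)))" for x :: 'a
    by (simp add: exp_add[symmetric] exp_diff exp_minus field_simps)
  have b: "norm (?m x) \<le> exp 1 * exp (2 * (norm x)\<^sup>2 + 3 * norm x)" for x
  proof -
    have "norm x ^ j \<le> exp (norm x) ^ j"
      using exp_ge_add_one_self[of "norm x"] by (intro power_mono) (linarith, simp)
    also have "\<dots> \<le> exp (norm x) ^ 3" using j by (intro power_increasing) auto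
    also have "\<dots> = exp (3 * norm x)" by (simp add: exp_of_nat_mult[of 3, simplified])
    finally have 1: "norm x ^ j \<le> exp (3 * norm x)" .
    have "- \<mu> * (norm x)\<^sup>2 \<le> 1 * (norm x)\<^sup>2" using \<mu> by (intro mult_right_mono) auto
    then have "norm (?m x) \<le> exp (3 * norm x) * exp ((norm x)\<^sup>2)"
      using 1 by (auto simp: abs_mult intro!: mult_mono)
    also have "\<dots> \<le> exp 1 * exp (2 * (norm x)\<^sup>2 + 3 * norm x)"
      using zero_le_power2[of "norm x"] by (simp add: exp_add[symmetric] del: zero_le_power2)
    finally show ?thesis .
  qed
  have m: "?m \<in> borel_measurable borel" by measurable
  show *: "norm x ^ j * exp (- (norm x ^ 4 + \<mu> * (norm x)\<^sup>2)) \<le> exp 28 * exp (- norm x)" for x :: 'a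
    using integrable_quartic(2)[OF m b, of x] unfolding e by (simp add: exp_add[symmetric])
  show i: "integrable lborel (\<lambda>x::'a. norm x ^ j * exp (- (norm x ^ 4 + \<mu> * (norm x)\<^sup>2)))"
    unfolding e by (rule integrable_quartic(1)[OF m b])
  have "(LBINT x. norm (x::'a) ^ j * exp (- (norm x ^ 4 + \<mu> * (norm x)\<^sup>2))) \<le> (LBINT x. exp 28 * exp (- norm (x::'a)))"
    using integrable_exp_norm[of 1, where 'a='a] by (intro integral_mono i *) auto
  then show "(LBINT x. norm (x::'a) ^ j * exp (- (norm x ^ 4 + \<mu> * (norm x)\<^sup>2))) \<le> kernel_bound TYPE('a)"
    by (simp add: kernel_bound_def)
  show "integrable lborel (\<lambda>x. (\<i> * of_real (x \<bullet> \<nu>)) ^ j * of_real (exp (- (norm x ^ 4 + \<mu> * (norm x)\<^sup>2))) * exp (\<i> * of_real (z \<bullet> x)))"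
  proof (rule Bochner_Integration.integrable_bound[OF i])
    show "(\<lambda>x. (\<i> * of_real (x \<bullet> \<nu>)) ^ j * of_real (exp (- (norm x ^ 4 + \<mu> * (norm x)\<^sup>2))) * exp (\<i> * of_real (z \<bullet> x)))
       \<in> borel_measurable lborel" by measurable
    have "\<bar>x \<bullet> \<nu>\<bar> ^ j \<le> norm x ^ j" for x
      using Cauchy_Schwarz_ineq2[of x \<nu>] mult_left_le[OF \<nu>, of "norm x"] by (intro power_mono) auto
    then show "AE x in lborel. norm ((\<i> * of_real (x \<bullet> \<nu>)) ^ j * of_real (exp (- (norm x ^ 4 + \<mu> * (norm x)\<^sup>2))) * exp (\<i> * of_real (z \<bullet> x)))
       \<le> norm (norm x ^ j * exp (- (norm x ^ 4 + \<mu> * (norm x)\<^sup>2)))"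
      by (intro AE_I2) (simp add: norm_mult norm_power)
  qed
qed


lemma norm_exp_diff_one: "norm (exp w - 1 :: complex) \<le> norm w * exp (norm w)"
proof -
  have "norm (exp w - exp 0) \<le> exp (norm w) * norm (w - 0)"
  proof (rule field_differentiable_bound[where S = "cball 0 (norm w)"])
    show "(exp has_field_derivative exp z) (at z within cball 0 (norm w))" for z :: complex
      by (auto intro!: derivative_eq_intros)
    show "norm (exp z) \<le> exp (norm w)" if "z \<in> cball 0 (norm w)" for z :: complex
      using that complex_Re_le_cmod[of z] by simp
  qed auto
  then show ?thesis by (simp add: mult.commute)
qed

text \<open>
  The difference has the multiplier \<open>exp (- \<mu> |x|\<^sup>2) - 1\<close>, which is of order \<open>\<mu>\<close>.
\<close>

lemma kernel_c_perturbation: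
  fixes \<nu> z :: "'a::euclidean_space"
  assumes \<mu>: "\<bar>\<mu>\<bar> \<le> 1"
  shows "norm (kernel_c \<nu> \<mu> 0 z - kernel_c \<nu> 0 0 z) \<le> \<bar>\<mu>\<bar> * kernel_bound TYPE('a) * exp (- norm z)"
proof -
  obtain \<zeta> where z: "norm \<zeta> = 1" and zr: "z = norm z *\<^sub>R \<zeta>" using direction_exists by blast
  define m where "m = (\<lambda>x w. exp (- of_real \<mu> * csq \<zeta> x w) - 1)"
  let ?f = "\<lambda>\<mu> x. (\<i> * of_real (x \<bullet> 0)) ^ 0 * of_real (exp (- (norm x ^ 4 + \<mu> * (norm x)\<^sup>2))) * exp (\<i> * of_real (z \<bullet> x))"
  have "norm (LBINT x. m x 0 * of_real (exp (- (norm x ^ 4))) * exp (\<i> * of_real ((norm z *\<^sub>R \<zeta>) \<bullet> x)))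
    \<le> \<bar>\<mu>\<bar> * exp 1 * exp 27 * (LBINT x. exp (- norm (x::'a))) * exp (- norm z)"
  proof (rule fourier_decay[OF z])
    show "m x holomorphic_on UNIV" for x
      unfolding m_def csq_def by (intro holomorphic_intros)
    show "m x (of_real s + w) = m (x + s *\<^sub>R \<zeta>) w" for x s w
      unfolding m_def csq_translate[OF z] by simp
    show "continuous_on UNIV (\<lambda>p. m (fst p) (snd p))"
      unfolding m_def csq_def by (intro continuous_intros)
    show "norm (m x (\<i> * of_real t)) \<le> \<bar>\<mu>\<bar> * exp 1 * exp (2 * (norm x)\<^sup>2 + 3 * norm x)"
      if t: "0 \<le> t" "t \<le> 1" for x t
    proof -
      let ?S = "csq \<zeta> x (\<i> * of_real t)"
      have S: "norm ?S \<le> (norm x)\<^sup>2 + 1" by (rule csq_imag(1)[OF z t])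
      have \<mu>S: "norm (- of_real \<mu> * ?S) \<le> 1 * ((norm x)\<^sup>2 + 1)"
        unfolding norm_mult norm_minus_cancel norm_of_real using S \<mu> by (intro mult_mono) auto
      have "(norm x)\<^sup>2 + 1 \<le> exp ((norm x)\<^sup>2)"
        using exp_ge_add_one_self[of "(norm x)\<^sup>2"] by linarith
      then have S': "norm ?S \<le> exp ((norm x)\<^sup>2)" using S by linarith
      have "norm (m x (\<i> * of_real t)) \<le> norm (- of_real \<mu> * ?S) * exp (norm (- of_real \<mu> * ?S))"
        unfolding m_def by (rule norm_exp_diff_one)
      also have "\<dots> \<le> (\<bar>\<mu>\<bar> * exp ((norm x)\<^sup>2)) * exp ((norm x)\<^sup>2 + 1)"
      proof (rule mult_mono)
        show "norm (- of_real \<mu> * ?S) \<le> \<bar>\<mu>\<bar> * exp ((norm x)\<^sup>2)"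
          unfolding norm_mult norm_minus_cancel norm_of_real using S' by (intro mult_left_mono) auto
        show "exp (norm (- of_real \<mu> * ?S)) \<le> exp ((norm x)\<^sup>2 + 1)" using \<mu>S by simp
      qed auto
      also have "\<dots> = \<bar>\<mu>\<bar> * exp 1 * exp (2 * (norm x)\<^sup>2)"
        by (simp add: exp_add[symmetric])
      also have "\<dots> \<le> \<bar>\<mu>\<bar> * exp 1 * exp (2 * (norm x)\<^sup>2 + 3 * norm x)"
        by (intro mult_left_mono) auto
      finally show ?thesis .
    qed
  qed simp
  also have "(\<lambda>x. m x 0 * of_real (exp (- (norm x ^ 4))) * exp (\<i> * of_real ((norm z *\<^sub>R \<zeta>) \<bullet> x)))
      = (\<lambda>x. ?f \<mu> x - ?f 0 x)"
    using zr by (auto simp: m_def csq_def exp_of_real[symmetric] exp_add[symmetric] exp_diff exp_minus field_simps fun_eq_iff)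
  also have "(LBINT x. ?f \<mu> x - ?f 0 x) = (LBINT x. ?f \<mu> x) - (LBINT x. ?f 0 x)"
    by (intro Bochner_Integration.integral_diff kernel_c_integrand(1)) (use \<mu> in auto)
  finally have "1 / (2 * pi) ^ DIM('a) * norm ((LBINT x. ?f \<mu> x) - (LBINT x. ?f 0 x))
      \<le> 1 * (\<bar>\<mu>\<bar> * exp 1 * exp 27 * (LBINT x. exp (- norm (x::'a))) * exp (- norm z))"
    using inverse_pi_power[of "DIM('a)"] by (intro mult_mono) auto
  then show ?thesis
    unfolding kernel_c_def right_diff_distrib[symmetric] norm_mult norm_of_real kernel_bound_def
    using inverse_pi_power[of "DIM('a)"] exp_add[of 1 "27::real"] by (simp add: mult_ac)
qed

lemma kernel_c_lipschitz:
  fixes \<nu> z :: "'a::euclidean_space"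
  assumes \<nu>: "norm \<nu> \<le> 1" and \<mu>: "\<bar>\<mu>\<bar> \<le> 1" and j: "j \<le> 2"
  shows "norm (kernel_c \<nu> \<mu> j z - kernel_c \<nu> \<mu> j z') \<le> kernel_bound TYPE('a) * norm (z - z')"
proof -
  let ?w = "\<lambda>x::'a. exp (- (norm x ^ 4 + \<mu> * (norm x)\<^sup>2))"
  let ?f = "\<lambda>z x. (\<i> * of_real (x \<bullet> \<nu>)) ^ j * of_real (?w x) * exp (\<i> * of_real (z \<bullet> x))"
  have i: "integrable lborel (?f z)" for z
    using kernel_c_integrand(1)[OF \<nu> \<mu>] j by simp
  have d: "norm (?f z x - ?f z' x) \<le> norm (z - z') * (norm x ^ Suc j * ?w x)" for x
  proof -
    have "norm (exp (\<i> * of_real (z \<bullet> x)) - exp (\<i> * of_real (z' \<bullet> x)) :: complex)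
        = norm (exp (\<i> * of_real (z' \<bullet> x)) * (iexp ((z - z') \<bullet> x) - 1))"
      by (simp add: inner_diff_left algebra_simps flip: exp_add)
    also have "\<dots> = norm (iexp ((z - z') \<bullet> x) - 1)" by (simp add: norm_mult)
    also have "\<dots> \<le> \<bar>(z - z') \<bullet> x\<bar>"
      using iexp_approx1[of "(z - z') \<bullet> x" 0] by simp
    also have "\<dots> \<le> norm (z - z') * norm x" by (rule Cauchy_Schwarz_ineq2)
    finally have 1: "norm (exp (\<i> * of_real (z \<bullet> x)) - exp (\<i> * of_real (z' \<bullet> x)) :: complex) \<le> norm (z - z') * norm x" .
    have 2: "\<bar>x \<bullet> \<nu>\<bar> ^ j \<le> norm x ^ j"
      using Cauchy_Schwarz_ineq2[of x \<nu>] mult_left_le[OF \<nu>, of "norm x"] by (intro power_mono) auto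
    have "norm (?f z x - ?f z' x) = (\<bar>x \<bullet> \<nu>\<bar> ^ j * ?w x) * norm (exp (\<i> * of_real (z \<bullet> x)) - exp (\<i> * of_real (z' \<bullet> x)) :: complex)"
      unfolding right_diff_distrib[symmetric] by (simp add: norm_mult norm_power)
    also have "\<dots> \<le> (norm x ^ j * ?w x) * (norm (z - z') * norm x)"
      using 1 2 by (intro mult_mono mult_right_mono) auto
    finally show ?thesis by (simp add: mult_ac)
  qed
  have i3: "integrable lborel (\<lambda>x::'a. norm (z - z') * (norm x ^ Suc j * ?w x))"
    using kernel_c_integrand(2)[OF \<nu> \<mu>, of "Suc j"] j by simp
  have "norm (LBINT x. ?f z x - ?f z' x) \<le> (LBINT x. norm (z - z') * (norm (x::'a) ^ Suc j * ?w x))"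
    by (rule Bochner_Integration.integral_norm_bound_integral) (intro Bochner_Integration.integrable_diff i i3 d)+
  also have "\<dots> \<le> norm (z - z') * kernel_bound TYPE('a)"
    using kernel_c_integrand(3)[OF \<nu> \<mu>, of "Suc j"] j by (simp add: mult_left_mono)
  finally have "1 / (2 * pi) ^ DIM('a) * norm (LBINT x. ?f z x - ?f z' x) \<le> 1 * (norm (z - z') * kernel_bound TYPE('a))"
    using inverse_pi_power[of "DIM('a)"] by (intro mult_mono) auto
  then show ?thesis
    unfolding kernel_c_def right_diff_distrib[symmetric] Bochner_Integration.integral_diff[OF i i, symmetric]
      norm_mult norm_of_real
    using inverse_pi_power[of "DIM('a)"] by (simp add: mult_ac)
qed

lemma kernel_c_taylor:
  fixes \<nu> z :: "'a::euclidean_space"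
  assumes \<nu>: "norm \<nu> \<le> 1" and \<mu>: "\<bar>\<mu>\<bar> \<le> 1" and j: "j \<le> 1"
  shows "norm (kernel_c \<nu> \<mu> j (z + s *\<^sub>R \<nu>) - kernel_c \<nu> \<mu> j z - of_real s * kernel_c \<nu> \<mu> (Suc j) z)
    \<le> kernel_bound TYPE('a) * s\<^sup>2"
proof -
  let ?w = "\<lambda>x::'a. exp (- (norm x ^ 4 + \<mu> * (norm x)\<^sup>2))"
  let ?f = "\<lambda>j z x. (\<i> * of_real (x \<bullet> \<nu>)) ^ j * of_real (?w x) * exp (\<i> * of_real (z \<bullet> x))"
  let ?z = "z + s *\<^sub>R \<nu>"
  have i: "integrable lborel (?f k z)" if "k \<le> 2" for k z
    using kernel_c_integrand(1)[OF \<nu> \<mu>] that by simp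
  have ii: "integrable lborel (?f j z)" "integrable lborel (?f j ?z)" "integrable lborel (\<lambda>x. of_real s * ?f (Suc j) z x)"
    by (intro integrable_mult_right i; use j in simp)+
  have d: "norm (?f j ?z x - ?f j z x - of_real s * ?f (Suc j) z x) \<le> s\<^sup>2 * (norm x ^ (j + 2) * ?w x)" for x
  proof -
    have xn: "\<bar>x \<bullet> \<nu>\<bar> \<le> norm x"
      using Cauchy_Schwarz_ineq2[of x \<nu>] mult_left_le[OF \<nu>, of "norm x"] by auto
    let ?t = "s * (x \<bullet> \<nu>)"
    have e: "?f j ?z x - ?f j z x - of_real s * ?f (Suc j) z x
        = ?f j z x * (iexp ?t - 1 - \<i> * of_real ?t)"
      by (simp add: inner_add_left inner_commute[of \<nu> x] exp_add algebra_simps)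
    have a: "norm (?f j z x) \<le> norm x ^ j * ?w x"
      using xn by (auto simp: norm_mult norm_power intro!: mult_right_mono power_mono)
    have b: "norm (iexp ?t - 1 - \<i> * of_real ?t) \<le> ?t\<^sup>2"
    proof -
      have "norm (iexp ?t - 1 - \<i> * of_real ?t) \<le> \<bar>?t\<bar>\<^sup>2 / 2"
        using iexp_approx1[of ?t 1] by (simp add: algebra_simps power2_eq_square)
      also have "\<dots> \<le> ?t\<^sup>2" by simp
      finally show ?thesis .
    qed
    have c: "?t\<^sup>2 \<le> s\<^sup>2 * (norm x)\<^sup>2"
      using xn power_mono[OF xn, of 2] by (simp add: power_mult_distrib mult_left_mono)
    have "norm (?f j z x * (iexp ?t - 1 - \<i> * of_real ?t)) \<le> (norm x ^ j * ?w x) * (s\<^sup>2 * (norm x)\<^sup>2)"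
      unfolding norm_mult[of "?f j z x"] by (intro mult_mono a order_trans[OF b c]) auto
    then have "norm (?f j ?z x - ?f j z x - of_real s * ?f (Suc j) z x) \<le> (norm x ^ j * ?w x) * (s\<^sup>2 * (norm x)\<^sup>2)"
      by (simp only: e)
    then show ?thesis by (simp only: power_add mult_ac)
  qed
  have i3: "integrable lborel (\<lambda>x::'a. s\<^sup>2 * (norm x ^ (j + 2) * ?w x))"
    using kernel_c_integrand(2)[OF \<nu> \<mu>, of "j + 2"] j by simp
  have "norm (LBINT x. ?f j ?z x - ?f j z x - of_real s * ?f (Suc j) z x) \<le> (LBINT x. s\<^sup>2 * (norm (x::'a) ^ (j + 2) * ?w x))"
    by (rule Bochner_Integration.integral_norm_bound_integral) (intro Bochner_Integration.integrable_diff ii i3 d)+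
  also have "\<dots> \<le> s\<^sup>2 * kernel_bound TYPE('a)"
    using kernel_c_integrand(3)[OF \<nu> \<mu>, of "j + 2"] j by (simp add: mult_left_mono)
  finally have "1 / (2 * pi) ^ DIM('a) * norm (LBINT x. ?f j ?z x - ?f j z x - of_real s * ?f (Suc j) z x) \<le> 1 * (s\<^sup>2 * kernel_bound TYPE('a))"
    using inverse_pi_power[of "DIM('a)"] by (intro mult_mono) auto
  moreover have "kernel_c \<nu> \<mu> j ?z - kernel_c \<nu> \<mu> j z - of_real s * kernel_c \<nu> \<mu> (Suc j) z
      = of_real (1 / (2 * pi) ^ DIM('a)) * (LBINT x. ?f j ?z x - ?f j z x - of_real s * ?f (Suc j) z x)"
  proof -
    have "(LBINT x. ?f j ?z x - ?f j z x - of_real s * ?f (Suc j) z x)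
        = (LBINT x. ?f j ?z x) - (LBINT x. ?f j z x) - of_real s * (LBINT x. ?f (Suc j) z x)"
      using ii by (simp only: Bochner_Integration.integral_diff Bochner_Integration.integrable_diff integral_mult_right_zero)
    note q = this
    show ?thesis unfolding kernel_c_def q by (simp only: right_diff_distrib mult.left_commute)
  qed
  ultimately show ?thesis
    using inverse_pi_power[of "DIM('a)"] by (simp only: norm_mult norm_of_real abs_of_nonneg mult_1_left) (simp add: mult_ac)
qed

lemma kernel_c_uminus:
  fixes \<nu> z :: "'a::euclidean_space"
  shows "kernel_c \<nu> \<mu> j (- z) = (-1) ^ j * kernel_c \<nu> \<mu> j z"
proof -
  let ?f = "\<lambda>z x. (\<i> * of_real (x \<bullet> \<nu>)) ^ j * of_real (exp (- (norm x ^ 4 + \<mu> * (norm x)\<^sup>2))) * exp (\<i> * of_real (z \<bullet> x))"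
  have "(LBINT x. ?f (- z) x) = (LBINT x. ?f (- z) (- x))"
    by (rule lborel_integral_reflect[symmetric]) measurable
  also have "(\<lambda>x. ?f (- z) (- x)) = (\<lambda>x. (-1) ^ j * ?f z x)"
  proof
    fix x
    have "(\<i> * of_real (- x \<bullet> \<nu>)) ^ j = (-1) ^ j * (\<i> * of_real (x \<bullet> \<nu>)) ^ j"
      by (simp add: power_mult_distrib[symmetric])
    then show "?f (- z) (- x) = (-1) ^ j * ?f z x" by (simp add: mult_ac)
  qed
  finally show ?thesis unfolding kernel_c_def by simp
qed

lemma kernel_c_real: "kernel_c \<nu> \<mu> j z \<in> \<real>" for z :: "'a::euclidean_space"
proof -
  let ?f = "\<lambda>x. (\<i> * of_real (x \<bullet> \<nu>)) ^ j * of_real (exp (- (norm x ^ 4 + \<mu> * (norm x)\<^sup>2))) * exp (\<i> * of_real (z \<bullet> x))"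
  have "cnj (LBINT x. ?f x) = (LBINT x. cnj (?f x))"
    by (rule Bochner_Integration.integral_cnj[symmetric])
  also have "\<dots> = (LBINT x. ?f (- x))" by (simp add: exp_cnj)
  also have "\<dots> = (LBINT x. ?f x)"
    by (rule lborel_integral_reflect) measurable
  finally have "(LBINT x. ?f x) \<in> \<real>" by (simp only: Reals_cnj_iff)
  then show ?thesis unfolding kernel_c_def by (intro Reals_mult) auto
qed

definition kernel :: "'a::euclidean_space \<Rightarrow> real \<Rightarrow> nat \<Rightarrow> 'a \<Rightarrow> real" where
  "kernel \<nu> \<mu> j z = Re (kernel_c \<nu> \<mu> j z)"

lemma of_real_kernel: "of_real (kernel \<nu> \<mu> j z) = kernel_c \<nu> \<mu> j z"
  using kernel_c_real[of \<nu> \<mu> j z] by (simp add: kernel_def)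

lemma kernel_0_indep: "kernel \<nu> \<mu> 0 = kernel \<nu>' \<mu> 0"
  by (simp add: kernel_def kernel_c_def fun_eq_iff)

context
  fixes \<nu> :: "'a::euclidean_space" and \<mu> :: real
  assumes \<nu>: "norm \<nu> \<le> 1" and \<mu>: "\<bar>\<mu>\<bar> \<le> 1"
begin

lemma kernel_decay: "j \<le> 2 \<Longrightarrow> \<bar>kernel \<nu> \<mu> j z\<bar> \<le> kernel_bound TYPE('a) * exp (- norm z)"
  unfolding kernel_def using kernel_c_decay[OF \<nu> \<mu>, of j z] abs_Re_le_cmod order_trans by blast

lemma kernel_perturbation: "\<bar>kernel \<nu> \<mu> 0 z - kernel \<nu> 0 0 z\<bar> \<le> \<bar>\<mu>\<bar> * kernel_bound TYPE('a) * exp (- norm z)"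
  unfolding kernel_def using kernel_c_perturbation[OF \<mu>, of \<nu> z] abs_Re_le_cmod[of "kernel_c \<nu> \<mu> 0 z - kernel_c \<nu> 0 0 z"]
  by simp

lemma kernel_continuous: "j \<le> 2 \<Longrightarrow> continuous_on UNIV (kernel \<nu> \<mu> j)"
proof -
  assume j: "j \<le> 2"
  have "(kernel_bound TYPE('a))-lipschitz_on UNIV (kernel_c \<nu> \<mu> j)"
    using kernel_c_lipschitz[OF \<nu> \<mu> j] kernel_bound_nonneg by (intro lipschitz_onI) (auto simp: dist_norm)
  then have "continuous_on UNIV (kernel_c \<nu> \<mu> j)" by (rule lipschitz_on_continuous_on)
  then show ?thesis unfolding kernel_def by (intro continuous_intros)
qed

lemma kernel_measurable: "j \<le> 2 \<Longrightarrow> kernel \<nu> \<mu> j \<in> borel_measurable borel"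
  using kernel_continuous by (rule borel_measurable_continuous_onI)

lemma kernel_integrable: "j \<le> 2 \<Longrightarrow> integrable lborel (kernel \<nu> \<mu> j)"
proof (rule Bochner_Integration.integrable_bound)
  show "integrable lborel (\<lambda>z::'a. kernel_bound TYPE('a) * exp (- norm z))"
    using integrable_exp_norm[of 1, where 'a='a] by simp
  show "j \<le> 2 \<Longrightarrow> kernel \<nu> \<mu> j \<in> borel_measurable lborel" using kernel_measurable by simp
  show "j \<le> 2 \<Longrightarrow> AE z in lborel. norm (kernel \<nu> \<mu> j z) \<le> norm (kernel_bound TYPE('a) * exp (- norm z))"
    using kernel_decay kernel_bound_nonneg[where 'a='a] by (intro AE_I2) (simp add: abs_mult)
qed

lemma kernel_uminus: "kernel \<nu> \<mu> j (- z) = (-1) ^ j * kernel \<nu> \<mu> j z"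
proof -
  have "of_real (kernel \<nu> \<mu> j (- z)) = (of_real ((-1) ^ j * kernel \<nu> \<mu> j z) :: complex)"
    by (simp add: of_real_kernel kernel_c_uminus)
  then show ?thesis by (simp only: of_real_eq_iff)
qed

lemma kernel_DERIV:
  assumes j: "j \<le> 1"
  shows "((\<lambda>s. kernel \<nu> \<mu> j (z + s *\<^sub>R \<nu>)) has_real_derivative kernel \<nu> \<mu> (Suc j) (z + s *\<^sub>R \<nu>)) (at s)"
proof -
  let ?C = "kernel_bound TYPE('a)" and ?k = "\<lambda>s. kernel \<nu> \<mu> j (z + s *\<^sub>R \<nu>)" and ?d = "kernel \<nu> \<mu> (Suc j) (z + s *\<^sub>R \<nu>)"
  have t: "\<bar>?k (s + h) - ?k s - h * ?d\<bar> \<le> ?C * h\<^sup>2" for h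
  proof -
    have "of_real (?k (s + h) - ?k s - h * ?d) = kernel_c \<nu> \<mu> j ((z + s *\<^sub>R \<nu>) + h *\<^sub>R \<nu>) - kernel_c \<nu> \<mu> j (z + s *\<^sub>R \<nu>)
        - of_real h * kernel_c \<nu> \<mu> (Suc j) (z + s *\<^sub>R \<nu>)"
      by (simp add: of_real_kernel algebra_simps)
    then show ?thesis
      using kernel_c_taylor[OF \<nu> \<mu> j, of "z + s *\<^sub>R \<nu>" h] by (metis norm_of_real)
  qed
  have "((\<lambda>h. (?k (s + h) - ?k s) / h - ?d) \<longlongrightarrow> 0) (at 0)"
  proof (rule Lim_null_comparison)
    show "\<forall>\<^sub>F h in at 0. norm ((?k (s + h) - ?k s) / h - ?d) \<le> ?C * \<bar>h\<bar>"
      unfolding eventually_at_filter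
    proof (intro always_eventually allI impI)
      fix h :: real assume h: "h \<noteq> 0"
      have "norm ((?k (s + h) - ?k s) / h - ?d) = \<bar>?k (s + h) - ?k s - h * ?d\<bar> / \<bar>h\<bar>"
        using h by (simp add: abs_divide[symmetric] diff_divide_distrib)
      also have "\<dots> \<le> ?C * h\<^sup>2 / \<bar>h\<bar>" by (intro divide_right_mono t) simp
      also have "\<dots> = ?C * \<bar>h\<bar>" using h by (simp add: power2_eq_square field_simps abs_if)
      finally show "norm ((?k (s + h) - ?k s) / h - ?d) \<le> ?C * \<bar>h\<bar>" .
    qed
    have "((\<lambda>h. ?C * \<bar>h\<bar>) \<longlongrightarrow> ?C * \<bar>0\<bar>) (at (0::real))" by (intro tendsto_intros)
    then show "((\<lambda>h. ?C * \<bar>h\<bar>) \<longlongrightarrow> 0) (at (0::real))" by simp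
  qed
  then show ?thesis unfolding DERIV_def by (rule LIM_zero_cancel)
qed

end


text \<open>
  Fubini's theorem in the form used below, with a majorant of product type.
\<close>

lemma lborel_swap:
  fixes f :: "'a::euclidean_space \<Rightarrow> 'b::euclidean_space \<Rightarrow> 'c::{banach, second_countable_topology}"
  assumes [measurable]: "(\<lambda>p. f (fst p) (snd p)) \<in> borel_measurable (borel \<Otimes>\<^sub>M borel)"
    and g: "integrable lborel g" and h: "integrable lborel h"
    and b: "\<And>x y. norm (f x y) \<le> g x * h y"
  shows "(LBINT x. (LBINT y. f x y)) = (LBINT y. (LBINT x. f x y))"
proof -
  have [measurable]: "g \<in> borel_measurable borel" "h \<in> borel_measurable borel"
    using borel_measurable_integrable[OF g] borel_measurable_integrable[OF h] by auto
  have fm: "f x \<in> borel_measurable borel" for x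
  proof -
    have "(\<lambda>y::'b. (x, y)) \<in> measurable borel (borel \<Otimes>\<^sub>M borel)" by measurable
    from measurable_compose[OF this assms(1)] show ?thesis by simp
  qed
  have fi: "integrable lborel (f x)" for x
  proof (rule Bochner_Integration.integrable_bound)
    show "integrable lborel (\<lambda>y. g x * h y)" using h by simp
    show "AE y in lborel. norm (f x y) \<le> norm (g x * h y)"
      using b by (intro AE_I2) (metis abs_ge_self order_trans real_norm_def)
  qed (use fm in simp)
  have int: "integrable (lborel \<Otimes>\<^sub>M lborel) (\<lambda>(x, y). f x y)"
  proof (rule lborel_pair.Fubini_integrable)
    show m: "(\<lambda>(x, y). f x y) \<in> borel_measurable (lborel \<Otimes>\<^sub>M lborel)"
      by (simp add: case_prod_beta') measurable
    show "integrable lborel (\<lambda>x. \<integral>y. norm ((\<lambda>(x, y). f x y) (x, y)) \<partial>lborel)"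
    proof (rule Bochner_Integration.integrable_bound)
      show "integrable lborel (\<lambda>x. g x * (LBINT y. h y))" using g by simp
      show "(\<lambda>x. \<integral>y. norm ((\<lambda>(x, y). f x y) (x, y)) \<partial>lborel) \<in> borel_measurable lborel"
        by (simp add: case_prod_beta') measurable
      show "AE x in lborel. norm (LBINT y. norm ((\<lambda>(x, y). f x y) (x, y))) \<le> norm (g x * (LBINT y. h y))"
      proof (rule AE_I2)
        fix x
        have "(LBINT y. norm (f x y)) \<le> (LBINT y. g x * h y)"
          using fi h b by (intro integral_mono) auto
        then show "norm (LBINT y. norm ((\<lambda>(x, y). f x y) (x, y))) \<le> norm (g x * (LBINT y. h y))"
          by (simp add: integral_nonneg_AE)
      qed
    qed
    show "AE x in lborel. integrable lborel (\<lambda>y. (\<lambda>(x, y). f x y) (x, y))"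
      using fi by simp
  qed
  show ?thesis
    by (rule lborel_pair.Fubini_integral[OF int, symmetric])
qed

text \<open>
  Fourier inversion by Gaussian regularization: for the damping factor \<open>g (\<delta> z)\<close> with \<open>g = exp (- |z|\<^sup>2 / 2)\<close>
  the integrals may be interchanged, and the transform of the Gaussian concentrates at \<open>\<eta>\<close> as \<open>\<delta>\<close> tends to zero.
\<close>

lemma kernel_fourier:
  fixes \<eta> :: "'a::euclidean_space"
  assumes \<mu>: "\<bar>\<mu>\<bar> \<le> 1"
  shows "(LBINT z. kernel_c 0 \<mu> 0 z * exp (\<i> * of_real (z \<bullet> \<eta>))) = of_real (exp (- (norm \<eta> ^ 4 + \<mu> * (norm \<eta>)\<^sup>2)))"
proof -
  define w where "w = (\<lambda>x::'a. exp (- (norm x ^ 4 + \<mu> * (norm x)\<^sup>2)))"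
  define g where "g = (\<lambda>x::'a. exp (- (norm x)\<^sup>2 / 2))"
  define G where "G = sqrt (2 * pi) ^ DIM('a)"
  define c where "c = 1 / (2 * pi) ^ DIM('a)"
  define A where "A = (\<lambda>\<delta>::real. \<integral>z. kernel_c (0::'a) \<mu> 0 z * exp (\<i> * of_real (z \<bullet> \<eta>)) * of_real (g (\<delta> *\<^sub>R z)) \<partial>lborel)"
  have [measurable]: "w \<in> borel_measurable borel" "g \<in> borel_measurable borel"
    unfolding w_def g_def by measurable
  have wi: "integrable lborel w"
    using kernel_c_integrand(2)[of "0::'a" \<mu> 0] \<mu> by (simp add: w_def)
  have wb: "w x \<le> exp 28" for x
  proof -
    have "w x \<le> exp 28 * exp (- norm x)"
      using kernel_c_integrand(4)[of "0::'a" \<mu> 0 x] \<mu> by (simp add: w_def)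
    also have "\<dots> \<le> exp 28 * 1" by (intro mult_left_mono) auto
    finally show ?thesis by simp
  qed
  have wn: "0 \<le> w x" for x by (simp add: w_def)
  have gi: "integrable lborel g" and gG: "integral\<^sup>L lborel g = G"
    unfolding g_def G_def using gaussian_integral by auto
  have gn: "0 \<le> g x" "g x \<le> 1" for x by (auto simp: g_def)
  have km[measurable]: "kernel_c (0::'a) \<mu> 0 \<in> borel_measurable borel"
    using kernel_measurable[of "0::'a" \<mu> 0] \<mu> unfolding of_real_kernel[symmetric] by simp
  have ki: "integrable lborel (\<lambda>z::'a. norm (kernel_c (0::'a) \<mu> 0 z))"
    using kernel_integrable[of "0::'a" \<mu> 0] \<mu> unfolding of_real_kernel[symmetric] norm_of_real by simp
  have "G * G = (sqrt (2 * pi) * sqrt (2 * pi)) ^ DIM('a)"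
    unfolding G_def by (rule power_mult_distrib[symmetric])
  then have cG: "c * G * G = 1"
    unfolding c_def by (simp add: mult.assoc)
  have AR: "A \<delta> = of_real (c * G * (LBINT x. w (- \<eta> + \<delta> *\<^sub>R x) * g x))" if d: "\<delta> > 0" for \<delta>
  proof -
    have gdi: "integrable lborel (\<lambda>z. g (\<delta> *\<^sub>R z))"
      using lborel_integrable_affine[OF _ gi, of \<delta> 0] d by simp
    let ?F = "\<lambda>z x. of_real (w x) * exp (\<i> * of_real (z \<bullet> x)) * exp (\<i> * of_real (z \<bullet> \<eta>)) * of_real (g (\<delta> *\<^sub>R z)) :: complex"
    have inner: "(LBINT z. exp (\<i> * of_real (z \<bullet> (x + \<eta>))) * of_real (g (\<delta> *\<^sub>R z)))
        = of_real ((1 / \<delta>) ^ DIM('a) * G * g ((1 / \<delta>) *\<^sub>R (x + \<eta>)))" for x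
    proof -
      have "(LBINT z. exp (\<i> * of_real (z \<bullet> (x + \<eta>))) * of_real (g (\<delta> *\<^sub>R z)))
          = \<bar>1 / \<delta>\<bar> ^ DIM('a) *\<^sub>R (LBINT z. exp (\<i> * of_real ((0 + (1 / \<delta>) *\<^sub>R z) \<bullet> (x + \<eta>))) * of_real (g (\<delta> *\<^sub>R (0 + (1 / \<delta>) *\<^sub>R z))))"
        by (rule lborel_integral_affine) (use d in auto)
      also have "\<dots> = \<bar>1 / \<delta>\<bar> ^ DIM('a) *\<^sub>R (LBINT z. exp (\<i> * of_real (z \<bullet> ((1 / \<delta>) *\<^sub>R (x + \<eta>)))) * of_real (g z))"
        using d by simp
      also have "\<dots> = of_real ((1 / \<delta>) ^ DIM('a) * G * g ((1 / \<delta>) *\<^sub>R (x + \<eta>)))"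
        unfolding g_def gaussian_fourier G_def using d by (simp add: scaleR_conv_of_real)
      finally show ?thesis .
    qed
    have "A \<delta> = (LBINT z. of_real c * (LBINT x. ?F z x))"
    proof -
      have "kernel_c 0 \<mu> 0 z * exp (\<i> * of_real (z \<bullet> \<eta>)) * of_real (g (\<delta> *\<^sub>R z)) = of_real c * (LBINT x. ?F z x)" for z
        unfolding kernel_c_def c_def w_def by simp
      then show ?thesis unfolding A_def by (simp only:)
    qed
    also have "\<dots> = of_real c * (LBINT z. (LBINT x. ?F z x))"
      by (rule integral_mult_right_zero)
    also have "(LBINT z. (LBINT x. ?F z x)) = (LBINT x. (LBINT z. ?F z x))"
    proof (rule lborel_swap)
      show "norm (?F z x) \<le> g (\<delta> *\<^sub>R z) * w x" for z x
        using wn gn by (simp add: norm_mult)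
    qed (use gdi wi in auto)
    also have "\<dots> = (LBINT x. of_real (w x * ((1 / \<delta>) ^ DIM('a) * G * g ((1 / \<delta>) *\<^sub>R (x + \<eta>)))))"
    proof (rule Bochner_Integration.integral_cong[OF refl])
      fix x
      have "(LBINT z. ?F z x) = (LBINT z. of_real (w x) * (exp (\<i> * of_real (z \<bullet> (x + \<eta>))) * of_real (g (\<delta> *\<^sub>R z))))"
        by (simp add: inner_add_right exp_add algebra_simps)
      also have "\<dots> = of_real (w x) * (LBINT z. (exp (\<i> * of_real (z \<bullet> (x + \<eta>))) * of_real (g (\<delta> *\<^sub>R z))))"
        by (rule integral_mult_right_zero)
      finally show "(LBINT z. ?F z x) = of_real (w x * ((1 / \<delta>) ^ DIM('a) * G * g ((1 / \<delta>) *\<^sub>R (x + \<eta>))))"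
        unfolding inner by simp
    qed
    also have "\<dots> = of_real (LBINT x. w x * ((1 / \<delta>) ^ DIM('a) * G * g ((1 / \<delta>) *\<^sub>R (x + \<eta>))))"
      by (rule integral_complex_of_real)
    also have "(LBINT x. w x * ((1 / \<delta>) ^ DIM('a) * G * g ((1 / \<delta>) *\<^sub>R (x + \<eta>))))
       = \<bar>\<delta>\<bar> ^ DIM('a) *\<^sub>R (LBINT x. w (- \<eta> + \<delta> *\<^sub>R x) * ((1 / \<delta>) ^ DIM('a) * G * g ((1 / \<delta>) *\<^sub>R ((- \<eta> + \<delta> *\<^sub>R x) + \<eta>))))"
      by (rule lborel_integral_affine) (use d in auto)
    also have "\<dots> = \<delta> ^ DIM('a) * (LBINT x. ((1 / \<delta>) ^ DIM('a) * G) * (w (- \<eta> + \<delta> *\<^sub>R x) * g x))"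
      using d by (simp add: mult_ac)
    also have "\<dots> = G * (LBINT x. w (- \<eta> + \<delta> *\<^sub>R x) * g x)"
      using d by (simp add: power_one_over)
    finally show ?thesis by simp
  qed
  let ?\<delta> = "\<lambda>n. inverse (real (Suc n))"
  have \<delta>0: "?\<delta> \<longlonglongrightarrow> 0" by (rule LIMSEQ_inverse_real_of_nat)
  have "(\<lambda>n. A (?\<delta> n)) \<longlonglongrightarrow> (LBINT z. kernel_c (0::'a) \<mu> 0 z * exp (\<i> * of_real (z \<bullet> \<eta>)))"
    unfolding A_def
  proof (rule integral_dominated_convergence)
    show "integrable lborel (\<lambda>z::'a. norm (kernel_c (0::'a) \<mu> 0 z))" by (rule ki)
    show "AE z in lborel. (\<lambda>n. kernel_c (0::'a) \<mu> 0 z * exp (\<i> * of_real (z \<bullet> \<eta>)) * of_real (g (?\<delta> n *\<^sub>R z)))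
        \<longlonglongrightarrow> kernel_c 0 \<mu> 0 z * exp (\<i> * of_real (z \<bullet> \<eta>))"
    proof (rule AE_I2)
      fix z
      have "(\<lambda>n. g (?\<delta> n *\<^sub>R z)) \<longlonglongrightarrow> exp (- (norm ((0::real) *\<^sub>R z))\<^sup>2 / 2)"
        unfolding g_def by (intro tendsto_intros \<delta>0) auto
      then have "(\<lambda>n. g (?\<delta> n *\<^sub>R z)) \<longlonglongrightarrow> 1" by simp
      then have "(\<lambda>n. kernel_c (0::'a) \<mu> 0 z * exp (\<i> * of_real (z \<bullet> \<eta>)) * of_real (g (?\<delta> n *\<^sub>R z)))
        \<longlonglongrightarrow> kernel_c 0 \<mu> 0 z * exp (\<i> * of_real (z \<bullet> \<eta>)) * of_real 1"
        by (intro tendsto_intros)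
      then show "(\<lambda>n. kernel_c (0::'a) \<mu> 0 z * exp (\<i> * of_real (z \<bullet> \<eta>)) * of_real (g (?\<delta> n *\<^sub>R z)))
        \<longlonglongrightarrow> kernel_c 0 \<mu> 0 z * exp (\<i> * of_real (z \<bullet> \<eta>))" by simp
    qed
    show "AE z in lborel. norm (kernel_c (0::'a) \<mu> 0 z * exp (\<i> * of_real (z \<bullet> \<eta>)) * of_real (g (?\<delta> n *\<^sub>R z))) \<le> norm (kernel_c (0::'a) \<mu> 0 z)" for n
      using gn by (intro AE_I2) (simp add: norm_mult mult_left_le)
  qed auto
  moreover have "(\<lambda>n. A (?\<delta> n)) \<longlonglongrightarrow> of_real (w \<eta>)"
  proof -
    have "(\<lambda>n. \<integral>x. w (- \<eta> + ?\<delta> n *\<^sub>R x) * g x \<partial>lborel) \<longlonglongrightarrow> (LBINT x. w \<eta> * g x)"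
    proof (rule integral_dominated_convergence)
      show "integrable lborel (\<lambda>x. exp 28 * g x)" using gi by simp
      show "AE x in lborel. (\<lambda>n. w (- \<eta> + ?\<delta> n *\<^sub>R x) * g x) \<longlonglongrightarrow> w \<eta> * g x"
      proof (rule AE_I2)
        fix x
        have "(\<lambda>n. w (- \<eta> + ?\<delta> n *\<^sub>R x) * g x) \<longlonglongrightarrow> w (- \<eta> + 0 *\<^sub>R x) * g x"
          unfolding w_def by (intro tendsto_intros \<delta>0)
        then show "(\<lambda>n. w (- \<eta> + ?\<delta> n *\<^sub>R x) * g x) \<longlonglongrightarrow> w \<eta> * g x" by (simp add: w_def)
      qed
      show "AE x in lborel. norm (w (- \<eta> + ?\<delta> n *\<^sub>R x) * g x) \<le> exp 28 * g x" for n
        using wn wb gn by (intro AE_I2) (simp add: abs_mult mult_right_mono)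
    qed auto
    then have "(\<lambda>n. of_real (c * G * (LBINT x. w (- \<eta> + ?\<delta> n *\<^sub>R x) * g x)) :: complex) \<longlonglongrightarrow> of_real (c * G * (LBINT x. w \<eta> * g x))"
      by (intro tendsto_intros)
    moreover have "c * G * (LBINT x. w \<eta> * g x) = w \<eta>"
      using cG by (simp add: gG mult_ac)
    moreover have "A (?\<delta> n) = of_real (c * G * (LBINT x. w (- \<eta> + ?\<delta> n *\<^sub>R x) * g x))" for n
      by (rule AR) simp
    ultimately show ?thesis by (simp only:)
  qed
  ultimately show ?thesis
    unfolding w_def by (rule LIMSEQ_unique)
qed

lemma kernel_integral_one:
  assumes "\<bar>\<mu>\<bar> \<le> 1"
  shows "(LBINT z. kernel \<nu> \<mu> 0 (z::'a::euclidean_space)) = 1"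
proof -
  have "(LBINT z. kernel_c (0::'a) \<mu> 0 z * exp (\<i> * of_real (z \<bullet> 0))) = 1"
    using kernel_fourier[OF assms, of 0] by simp
  then have "(LBINT z. of_real (kernel (0::'a) \<mu> 0 z)) = (1::complex)"
    by (simp add: of_real_kernel)
  then have "of_real (LBINT z. kernel (0::'a) \<mu> 0 z) = (1::complex)"
    by (simp only: integral_complex_of_real)
  then show ?thesis using kernel_0_indep[of \<nu> \<mu> 0] by simp
qed

section \<open>Integration along the fibres over a hyperplane\<close>

abbreviation hyper :: "'a::euclidean_space \<Rightarrow> 'a \<Rightarrow> 'a" where
  "hyper \<nu> z \<equiv> z - (z \<bullet> \<nu>) *\<^sub>R \<nu>"

text \<open>
  Integration over lines in direction \<open>\<nu>\<close> first. Instead of an integral over the orthogonal hyperplane the outer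
  integral extends over the whole space, with a probability density in the direction \<open>\<nu>\<close>; for functions that are constant in
  this direction both agree. The proof inserts a factor one, the integral of the density along the line,
  and uses only Tonelli's theorem and translation invariance, so that no orthonormal basis has to be chosen.
\<close>

lemma nn_integral_fibres:
  fixes \<nu> :: "'a::euclidean_space" and f :: "'a \<Rightarrow> ennreal"
  assumes \<nu>: "norm \<nu> = 1" and [measurable]: "f \<in> borel_measurable borel"
  shows "(\<integral>\<^sup>+z. f z \<partial>lborel) = (\<integral>\<^sup>+z. ennreal (std_normal_density (z \<bullet> \<nu>)) * (\<integral>\<^sup>+s. f (z + s *\<^sub>R \<nu>) \<partial>lborel) \<partial>lborel)"
proof -
  let ?\<rho> = "std_normal_density"
  have \<nu>\<nu>: "\<nu> \<bullet> \<nu> = 1" using \<nu> by (simp add: norm_eq_1)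
  have one: "(\<integral>\<^sup>+s. ennreal (?\<rho> (c - s)) \<partial>lborel) = 1" for c
  proof -
    have "(\<integral>\<^sup>+s. ennreal (?\<rho> s) \<partial>lborel) = 1"
      using integral_normal_density[of 1 0] integrable_normal_density[of 1 0]
      by (subst nn_integral_eq_integral) auto
    also have "(\<integral>\<^sup>+s. ennreal (?\<rho> s) \<partial>lborel) = (\<integral>\<^sup>+s. ennreal (?\<rho> (c - s)) \<partial>lborel)"
      using nn_integral_real_affine[of "\<lambda>s. ennreal (?\<rho> s)" "-1" c] by simp
    finally show ?thesis by simp
  qed
  have tr: "(\<integral>\<^sup>+z. h (t + z) \<partial>lborel) = (\<integral>\<^sup>+z. h z \<partial>lborel)" if "h \<in> borel_measurable borel" for h and t :: 'a
    using that nn_integral_distr[of "(+) t" lborel borel h] by (simp add: lborel_distr_plus)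
  have "(\<integral>\<^sup>+z. f z \<partial>lborel) = (\<integral>\<^sup>+z. f z * (\<integral>\<^sup>+s. ennreal (?\<rho> (z \<bullet> \<nu> - s)) \<partial>lborel) \<partial>lborel)"
    by (simp add: one)
  also have "\<dots> = (\<integral>\<^sup>+z. (\<integral>\<^sup>+s. f z * ennreal (?\<rho> (z \<bullet> \<nu> - s)) \<partial>lborel) \<partial>lborel)"
    by (simp add: nn_integral_cmult)
  also have "\<dots> = (\<integral>\<^sup>+s. (\<integral>\<^sup>+z. f z * ennreal (?\<rho> (z \<bullet> \<nu> - s)) \<partial>lborel) \<partial>lborel)"
    by (rule lborel_pair.Fubini') measurable
  also have "\<dots> = (\<integral>\<^sup>+s. (\<integral>\<^sup>+z. f (s *\<^sub>R \<nu> + z) * ennreal (?\<rho> ((s *\<^sub>R \<nu> + z) \<bullet> \<nu> - s)) \<partial>lborel) \<partial>lborel)"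
    by (intro nn_integral_cong tr[symmetric]) measurable
  also have "\<dots> = (\<integral>\<^sup>+s. (\<integral>\<^sup>+z. f (z + s *\<^sub>R \<nu>) * ennreal (?\<rho> (z \<bullet> \<nu>)) \<partial>lborel) \<partial>lborel)"
    by (simp add: inner_add_left \<nu>\<nu> add.commute)
  also have "\<dots> = (\<integral>\<^sup>+z. (\<integral>\<^sup>+s. f (z + s *\<^sub>R \<nu>) * ennreal (?\<rho> (z \<bullet> \<nu>)) \<partial>lborel) \<partial>lborel)"
    by (rule lborel_pair.Fubini'[symmetric]) measurable
  also have "\<dots> = (\<integral>\<^sup>+z. ennreal (?\<rho> (z \<bullet> \<nu>)) * (\<integral>\<^sup>+s. f (z + s *\<^sub>R \<nu>) \<partial>lborel) \<partial>lborel)"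
    by (simp add: nn_integral_multc mult.commute)
  finally show ?thesis .
qed

lemma lborel_fibres:
  fixes \<nu> :: "'a::euclidean_space"
  assumes \<nu>: "norm \<nu> = 1"
  shows "distr (density (lborel \<Otimes>\<^sub>M lborel) (\<lambda>p. ennreal (std_normal_density (fst p \<bullet> \<nu>)))) borel (\<lambda>p. fst p + snd p *\<^sub>R \<nu>) = lborel"
    (is "distr (density ?M ?d) borel ?T = _")
proof (rule measure_eqI)
  have Tm[measurable]: "?T \<in> measurable (lborel \<Otimes>\<^sub>M lborel) borel" by measurable
  have dm[measurable]: "?d \<in> borel_measurable (lborel \<Otimes>\<^sub>M lborel)" by measurable
  fix A assume "A \<in> sets (distr (density ?M ?d) borel ?T)"
  then have A[measurable]: "A \<in> sets borel" by simp
  have "emeasure (distr (density ?M ?d) borel ?T) A = (\<integral>\<^sup>+p. indicator A p \<partial>distr (density ?M ?d) borel ?T)"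
    using A by simp
  also have "\<dots> = (\<integral>\<^sup>+p. indicator A (?T p) \<partial>density ?M ?d)"
    by (rule nn_integral_distr) auto
  also have "\<dots> = (\<integral>\<^sup>+p. ?d p * indicator A (?T p) \<partial>?M)"
    by (rule nn_integral_density) auto
  also have "\<dots> = (\<integral>\<^sup>+z. (\<integral>\<^sup>+s. ?d (z, s) * indicator A (?T (z, s)) \<partial>lborel) \<partial>lborel)"
    by (rule lborel.nn_integral_fst[symmetric]) auto
  also have "\<dots> = (\<integral>\<^sup>+z. ennreal (std_normal_density (z \<bullet> \<nu>)) * (\<integral>\<^sup>+s. indicator A (z + s *\<^sub>R \<nu>) \<partial>lborel) \<partial>lborel)"
    by (simp add: nn_integral_cmult)
  also have "\<dots> = (\<integral>\<^sup>+z. indicator A z \<partial>lborel)"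
    by (rule nn_integral_fibres[OF \<nu>, symmetric]) auto
  finally show "emeasure (distr (density ?M ?d) borel ?T) A = emeasure lborel A" by simp
qed simp

lemma integral_fibres:
  fixes \<nu> :: "'a::euclidean_space" and f :: "'a \<Rightarrow> real"
  assumes \<nu>: "norm \<nu> = 1" and f: "integrable lborel f"
  shows "integrable lborel (\<lambda>z. std_normal_density (z \<bullet> \<nu>) * (LBINT s. f (z + s *\<^sub>R \<nu>)))"
    and "(LBINT z. f z) = (LBINT z. std_normal_density (z \<bullet> \<nu>) * (LBINT s. f (z + s *\<^sub>R \<nu>)))"
proof -
  let ?d = "\<lambda>p::'a \<times> real. std_normal_density (fst p \<bullet> \<nu>)" and ?T = "\<lambda>p::'a \<times> real. fst p + snd p *\<^sub>R \<nu>"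
  have [measurable]: "f \<in> borel_measurable borel" using borel_measurable_integrable[OF f] by simp
  have [measurable]: "?T \<in> measurable (lborel \<Otimes>\<^sub>M lborel) borel" "?d \<in> borel_measurable (lborel \<Otimes>\<^sub>M lborel)"
    by measurable
  have i: "integrable (lborel \<Otimes>\<^sub>M lborel) (\<lambda>p. ?d p *\<^sub>R f (?T p))"
    using f by (subst (asm) lborel_fibres[OF \<nu>, symmetric]) (simp add: integrable_distr_eq integrable_density)
  have e: "(LBINT z. f z) = (\<integral>p. ?d p *\<^sub>R f (?T p) \<partial>(lborel \<Otimes>\<^sub>M lborel))"
    by (subst lborel_fibres[OF \<nu>, symmetric]) (simp add: integral_distr integral_density)
  show "integrable lborel (\<lambda>z. std_normal_density (z \<bullet> \<nu>) * (LBINT s. f (z + s *\<^sub>R \<nu>)))"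
    using lborel_pair.integrable_fst'[OF i] by simp
  show "(LBINT z. f z) = (LBINT z. std_normal_density (z \<bullet> \<nu>) * (LBINT s. f (z + s *\<^sub>R \<nu>)))"
    unfolding e using lborel_pair.integral_fst'[OF i, symmetric] by simp
qed


section \<open>Inequalities for the sine integral\<close>

lemma DERIV_Si_chain [derivative_intros]:
  "(g has_real_derivative g') (at x within s) \<Longrightarrow> ((\<lambda>x. Si (g x)) has_real_derivative sinc (g x) * g') (at x within s)"
  using DERIV_chain2[OF DERIV_Si] by blast

lemma sin_upper_5:
  fixes x :: real
  assumes "0 \<le> x"
  shows "sin x \<le> x - x ^ 3 / 6 + x ^ 5 / 120"
proof -
  have "(\<Sum>m<5. sin_coeff m * x ^ m) = x - x ^ 3 / 6"
    by (simp add: lessThan_nat_numeral sin_coeff_def fact_numeral)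
  moreover have "inverse (fact 5) * \<bar>x\<bar> ^ 5 = x ^ 5 / 120"
    using assms by (simp add: fact_numeral)
  ultimately show ?thesis using Maclaurin_sin_bound[of x 5] by linarith
qed

lemma sin_lower_7:
  fixes x :: real
  assumes "0 \<le> x"
  shows "x - x ^ 3 / 6 + x ^ 5 / 120 - x ^ 7 / 5040 \<le> sin x"
proof -
  have "(\<Sum>m<7. sin_coeff m * x ^ m) = x - x ^ 3 / 6 + x ^ 5 / 120"
    by (simp add: lessThan_nat_numeral sin_coeff_def fact_numeral)
  moreover have "inverse (fact 7) * \<bar>x\<bar> ^ 7 = x ^ 7 / 5040"
    using assms by (simp add: fact_numeral)
  ultimately show ?thesis using Maclaurin_sin_bound[of x 7] by linarith
qed

text \<open>
  Both bounds compare \<open>sin (pi / 6) = 1 / 2\<close> with Taylor polynomials at nearby rational points.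
\<close>

lemma pi_bounds: "157 / 50 < pi" "pi < 63 / 20"
proof -
  have "sin (157 / 300 :: real) < 1 / 2"
    using sin_upper_5[of "157 / 300"] by (simp add: power_divide)
  then have "sin (157 / 300) < sin (pi / 6)" by (simp add: sin_30)
  then have "\<not> pi / 6 \<le> 157 / 300"
    using sin_monotone_2pi_le[of "pi / 6" "157 / 300"] pi_gt3 by linarith
  then show "157 / 50 < pi" by simp
  have "1 / 2 < sin (21 / 40 :: real)"
    using sin_lower_7[of "21 / 40"] by (simp add: power_divide)
  then have "sin (pi / 6) < sin (21 / 40)" by (simp add: sin_30)
  then have "\<not> 21 / 40 \<le> pi / 6"
    using sin_monotone_2pi_le[of "21 / 40" "pi / 6"] pi_gt3 by linarith
  then show "pi < 63 / 20" by simp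
qed

lemma Si_0 [simp]: "Si 0 = 0"
  by (simp add: Si_def zero_ereal_def)

lemma Si_minus: "Si (- x) = - Si x"
  using Si_neg[of x] Si_neg[of "- x"] by (cases "0 \<le> x") auto

lemma Si_lower_7:
  assumes "0 \<le> y"
  shows "y - y ^ 3 / 18 + y ^ 5 / 600 - y ^ 7 / 35280 \<le> Si y"
proof -
  let ?f = "\<lambda>y. Si y - (y - y ^ 3 / 18 + y ^ 5 / 600 - y ^ 7 / 35280)"
  have "?f 0 \<le> ?f y"
  proof (rule DERIV_nonneg_imp_nondecreasing[OF assms])
    fix x :: real assume x: "0 \<le> x" "x \<le> y"
    have "(?f has_real_derivative sinc x - (1 - x\<^sup>2 / 6 + x ^ 4 / 120 - x ^ 6 / 5040)) (at x)"
      by (auto intro!: derivative_eq_intros simp: field_simps)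
    moreover have "0 \<le> sinc x - (1 - x\<^sup>2 / 6 + x ^ 4 / 120 - x ^ 6 / 5040)"
    proof (cases "x = 0")
      case False
      then have "(x - x ^ 3 / 6 + x ^ 5 / 120 - x ^ 7 / 5040) / x \<le> sin x / x"
        using sin_lower_7[of x] x by (intro divide_right_mono) auto
      moreover have "(x - x ^ 3 / 6 + x ^ 5 / 120 - x ^ 7 / 5040) / x = 1 - x\<^sup>2 / 6 + x ^ 4 / 120 - x ^ 6 / 5040"
        using False by (simp add: field_simps eval_nat_numeral)
      ultimately show ?thesis using False by simp
    qed simp
    ultimately show "\<exists>d. (?f has_real_derivative d) (at x) \<and> 0 \<le> d" by blast
  qed
  then show ?thesis by simp
qed

lemma Si_mono_first_arch:
  assumes "0 \<le> a" "a \<le> b" "b \<le> pi"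
  shows "Si a \<le> Si b"
proof (rule DERIV_nonneg_imp_nondecreasing[OF assms(2)])
  fix x assume "a \<le> x" "x \<le> b"
  then have "0 \<le> sinc x" using assms sin_ge_zero[of x] by auto
  then show "\<exists>d. (Si has_real_derivative d) (at x) \<and> 0 \<le> d" using DERIV_Si by blast
qed

lemma Si_antimono_second_arch:
  assumes "pi \<le> a" "a \<le> b" "b \<le> 2 * pi"
  shows "Si b \<le> Si a"
proof (rule DERIV_nonpos_imp_nonincreasing[OF assms(2)])
  fix x assume x: "a \<le> x" "x \<le> b"
  then have "0 < x" using assms pi_gt_zero by linarith
  moreover have "sin x \<le> 0" using sin_le_zero[of x] x assms by (cases "x = 2 * pi") auto
  ultimately have "sinc x \<le> 0" by (simp add: divide_nonpos_pos)
  then show "\<exists>d. (Si has_real_derivative d) (at x) \<and> d \<le> 0" using DERIV_Si by blast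
qed

lemma Si_pos: "0 < y \<Longrightarrow> y \<le> pi \<Longrightarrow> 0 < Si y"
proof -
  assume y: "0 < y" "y \<le> pi"
  let ?m = "min y 1"
  have m: "0 < ?m" "?m \<le> 1" using y by auto
  have "?m ^ 3 \<le> ?m ^ 1" "?m ^ 7 \<le> ?m ^ 1" "0 \<le> ?m ^ 5"
    using m by (intro power_decreasing zero_le_power; simp)+
  then have "?m ^ 3 \<le> ?m" "?m ^ 7 \<le> ?m" "0 \<le> ?m ^ 5" by (simp_all only: power_one_right)
  then have "0 < Si ?m" using Si_lower_7[of ?m] m by linarith
  also have "Si ?m \<le> Si y" using y by (intro Si_mono_first_arch) auto
  finally show ?thesis .
qed

text \<open>
  The derivative \<open>sin x * (1 / x - 1 / pi)\<close> is nonnegative, since both factors change sign at \<open>pi\<close>.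
\<close>

lemma Si_plus_cos_mono:
  assumes "0 \<le> a" "a \<le> b" "b \<le> 2 * pi"
  shows "Si a + cos a / pi \<le> Si b + cos b / pi"
proof (rule DERIV_nonneg_imp_nondecreasing[OF assms(2), of "\<lambda>t. Si t + cos t / pi"])
  fix x assume x: "a \<le> x" "x \<le> b"
  have "((\<lambda>t. Si t + cos t / pi) has_real_derivative sinc x - sin x / pi) (at x)"
    by (auto intro!: derivative_eq_intros)
  moreover have "0 \<le> sinc x - sin x / pi"
  proof (cases "x = 0")
    case False
    then have x0: "0 < x" using x assms by simp
    have e: "sinc x - sin x / pi = sin x * (pi - x) / (x * pi)" using x0 by (simp add: field_simps)
    have "0 \<le> sin x * (pi - x)"
    proof (cases "x \<le> pi")
      case True
      then show ?thesis using x0 sin_ge_zero[of x] by simp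
    next
      case F: False
      have "sin x \<le> 0" using sin_le_zero[of x] F x assms by (cases "x = 2 * pi") auto
      then show ?thesis using F by (intro mult_nonpos_nonpos) auto
    qed
    then show ?thesis unfolding e using x0 by simp
  qed simp
  ultimately show "\<exists>d. ((\<lambda>t. Si t + cos t / pi) has_real_derivative d) (at x) \<and> 0 \<le> d" by blast
qed

text \<open>
  On the second arch the sine is negative, and the convex function \<open>1 / x\<close> lies below its chord. The sine times the
  chord has an elementary primitive.
\<close>

lemma Si_chord:
  assumes "pi \<le> a" "a \<le> b" "b \<le> 2 * pi"
  shows "cos a / a - cos b / b + (sin a - sin b) / (a * b) \<le> Si b - Si a"
proof -
  have ab: "0 < a" "0 < b" using assms pi_gt_zero by linarith+
  let ?\<alpha> = "1 / a + 1 / b" and ?\<beta> = "- 1 / (a * b)"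
  let ?f = "\<lambda>t. Si t + (?\<alpha> + ?\<beta> * t) * cos t - ?\<beta> * sin t"
  have "?f a \<le> ?f b"
  proof (rule DERIV_nonneg_imp_nondecreasing[OF assms(2)])
    fix x assume x: "a \<le> x" "x \<le> b"
    have x0: "0 < x" using ab x by simp
    have "(?f has_real_derivative sinc x - (?\<alpha> + ?\<beta> * x) * sin x) (at x)"
      using ab by (auto intro!: derivative_eq_intros)
    moreover have "0 \<le> sinc x - (?\<alpha> + ?\<beta> * x) * sin x"
    proof -
      have e: "sinc x - (?\<alpha> + ?\<beta> * x) * sin x = (- sin x) * ((x - a) * (b - x)) / (x * a * b)"
        using x0 ab by (simp add: field_simps)
      have "sin x \<le> 0" using sin_le_zero[of x] x assms by (cases "x = 2 * pi") auto
      then show ?thesis unfolding e using x x0 ab by (intro divide_nonneg_pos mult_nonneg_nonneg) auto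
    qed
    ultimately show "\<exists>d. (?f has_real_derivative d) (at x) \<and> 0 \<le> d" by blast
  qed
  moreover have "?\<alpha> + ?\<beta> * a = 1 / a" "?\<alpha> + ?\<beta> * b = 1 / b" using ab by (auto simp: field_simps)
  ultimately show ?thesis by (simp add: diff_divide_distrib)
qed

lemma cos_3_half_pi: "cos (3 * pi / 2) = 0" and sin_3_half_pi': "sin (3 * pi / 2) = -1"
  using cos_3over2_pi sin_3over2_pi by auto

text \<open>
  One chord over the whole arch would give \<open>3 / (2 * pi) > 47 / 100\<close>, which is too weak for the positivity
  argument below; two chords suffice.
\<close>

lemma Si_second_arch_drop: "Si pi - Si (2 * pi) \<le> 9 / 20"
proof -
  have 1: "- 1 / pi + 1 / (pi * (3 * pi / 2)) \<le> Si (3 * pi / 2) - Si pi"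
    using Si_chord[of pi "3 * pi / 2"] by (simp add: cos_3_half_pi sin_3_half_pi')
  have 2: "- 1 / (2 * pi) - 1 / (3 * pi / 2 * (2 * pi)) \<le> Si (2 * pi) - Si (3 * pi / 2)"
    using Si_chord[of "3 * pi / 2" "2 * pi"] by (simp add: cos_3_half_pi sin_3_half_pi')
  have "Si pi - Si (2 * pi) \<le> 3 / (2 * pi) - 1 / (3 * (pi * pi))"
    using 1 2 by (simp add: field_simps)
  also have "\<dots> \<le> 9 / 20"
  proof -
    have "14 / 100 * (15 / 2) \<le> (pi - 3) * (27 / 10 * pi - 9 / 10)"
      using pi_bounds by (intro mult_mono) auto
    moreover have "(pi - 3) * (27 / 10 * pi - 9 / 10) = 27 / 10 * (pi * pi) - 9 * pi + 27 / 10"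
      by (simp add: field_simps)
    ultimately have "9 * pi - 2 \<le> 27 / 10 * (pi * pi)" by linarith
    then show ?thesis by (simp add: field_simps)
  qed
  finally show ?thesis .
qed

lemma Si_half_pi: "34 / 25 \<le> Si (pi / 2)"
proof -
  have p: "(157 / 100) < pi / 2" using pi_bounds by simp
  have "34 / 25 \<le> Si (157 / 100)" using Si_lower_7[of "157 / 100"] by (simp add: power_divide)
  also have "Si (157 / 100) \<le> Si (pi / 2)" using p by (intro Si_mono_first_arch) auto
  finally show ?thesis .
qed

text \<open>
  The integral of \<open>sin x / x\<close> over the second half of the first arch is bounded below by means of the tangent
  \<open>1 - x / 4\<close> of \<open>1 / x\<close> at the point 2.
\<close>

lemma Si_two_pi: "137 / 100 \<le> Si (2 * pi)"
proof -
  let ?f = "\<lambda>t::real. Si t + (1 - t / 4) * cos t + sin t / 4"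
  have "?f (pi / 2) \<le> ?f pi"
  proof (rule DERIV_nonneg_imp_nondecreasing[where f = ?f])
    fix x assume x: "pi / 2 \<le> x" "x \<le> pi"
    have x0: "0 < x" using x pi_gt_zero by linarith
    have "(?f has_real_derivative sinc x - (1 - x / 4) * sin x) (at x)"
      by (auto intro!: derivative_eq_intros)
    moreover have "0 \<le> sinc x - (1 - x / 4) * sin x"
    proof -
      have e: "sinc x - (1 - x / 4) * sin x = sin x * (x - 2)\<^sup>2 / (4 * x)"
        using x0 by (simp add: field_simps power2_eq_square)
      show ?thesis unfolding e using x x0 sin_ge_zero[of x] by simp
    qed
    ultimately show "\<exists>d. (?f has_real_derivative d) (at x) \<and> 0 \<le> d" by blast
  qed simp
  then show ?thesis
    using Si_second_arch_drop Si_half_pi pi_bounds by simp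
qed

text \<open>
  One integration by parts leaves the integrand \<open>- cos x / x\<^sup>2\<close>, and adding or subtracting \<open>1 / x\<close> fixes its sign.
\<close>

lemma Si_asymptotic_mono:
  assumes "0 < a" "a \<le> b"
  shows "Si a + cos a / a - 1 / a \<le> Si b + cos b / b - 1 / b"
    and "Si b + cos b / b + 1 / b \<le> Si a + cos a / a + 1 / a"
proof -
  have d: "((\<lambda>t. Si t + cos t / t + c / t) has_real_derivative (- cos x - c) / x\<^sup>2) (at x)" if "0 < x" for x c :: real
    using that by (auto intro!: derivative_eq_intros simp: field_simps power2_eq_square)
  have "(\<lambda>t. Si t + cos t / t + (-1) / t) a \<le> (\<lambda>t. Si t + cos t / t + (-1) / t) b"
  proof (rule DERIV_nonneg_imp_nondecreasing[OF assms(2)])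
    fix x assume "a \<le> x" "x \<le> b"
    then have "0 < x" using assms by simp
    moreover have "0 \<le> (- cos x - (-1)) / x\<^sup>2" by simp
    ultimately show "\<exists>y. ((\<lambda>t. Si t + cos t / t + (-1) / t) has_real_derivative y) (at x) \<and> 0 \<le> y"
      using d[of x "-1"] by blast
  qed
  then show "Si a + cos a / a - 1 / a \<le> Si b + cos b / b - 1 / b" by simp
  have "(\<lambda>t. Si t + cos t / t + 1 / t) b \<le> (\<lambda>t. Si t + cos t / t + 1 / t) a"
  proof (rule DERIV_nonpos_imp_nonincreasing[OF assms(2)])
    fix x assume "a \<le> x" "x \<le> b"
    then have "0 < x" using assms by simp
    moreover have "(- cos x - 1) / x\<^sup>2 \<le> 0"
      using cos_ge_minus_one[of x] by (intro divide_nonpos_nonneg) auto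
    ultimately show "\<exists>y. ((\<lambda>t. Si t + cos t / t + 1 / t) has_real_derivative y) (at x) \<and> y \<le> 0"
      using d[of x 1] by blast
  qed
  then show "Si b + cos b / b + 1 / b \<le> Si a + cos a / a + 1 / a" .
qed

lemma Si_lower_tail:
  assumes "0 < y"
  shows "pi / 2 - 2 / y \<le> Si y"
proof -
  have inv: "((\<lambda>x::real. 1 / x) \<longlongrightarrow> 0) at_top" by real_asymp
  have "((\<lambda>x::real. cos x / x) \<longlongrightarrow> 0) at_top"
  proof (rule Lim_null_comparison[OF _ inv])
    show "\<forall>\<^sub>F x in at_top. norm (cos x / x) \<le> 1 / (x::real)"
      using eventually_gt_at_top[of "0::real"] by eventually_elim (simp add: divide_right_mono)
  qed
  then have "((\<lambda>b. Si b + cos b / b + 1 / b) \<longlongrightarrow> pi / 2 + 0 + 0) at_top"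
    by (intro tendsto_add Si_at_top inv)
  then have "pi / 2 + 0 + 0 \<le> Si y + cos y / y + 1 / y"
    by (rule tendsto_upperbound)
      (auto intro: eventually_mono[OF eventually_ge_at_top[of y] Si_asymptotic_mono(2)[OF assms]])
  moreover have "cos y / y \<le> 1 / y" using assms by (simp add: divide_right_mono)
  moreover have "2 / y = 2 * (1 / y)" by simp
  ultimately show ?thesis by linarith
qed

lemma Si_double_lower_tail:
  assumes "0 < x"
  shows "- 4 / x \<le> Si x - Si (x / 2)"
proof -
  have "Si (x / 2) + cos (x / 2) / (x / 2) - 1 / (x / 2) \<le> Si x + cos x / x - 1 / x"
    by (rule Si_asymptotic_mono) (use assms in auto)
  moreover define r where "r = 1 / x"
  ultimately have "Si (x / 2) + 2 * (cos (x / 2) * r) - 2 * r \<le> Si x + cos x * r - r"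
    by (simp add: mult.commute[of 2])
  moreover have "cos x * r \<le> 1 * r" "(- 1) * r \<le> cos (x / 2) * r"
    using assms by (intro mult_right_mono; simp add: r_def)+
  moreover have "- 4 / x = - 4 * r" by (simp add: r_def)
  ultimately show ?thesis by linarith
qed

text \<open>
  The derivative \<open>sin (x / 2) * (2 * cos (x / 2) - 1) / x\<close> changes its sign on this interval only at \<open>2 * pi\<close>,
  from negative to positive.
\<close>

lemma Si_double_lower:
  assumes "3 * pi / 2 \<le> x" "x \<le> 3 * pi"
  shows "- (9 / 20) \<le> Si x - Si (x / 2)"
proof -
  let ?Q = "\<lambda>x. Si x - Si (x / 2)"
  have d: "(?Q has_real_derivative sin (x / 2) * (2 * cos (x / 2) - 1) / x) (at x)" if "0 < x" for x
  proof -
    have "(?Q has_real_derivative sinc x - sinc (x / 2) / 2) (at x)"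
      by (auto intro!: derivative_eq_intros)
    moreover have "sinc x - sinc (x / 2) / 2 = (sin x - sin (x / 2)) / x"
      using that by (simp add: field_simps)
    moreover have "sin x = 2 * sin (x / 2) * cos (x / 2)"
      using sin_double[of "x / 2"] by simp
    ultimately show ?thesis by (simp add: algebra_simps)
  qed
  have q: "- (9 / 20) \<le> ?Q (2 * pi)" using Si_second_arch_drop by simp
  show ?thesis
  proof (cases "x \<le> 2 * pi")
    case True
    have "?Q (2 * pi) \<le> ?Q x"
    proof (rule DERIV_nonpos_imp_nonincreasing[OF True])
      fix y assume y: "x \<le> y" "y \<le> 2 * pi"
      have y0: "0 < y" using assms(1) y pi_gt_zero by linarith
      have "0 \<le> sin (y / 2)" using y y0 by (intro sin_ge_zero) auto
      moreover have "cos (y / 2) \<le> cos (pi / 2)"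
        using y assms by (intro cos_monotone_0_pi_le) auto
      ultimately have "sin (y / 2) * (2 * cos (y / 2) - 1) / y \<le> 0"
        using y0 by (intro divide_nonpos_pos mult_nonneg_nonpos) auto
      then show "\<exists>d. (?Q has_real_derivative d) (at y) \<and> d \<le> 0" using d[OF y0] by blast
    qed
    then show ?thesis using q by simp
  next
    case False
    then have "2 * pi \<le> x" by simp
    have "?Q (2 * pi) \<le> ?Q x"
    proof (rule DERIV_nonneg_imp_nondecreasing[OF \<open>2 * pi \<le> x\<close>])
      fix y assume y: "2 * pi \<le> y" "y \<le> x"
      have y0: "0 < y" using y pi_gt_zero by linarith
      have "0 \<le> sin (y / 2 - pi)" using y assms by (intro sin_ge_zero) auto
      then have "sin (y / 2) \<le> 0" by (simp add: sin_diff)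
      moreover have "0 \<le> cos (y / 2 - pi)" using y assms by (intro cos_ge_zero) auto
      then have "cos (y / 2) \<le> 0" by (simp add: cos_diff)
      ultimately have "0 \<le> sin (y / 2) * (2 * cos (y / 2) - 1) / y"
        using y0 by (intro divide_nonneg_pos mult_nonpos_nonpos) auto
      then show "\<exists>d. (?Q has_real_derivative d) (at y) \<and> 0 \<le> d" using d[OF y0] by blast
    qed
    then show ?thesis using q by simp
  qed
qed

text \<open>
  The threshold combination of three sine integrals. Averaged over dilations, it is the profile of the threshold
  function across a hyperplane.
\<close>

definition threshold_Si :: "real \<Rightarrow> real" where
  "threshold_Si x = Si (x / 3) - 3 * Si (x / 2) + 3 * Si x"

text \<open>
  In \<open>Si (x / 3) + 3 * (Si x - Si (x / 2))\<close> the bracket is nonnegative for \<open>x \<le> pi\<close> and afterwards never smaller than about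
  \<open>- 0.434\<close>, which is attained at \<open>2 * pi\<close>. By then \<open>Si (x / 3)\<close> has grown beyond \<open>1.3\<close>, and for large \<open>x\<close> the bracket
  is of order \<open>1 / x\<close> while \<open>Si\<close> tends to \<open>pi / 2\<close>. The five cases make this quantitative.
\<close>

lemma threshold_Si_pos:
  assumes "0 < x"
  shows "0 < threshold_Si x"
proof -
  have e: "threshold_Si x = Si (x / 3) + 3 * (Si x - Si (x / 2))" by (simp add: threshold_Si_def)
  consider "x \<le> pi" | "pi \<le> x" "x \<le> 3 * pi / 2" | "3 * pi / 2 \<le> x" "x \<le> 3 * pi"
    | "3 * pi \<le> x" "x \<le> 6 * pi" | "6 * pi \<le> x" by linarith
  then show ?thesis
  proof cases
    case 1
    have "Si (x / 2) \<le> Si x" using assms 1 by (intro Si_mono_first_arch) auto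
    moreover have "0 < Si (x / 3)" using assms 1 by (intro Si_pos) auto
    ultimately show ?thesis unfolding e by simp
  next
    case 2
    have "Si (x / 2) + cos (x / 2) / pi \<le> Si x + cos x / pi"
      using 2 assms pi_gt_zero by (intro Si_plus_cos_mono) linarith+
    moreover have "cos x / pi \<le> 0"
    proof -
      have "0 \<le> cos (x - pi)" using 2 by (intro cos_ge_zero) auto
      then show ?thesis by (simp add: cos_diff divide_nonpos_pos)
    qed
    moreover have "- 1 / pi \<le> cos (x / 2) / pi"
      using cos_ge_minus_one[of "x / 2"] by (intro divide_right_mono) auto
    ultimately have q: "- 1 / pi \<le> Si x - Si (x / 2)" by simp
    have "(26 / 25) - ((26 / 25)::real) ^ 3 / 18 - (26 / 25) ^ 7 / 35280 \<le> Si (26 / 25)"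
      using Si_lower_7[of "26 / 25"] by (simp add: power_divide)
    also have "Si (26 / 25) \<le> Si (x / 3)" using 2 pi_bounds by (intro Si_mono_first_arch) auto
    finally have "24 / 25 \<le> Si (x / 3)" by (simp add: power_divide)
    moreover have "3 * (1 / pi) < 24 / 25" using pi_bounds by (simp add: field_simps)
    moreover define r where "r = 1 / pi"
    moreover have "- 1 / pi = - r" by (simp add: r_def)
    ultimately show ?thesis unfolding e using q by simp
  next
    case 3
    have "Si (pi / 2) \<le> Si (x / 3)" using 3 by (intro Si_mono_first_arch) auto
    then show ?thesis unfolding e using Si_double_lower[OF 3] Si_half_pi by simp
  next
    case 4
    have "Si (2 * pi) \<le> Si (x / 3)" using 4 by (intro Si_antimono_second_arch) auto
    moreover have "- 4 / x \<ge> - 4 / (3 * pi)" using 4 assms by (simp add: frac_le)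
    moreover have "- 4 / (3 * pi) > - (43 / 100)" using pi_bounds by (simp add: field_simps)
    ultimately have "- (43 / 100) < Si x - Si (x / 2)" "137 / 100 \<le> Si (x / 3)"
      using Si_double_lower_tail[OF assms] Si_two_pi by linarith+
    then show ?thesis unfolding e by simp
  next
    case 5
    define r where "r = 1 / x"
    have "pi / 2 - 2 / (x / 3) \<le> Si (x / 3)" using assms by (intro Si_lower_tail) auto
    then have a: "pi / 2 - 6 * r \<le> Si (x / 3)" by (simp add: r_def)
    have b: "- 4 * r \<le> Si x - Si (x / 2)" using Si_double_lower_tail[OF assms] by (simp add: r_def)
    have "r \<le> 1 / (6 * pi)" using 5 by (simp add: r_def frac_le)
    moreover have "18 * (1 / (6 * pi)) < 1" using pi_bounds by (simp add: field_simps)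
    ultimately have c: "18 * r < 1" by linarith
    have "0 < (pi / 2 - 6 * r) + 3 * (- 4 * r)" using c pi_bounds by simp
    also have "\<dots> \<le> Si (x / 3) + 3 * (Si x - Si (x / 2))"
      by (intro add_mono mult_left_mono a b) simp
    finally show ?thesis unfolding e .
  qed
qed


lemma threshold_Si_DERIV:
  "((\<lambda>t. threshold_Si (y * t)) has_real_derivative
     y / 3 * sinc (y * t / 3) - 3 * (y / 2 * sinc (y * t / 2)) + 3 * (y * sinc (y * t))) (at t)"
  unfolding threshold_Si_def by (auto intro!: derivative_eq_intros simp: algebra_simps)

text \<open>
  The quotient \<open>threshold_Si x / x\<close> extends continuously by the derivative \<open>1 / 3 - 3 / 2 + 3 = 11 / 6\<close> at zero, so on a compact interval
  its minimum is attained and positive.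
\<close>

lemma threshold_Si_linear_lower:
  assumes "0 < M"
  shows "\<exists>c>0. \<forall>x\<in>{0..M}. c * x \<le> threshold_Si x"
proof -
  let ?p = "\<lambda>x. if x = 0 then 11 / 6 else threshold_Si x / x"
  have z: "threshold_Si 0 = 0" by (simp add: threshold_Si_def)
  have c: "isCont threshold_Si x" for x
    unfolding threshold_Si_def by (intro continuous_intros isCont_o2[OF _ isCont_Si]) auto
  have "continuous_on {0..M} ?p"
  proof (intro continuous_at_imp_continuous_on ballI)
    fix x :: real assume "x \<in> {0..M}"
    show "isCont ?p x"
    proof (cases "x = 0")
      case True
      have "(threshold_Si has_real_derivative 11 / 6) (at 0)"
        using threshold_Si_DERIV[of 1 0] by simp
      then have "((\<lambda>h. threshold_Si h / h) \<longlongrightarrow> 11 / 6) (at 0)"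
        by (simp add: DERIV_def z)
      then have "(?p \<longlongrightarrow> 11 / 6) (at 0)"
        by (rule Lim_transform_eventually) (simp add: eventually_at_filter)
      then show ?thesis using True by (simp add: isCont_def)
    next
      case False
      have "isCont (\<lambda>x. threshold_Si x / x) x" using c False by (intro continuous_intros) auto
      then show ?thesis
        by (rule continuous_transform_within[where \<delta> = "\<bar>x\<bar>"]) (use False in \<open>auto simp: dist_real_def\<close>)
    qed
  qed
  then obtain x0 where x0: "x0 \<in> {0..M}" "\<And>x. x \<in> {0..M} \<Longrightarrow> ?p x0 \<le> ?p x"
    using continuous_attains_inf[of "{0..M}" ?p] assms by auto
  have "0 < ?p x0" using threshold_Si_pos[of x0] x0(1) by auto
  moreover have "?p x0 * x \<le> threshold_Si x" if "x \<in> {0..M}" for x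
  proof (cases "x = 0")
    case False
    then have "?p x0 \<le> threshold_Si x / x" "0 < x" using x0(2)[OF that] that by auto
    then show ?thesis by (simp only: pos_le_divide_eq)
  qed (simp add: z)
  ultimately show ?thesis by blast
qed

section \<open>Half-space averages of the kernel\<close>

lemma kernel_fourier_cos:
  fixes n :: "'a::euclidean_space"
  assumes n: "norm n = 1"
  shows "(LBINT z. kernel n 0 0 z * cos (\<tau> * (z \<bullet> n))) = exp (- (\<tau> ^ 4))"
proof -
  have i: "complex_integrable lborel (\<lambda>z. kernel_c (0::'a) 0 0 z * exp (\<i> * of_real (z \<bullet> (\<tau> *\<^sub>R n))))"
  proof (rule Bochner_Integration.integrable_bound)
    show "integrable lborel (kernel (0::'a) 0 0)" by (rule kernel_integrable) auto
    have [measurable]: "kernel (0::'a) 0 0 \<in> borel_measurable borel" by (rule kernel_measurable) auto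
    show "(\<lambda>z. kernel_c (0::'a) 0 0 z * exp (\<i> * of_real (z \<bullet> (\<tau> *\<^sub>R n)))) \<in> borel_measurable lborel"
      unfolding of_real_kernel[symmetric] by measurable
    show "AE z in lborel. norm (kernel_c (0::'a) 0 0 z * exp (\<i> * of_real (z \<bullet> (\<tau> *\<^sub>R n)))) \<le> norm (kernel (0::'a) 0 0 z)"
      unfolding of_real_kernel[symmetric] by (intro AE_I2) (simp add: norm_mult)
  qed
  have "Re (LBINT z. kernel_c (0::'a) 0 0 z * exp (\<i> * of_real (z \<bullet> (\<tau> *\<^sub>R n))))
      = (LBINT z. Re (kernel_c (0::'a) 0 0 z * exp (\<i> * of_real (z \<bullet> (\<tau> *\<^sub>R n)))))"
    by (rule integral_Re[OF i, symmetric])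
  also have "\<dots> = (LBINT z. kernel n 0 0 z * cos (\<tau> * (z \<bullet> n)))"
    unfolding of_real_kernel[symmetric] by (simp add: Re_exp kernel_0_indep[of 0 0 n])
  finally show ?thesis
    using kernel_fourier[of 0 "\<tau> *\<^sub>R n"] n by simp
qed

text \<open>
  Twice the excess of the half-space average over one half (see \<open>half_space_average\<close>); the sign function
  makes the oddness in \<open>\<sigma>\<close> evident.
\<close>

definition sgn_average :: "'a::euclidean_space \<Rightarrow> real \<Rightarrow> real" where
  "sgn_average n \<sigma> = (LBINT z. kernel n 0 0 z * sgn (z \<bullet> n + \<sigma>))"

lemma kernel_0_uminus: "kernel n 0 0 (- z) = kernel n 0 0 z"
  by (simp add: kernel_def kernel_c_uminus)

lemma kernel_n_integrable: "norm n = 1 \<Longrightarrow> integrable lborel (kernel n 0 0)"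
  and kernel_n_measurable: "norm n = 1 \<Longrightarrow> kernel n 0 0 \<in> borel_measurable borel"
  by (intro kernel_integrable kernel_measurable; simp)+

lemma sgn_average_uminus:
  assumes n: "norm n = 1"
  shows "sgn_average n (- \<sigma>) = - sgn_average n \<sigma>"
proof -
  note [measurable] = kernel_n_measurable[OF n]
  have "(LBINT z. kernel n 0 0 z * sgn (z \<bullet> n - \<sigma>)) = (LBINT z. kernel n 0 0 (- z) * sgn ((- z) \<bullet> n - \<sigma>))"
    by (rule lborel_integral_reflect[symmetric]) measurable
  also have "\<dots> = (LBINT z. - (kernel n 0 0 z * sgn (z \<bullet> n + \<sigma>)))"
    by (intro Bochner_Integration.integral_cong refl)
      (auto simp: kernel_0_uminus sgn_if)
  finally show ?thesis by (simp add: sgn_average_def)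
qed

lemma AE_off_hyperplane:
  fixes n :: "'a::euclidean_space"
  assumes "n \<noteq> 0"
  shows "AE z in lborel. n \<bullet> z \<noteq> c"
proof -
  have "negligible {z. n \<bullet> z = c}" using assms by (intro negligible_hyperplane) auto
  then have "{z. n \<bullet> z = c} \<in> null_sets lebesgue" by (simp add: negligible_iff_null_sets)
  moreover have "closed {z. n \<bullet> z = c}" by (rule closed_hyperplane)
  ultimately have "{z. n \<bullet> z = c} \<in> null_sets lborel"
    by (auto simp: null_sets_def borel_closed)
  then have "AE z in lborel. z \<notin> {z. n \<bullet> z = c}" by (rule AE_not_in)
  then show ?thesis by simp
qed

lemma half_space_average:
  fixes n :: "'a::euclidean_space"
  assumes n: "norm n = 1"
  shows "(LBINT z. kernel n 0 0 z * indicator {z. - \<sigma> \<le> z \<bullet> n} z) = 1 / 2 + sgn_average n \<sigma> / 2"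
proof -
  note [measurable] = kernel_n_measurable[OF n]
  have K: "integrable lborel (kernel n 0 0)" by (rule kernel_n_integrable[OF n])
  have Ks: "integrable lborel (\<lambda>z. kernel n 0 0 z * sgn (z \<bullet> n + \<sigma>))"
    by (rule Bochner_Integration.integrable_bound[OF K]) (auto simp: abs_mult sgn_if)
  have "n \<noteq> 0" using n by auto
  then have ae: "AE z in lborel. n \<bullet> z \<noteq> - \<sigma>" by (rule AE_off_hyperplane)
  have "(LBINT z. kernel n 0 0 z * indicator {z. - \<sigma> \<le> z \<bullet> n} z)
      = (LBINT z. kernel n 0 0 z / 2 + kernel n 0 0 z * sgn (z \<bullet> n + \<sigma>) / 2)"
  proof (rule integral_cong_AE)
    show "AE z in lborel. kernel n 0 0 z * indicator {z. - \<sigma> \<le> z \<bullet> n} z = kernel n 0 0 z / 2 + kernel n 0 0 z * sgn (z \<bullet> n + \<sigma>) / 2"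
      using ae by eventually_elim (auto simp: sgn_if inner_commute split: split_indicator)
  qed measurable
  also have "\<dots> = (LBINT z. kernel n 0 0 z) / 2 + sgn_average n \<sigma> / 2"
    using K Ks by (simp add: sgn_average_def)
  finally show ?thesis by (simp add: kernel_integral_one)
qed

text \<open>
  The right-hand side is a smoothed indicator of the interval from \<open>- \<sigma>\<close> to \<open>\<sigma>\<close> (for \<open>\<sigma> > 0\<close>): as \<open>T\<close> grows it tends
  to \<open>pi\<close> inside and to zero outside.
\<close>

lemma integral_cos_sinc:
  assumes T: "0 \<le> T"
  shows "(LBINT \<tau>. indicator {0..T} \<tau> *\<^sub>R (2 * \<sigma> * sinc (\<sigma> * \<tau>) * cos (\<tau> * x))) = Si (T * (x + \<sigma>)) - Si (T * (x - \<sigma>))"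
proof -
  let ?F = "\<lambda>\<tau>. Si (\<tau> * (x + \<sigma>)) - Si (\<tau> * (x - \<sigma>))"
  have e: "2 * \<sigma> * sinc (\<sigma> * \<tau>) * cos (\<tau> * x) = sinc (\<tau> * (x + \<sigma>)) * (x + \<sigma>) - sinc (\<tau> * (x - \<sigma>)) * (x - \<sigma>)" for \<tau> :: real
  proof (cases "\<tau> = 0")
    case False
    have s: "sinc (\<tau> * u) * u = sin (\<tau> * u) / \<tau>" for u using False by simp
    have "sinc (\<tau> * (x + \<sigma>)) * (x + \<sigma>) - sinc (\<tau> * (x - \<sigma>)) * (x - \<sigma>) = (sin (\<tau> * x + \<tau> * \<sigma>) - sin (\<tau> * x - \<tau> * \<sigma>)) / \<tau>"
      unfolding s by (simp add: diff_divide_distrib algebra_simps)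
    also have "\<dots> = 2 * (sin (\<tau> * \<sigma>) / \<tau>) * cos (\<tau> * x)"
      unfolding sin_add sin_diff by simp
    also have "sin (\<tau> * \<sigma>) / \<tau> = sinc (\<sigma> * \<tau>) * \<sigma>" using s[of \<sigma>] by (simp only: mult.commute)
    finally show ?thesis by (simp only: mult_ac)
  qed simp
  have "(LBINT \<tau>. indicator {0..T} \<tau> *\<^sub>R (2 * \<sigma> * sinc (\<sigma> * \<tau>) * cos (\<tau> * x))) = ?F T - ?F 0"
  proof (rule integral_FTC_atLeastAtMost[OF T])
    fix t
    have "(?F has_real_derivative 2 * \<sigma> * sinc (\<sigma> * t) * cos (t * x)) (at t)"
      unfolding e by (auto intro!: derivative_eq_intros)
    then show "(?F has_vector_derivative 2 * \<sigma> * sinc (\<sigma> * t) * cos (t * x)) (at t within {0..T})"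
      using has_real_derivative_iff_has_vector_derivative has_vector_derivative_at_within by blast
  qed (intro continuous_intros)
  then show ?thesis by simp
qed

lemma Si_scaled_limit: "(\<lambda>k. Si (real k * u)) \<longlonglongrightarrow> pi / 2 * sgn u"
proof -
  have pos: "(\<lambda>k. Si (real k * u)) \<longlonglongrightarrow> pi / 2" if "0 < u" for u
  proof -
    have "filterlim (\<lambda>k. real k * u) at_top sequentially" using that by real_asymp
    then show ?thesis by (rule filterlim_compose[OF Si_at_top])
  qed
  consider "0 < u" | "u = 0" | "0 < - u" by linarith
  then show ?thesis
  proof cases
    case 3
    then have "(\<lambda>k. - Si (real k * (- u))) \<longlonglongrightarrow> - (pi / 2)" by (intro tendsto_minus pos)
    then show ?thesis using 3 by (simp add: Si_minus)
  qed (use pos in auto)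
qed

lemma integrable_continuous_interval:
  fixes f :: "real \<Rightarrow> real"
  assumes "continuous_on {a..b} f"
  shows "integrable lborel (\<lambda>x. indicator {a..b} x *\<^sub>R f x)"
  using borel_integrable_atLeastAtMost'[OF assms] by (simp add: set_integrable_def)

text \<open>
  Only the values of the kernel's Fourier transform on the line spanned by \<open>n\<close> enter. They are
  inserted as \<open>exp (- \<tau>\<^sup>4)\<close>; exchanging the integrals and letting the truncation tend to infinity
  turns the sine integrals into sign functions.
\<close>

lemma sgn_average_limit:
  fixes n :: "'a::euclidean_space"
  assumes n: "norm n = 1"
  shows "(\<lambda>k. \<integral>\<tau>. indicator {0..real k} \<tau> *\<^sub>R (2 * \<sigma> * sinc (\<sigma> * \<tau>) * exp (- (\<tau> ^ 4))) \<partial>lborel) \<longlonglongrightarrow> pi * sgn_average n \<sigma>"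
proof -
  note [measurable] = kernel_n_measurable[OF n]
  have K: "integrable lborel (kernel n 0 0)" by (rule kernel_n_integrable[OF n])
  have [measurable]: "(\<lambda>\<tau>. sinc (\<sigma> * \<tau>)) \<in> borel_measurable borel"
    by (intro borel_measurable_continuous_onI continuous_intros)
  have swap: "(LBINT \<tau>. indicator {0..T} \<tau> *\<^sub>R (2 * \<sigma> * sinc (\<sigma> * \<tau>) * exp (- (\<tau> ^ 4))))
      = (LBINT z. kernel n 0 0 z * (Si (T * (z \<bullet> n + \<sigma>)) - Si (T * (z \<bullet> n - \<sigma>))))" if T: "0 \<le> T" for T
  proof -
    let ?f = "\<lambda>\<tau> z. (indicator {0..T} \<tau> * (2 * \<sigma> * sinc (\<sigma> * \<tau>))) * (kernel n 0 0 z * cos (\<tau> * (z \<bullet> n)))"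
    have "(LBINT \<tau>. indicator {0..T} \<tau> *\<^sub>R (2 * \<sigma> * sinc (\<sigma> * \<tau>) * exp (- (\<tau> ^ 4)))) = (LBINT \<tau>. (LBINT z. ?f \<tau> z))"
      unfolding integral_mult_right_zero kernel_fourier_cos[OF n] by (simp only: real_scaleR_def mult.assoc)
    also have "\<dots> = (LBINT z. (LBINT \<tau>. ?f \<tau> z))"
    proof (rule lborel_swap)
      have "integrable lborel (\<lambda>\<tau>. indicator {0..T} \<tau> *\<^sub>R (2 * \<sigma> * sinc (\<sigma> * \<tau>)))"
        by (rule integrable_continuous_interval) (intro continuous_intros)
      then show "integrable lborel (\<lambda>\<tau>. norm (indicator {0..T} \<tau> *\<^sub>R (2 * \<sigma> * sinc (\<sigma> * \<tau>))))"
        by (rule integrable_norm)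
      show "integrable lborel (\<lambda>z. norm (kernel n 0 0 z))" using K by (rule integrable_norm)
      show "norm (?f \<tau> z) \<le> norm (indicator {0..T} \<tau> *\<^sub>R (2 * \<sigma> * sinc (\<sigma> * \<tau>))) * norm (kernel n 0 0 z)" for \<tau> z
        unfolding norm_mult[of "indicator {0..T} \<tau> * (2 * \<sigma> * sinc (\<sigma> * \<tau>))"] real_scaleR_def
        by (intro mult_left_mono) (auto simp: abs_mult mult_left_le)
    qed measurable
    also have "\<dots> = (LBINT z. kernel n 0 0 z * (LBINT \<tau>. indicator {0..T} \<tau> *\<^sub>R (2 * \<sigma> * sinc (\<sigma> * \<tau>) * cos (\<tau> * (z \<bullet> n)))))"
    proof -
      have "(LBINT \<tau>. ?f \<tau> z) = (LBINT \<tau>. kernel n 0 0 z * (indicator {0..T} \<tau> *\<^sub>R (2 * \<sigma> * sinc (\<sigma> * \<tau>) * cos (\<tau> * (z \<bullet> n)))))" for z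
        by (simp only: real_scaleR_def mult_ac)
      then show ?thesis by (simp only: integral_mult_right_zero)
    qed
    finally show ?thesis unfolding integral_cos_sinc[OF T] .
  qed
  obtain B where B: "\<And>T. \<bar>Si T\<bar> \<le> B" using bounded_Si by blast
  have "(\<lambda>k. \<integral>z. kernel n 0 0 z * (Si (real k * (z \<bullet> n + \<sigma>)) - Si (real k * (z \<bullet> n - \<sigma>))) \<partial>lborel)
     \<longlonglongrightarrow> (LBINT z. kernel n 0 0 z * (pi / 2 * sgn (z \<bullet> n + \<sigma>) - pi / 2 * sgn (z \<bullet> n - \<sigma>)))"
  proof (rule integral_dominated_convergence)
    show "integrable lborel (\<lambda>z. norm (kernel n 0 0 z) * (2 * B))"
      using K by (intro integrable_mult_left integrable_norm)
    show "AE z in lborel. (\<lambda>k. kernel n 0 0 z * (Si (real k * (z \<bullet> n + \<sigma>)) - Si (real k * (z \<bullet> n - \<sigma>))))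
        \<longlonglongrightarrow> kernel n 0 0 z * (pi / 2 * sgn (z \<bullet> n + \<sigma>) - pi / 2 * sgn (z \<bullet> n - \<sigma>))"
      by (intro AE_I2 tendsto_intros Si_scaled_limit)
    show "AE z in lborel. norm (kernel n 0 0 z * (Si (real k * (z \<bullet> n + \<sigma>)) - Si (real k * (z \<bullet> n - \<sigma>)))) \<le> norm (kernel n 0 0 z) * (2 * B)" for k
    proof (rule AE_I2)
      fix z
      have "\<bar>Si (real k * (z \<bullet> n + \<sigma>)) - Si (real k * (z \<bullet> n - \<sigma>))\<bar> \<le> 2 * B"
        using B[of "real k * (z \<bullet> n + \<sigma>)"] B[of "real k * (z \<bullet> n - \<sigma>)"] by linarith
      then show "norm (kernel n 0 0 z * (Si (real k * (z \<bullet> n + \<sigma>)) - Si (real k * (z \<bullet> n - \<sigma>)))) \<le> norm (kernel n 0 0 z) * (2 * B)"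
        unfolding norm_mult by (intro mult_left_mono) auto
    qed
  qed measurable
  moreover have "(LBINT z. kernel n 0 0 z * (pi / 2 * sgn (z \<bullet> n + \<sigma>) - pi / 2 * sgn (z \<bullet> n - \<sigma>)))
      = pi * sgn_average n \<sigma>"
  proof -
    have Ks: "integrable lborel (\<lambda>z. kernel n 0 0 z * sgn (z \<bullet> n + \<sigma>))" for \<sigma>
      by (rule Bochner_Integration.integrable_bound[OF K]) (auto simp: abs_mult sgn_if)
    have "(LBINT z. kernel n 0 0 z * (pi / 2 * sgn (z \<bullet> n + \<sigma>) - pi / 2 * sgn (z \<bullet> n - \<sigma>)))
        = (LBINT z. pi / 2 * (kernel n 0 0 z * sgn (z \<bullet> n + \<sigma>)) - pi / 2 * (kernel n 0 0 z * sgn (z \<bullet> n + - \<sigma>)))"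
      by (simp add: algebra_simps)
    also have "\<dots> = pi / 2 * sgn_average n \<sigma> - pi / 2 * sgn_average n (- \<sigma>)"
      unfolding sgn_average_def
      by (simp only: Bochner_Integration.integral_diff integrable_mult_right Ks integral_mult_right_zero)
    also have "\<dots> = pi * sgn_average n \<sigma>" by (simp add: sgn_average_uminus[OF n])
    finally show ?thesis .
  qed
  ultimately show ?thesis
    by (simp only: swap[OF of_nat_0_le_iff])
qed

text \<open>
  For \<open>y > 0\<close> the combined integrand in \<open>sgn_average_limit\<close> is \<open>2 exp (- \<tau>\<^sup>4)\<close> times the derivative of \<open>\<tau> \<mapsto> threshold_Si (y \<tau>)\<close>.
  Integration by parts moves the derivative to the exponential and produces the positive weight \<open>8 \<tau>\<^sup>3 exp (- \<tau>\<^sup>4)\<close>. The part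
  over \<open>\<tau> \<le> 1\<close>, where the linear lower bound applies, already gives the estimate. Negative \<open>y\<close> reduce to positive ones by oddness.
\<close>

lemma sgn_average_threshold_lower:
  assumes "0 < M"
  shows "\<exists>c>0. \<forall>n::'a::euclidean_space. norm n = 1 \<longrightarrow> (\<forall>y. \<bar>y\<bar> \<le> M \<longrightarrow>
     c * \<bar>y\<bar> \<le> \<bar>sgn_average n (y / 3) - 3 * sgn_average n (y / 2) + 3 * sgn_average n y\<bar>)"
proof -
  obtain c where c: "c > 0" "\<And>x. x \<in> {0..M} \<Longrightarrow> c * x \<le> threshold_Si x"
    using threshold_Si_linear_lower[OF assms] by blast
  \<comment> \<open>The integral of \<open>8 * \<tau> ^ 3 * exp (-1) * (c * \<tau>)\<close> over the unit interval, divided by \<open>pi\<close>.\<close>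
  let ?c = "8 / 5 * c * exp (-1) / pi"
  let ?D = "\<lambda>n::'a. \<lambda>y. sgn_average n (y / 3) - 3 * sgn_average n (y / 2) + 3 * sgn_average n y"
  have pos: "?c * y \<le> ?D n y" if n: "norm n = 1" and y: "0 < y" "y \<le> M" for n y
  proof -
    let ?J = "\<lambda>\<sigma> k. \<integral>\<tau>. indicator {0..real k} \<tau> *\<^sub>R (2 * \<sigma> * sinc (\<sigma> * \<tau>) * exp (- (\<tau> ^ 4))) \<partial>lborel"
    let ?q = "\<lambda>t. y / 3 * sinc (y * t / 3) - 3 * (y / 2 * sinc (y * t / 2)) + 3 * (y * sinc (y * t))"
    have lim: "(\<lambda>k. ?J (y / 3) k - 3 * ?J (y / 2) k + 3 * ?J y k) \<longlonglongrightarrow>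
        pi * sgn_average n (y / 3) - 3 * (pi * sgn_average n (y / 2)) + 3 * (pi * sgn_average n y)"
      by (intro tendsto_intros sgn_average_limit[OF n])
    have low: "8 / 5 * c * exp (-1) * y \<le> ?J (y / 3) k - 3 * ?J (y / 2) k + 3 * ?J y k" if k: "1 \<le> k" for k
    proof -
      let ?g = "\<lambda>\<tau>. 2 * exp (- (\<tau> ^ 4)) * threshold_Si (y * \<tau>)"
      let ?r = "\<lambda>\<tau>. 8 * \<tau> ^ 3 * exp (- (\<tau> ^ 4)) * threshold_Si (y * \<tau>)"
      have cT: "continuous_on S (\<lambda>\<tau>. threshold_Si (y * \<tau>))" for S
        using threshold_Si_DERIV by (intro continuous_at_imp_continuous_on ballI DERIV_isCont) blast
      have Ji: "integrable lborel (\<lambda>\<tau>. indicator {0..real k} \<tau> *\<^sub>R (2 * \<sigma> * sinc (\<sigma> * \<tau>) * exp (- (\<tau> ^ 4))))" for \<sigma>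
        by (rule integrable_continuous_interval) (intro continuous_intros)
      have ri: "integrable lborel (\<lambda>\<tau>. indicator {0..real k} \<tau> *\<^sub>R ?r \<tau>)"
        by (rule integrable_continuous_interval) (intro continuous_intros cT)
      have qi: "integrable lborel (\<lambda>\<tau>. indicator {0..real k} \<tau> *\<^sub>R (2 * exp (- (\<tau> ^ 4)) * ?q \<tau>))"
        by (rule integrable_continuous_interval) (intro continuous_intros ballI; simp)
      have "?J (y / 3) k - 3 * ?J (y / 2) k + 3 * ?J y k
        = (LBINT \<tau>. indicator {0..real k} \<tau> *\<^sub>R (2 * (y / 3) * sinc (y / 3 * \<tau>) * exp (- (\<tau> ^ 4)))
            - 3 * (indicator {0..real k} \<tau> *\<^sub>R (2 * (y / 2) * sinc (y / 2 * \<tau>) * exp (- (\<tau> ^ 4))))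
            + 3 * (indicator {0..real k} \<tau> *\<^sub>R (2 * y * sinc (y * \<tau>) * exp (- (\<tau> ^ 4)))))"
        by (simp only: Bochner_Integration.integral_add Bochner_Integration.integral_diff Bochner_Integration.integrable_diff
            integrable_mult_right Ji integral_mult_right_zero)
      also have "\<dots> = (LBINT \<tau>. indicator {0..real k} \<tau> *\<^sub>R (2 * exp (- (\<tau> ^ 4)) * ?q \<tau>))"
      proof (rule Bochner_Integration.integral_cong[OF refl])
        fix \<tau> :: real
        have s: "y / 3 * \<tau> = y * \<tau> / 3" "y / 2 * \<tau> = y * \<tau> / 2" by simp_all
        show "indicator {0..real k} \<tau> *\<^sub>R (2 * (y / 3) * sinc (y / 3 * \<tau>) * exp (- (\<tau> ^ 4)))
            - 3 * (indicator {0..real k} \<tau> *\<^sub>R (2 * (y / 2) * sinc (y / 2 * \<tau>) * exp (- (\<tau> ^ 4))))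
            + 3 * (indicator {0..real k} \<tau> *\<^sub>R (2 * y * sinc (y * \<tau>) * exp (- (\<tau> ^ 4))))
          = indicator {0..real k} \<tau> *\<^sub>R (2 * exp (- (\<tau> ^ 4)) * ?q \<tau>)"
          unfolding s real_scaleR_def by (simp only: algebra_simps)
      qed
      also have "\<dots> = (LBINT \<tau>. indicator {0..real k} \<tau> *\<^sub>R (2 * exp (- (\<tau> ^ 4)) * ?q \<tau> - ?r \<tau>) + indicator {0..real k} \<tau> *\<^sub>R ?r \<tau>)"
        by (simp only: scaleR_add_right[symmetric] diff_add_cancel)
      also have "\<dots> = (LBINT \<tau>. indicator {0..real k} \<tau> *\<^sub>R (2 * exp (- (\<tau> ^ 4)) * ?q \<tau> - ?r \<tau>)) + (LBINT \<tau>. indicator {0..real k} \<tau> *\<^sub>R ?r \<tau>)"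
        using qi ri by (intro Bochner_Integration.integral_add) (simp_all only: scaleR_diff_right Bochner_Integration.integrable_diff)
      also have "(LBINT \<tau>. indicator {0..real k} \<tau> *\<^sub>R (2 * exp (- (\<tau> ^ 4)) * ?q \<tau> - ?r \<tau>)) = ?g (real k) - ?g 0"
      proof (rule integral_FTC_atLeastAtMost)
        fix t :: real
        have "(?g has_real_derivative 2 * exp (- (t ^ 4)) * ?q t - ?r t) (at t)"
        proof -
          have "((\<lambda>\<tau>::real. 2 * exp (- (\<tau> ^ 4))) has_real_derivative - (8 * t ^ 3 * exp (- (t ^ 4)))) (at t)"
            by (auto intro!: derivative_eq_intros)
          from DERIV_mult[OF this threshold_Si_DERIV[of y t]]
          show ?thesis by (rule DERIV_cong) (simp only: algebra_simps)
        qed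
        then show "(?g has_vector_derivative 2 * exp (- (t ^ 4)) * ?q t - ?r t) (at t within {0..real k})"
          using has_real_derivative_iff_has_vector_derivative has_vector_derivative_at_within by blast
      next
        show "continuous_on {0..real k} (\<lambda>t. 2 * exp (- (t ^ 4)) * ?q t - ?r t)"
          by (intro continuous_intros cT ballI) simp_all
      qed simp
      finally have J: "?J (y / 3) k - 3 * ?J (y / 2) k + 3 * ?J y k
        = ?g (real k) - ?g 0 + (LBINT \<tau>. indicator {0..real k} \<tau> *\<^sub>R ?r \<tau>)" .
      have g: "0 \<le> ?g (real k) - ?g 0"
        using threshold_Si_pos[of "y * real k"] y k by (simp add: threshold_Si_def[of 0])
      have "8 / 5 * c * exp (-1) * y \<le> (LBINT \<tau>. indicator {0..real k} \<tau> *\<^sub>R ?r \<tau>)"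
      proof -
        have "8 / 5 * c * exp (-1) * y = (LBINT \<tau>. indicator {0..1} \<tau> *\<^sub>R (8 * c * exp (-1) * y * \<tau> ^ 4))"
        proof -
          have "(LBINT \<tau>. indicator {0..1} \<tau> *\<^sub>R (8 * c * exp (-1) * y * \<tau> ^ 4)) =
             (\<lambda>\<tau>. 8 / 5 * c * exp (-1) * y * \<tau> ^ 5) 1 - (\<lambda>\<tau>. 8 / 5 * c * exp (-1) * y * \<tau> ^ 5) (0::real)"
          proof (rule integral_FTC_atLeastAtMost)
            fix t :: real
            have "((\<lambda>\<tau>. 8 / 5 * c * exp (-1) * y * \<tau> ^ 5) has_real_derivative 8 * c * exp (-1) * y * t ^ 4) (at t)"
              by (auto intro!: derivative_eq_intros)
            then show "((\<lambda>\<tau>. 8 / 5 * c * exp (-1) * y * \<tau> ^ 5) has_vector_derivative 8 * c * exp (-1) * y * t ^ 4) (at t within {0..1})"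
              using has_real_derivative_iff_has_vector_derivative has_vector_derivative_at_within by blast
          qed (auto intro!: continuous_intros)
          then show ?thesis by simp
        qed
        also have "\<dots> \<le> (LBINT \<tau>. indicator {0..real k} \<tau> *\<^sub>R ?r \<tau>)"
        proof (rule integral_mono[OF _ ri])
          show "integrable lborel (\<lambda>\<tau>::real. indicator {0..1} \<tau> *\<^sub>R (8 * c * exp (-1) * y * \<tau> ^ 4))"
            by (rule integrable_continuous_interval) (intro continuous_intros)
          fix \<tau> :: real
          show "indicator {0..1} \<tau> *\<^sub>R (8 * c * exp (-1) * y * \<tau> ^ 4) \<le> indicator {0..real k} \<tau> *\<^sub>R ?r \<tau>"
          proof (cases "\<tau> \<in> {0..1}")
            case True
            then have t: "0 \<le> \<tau>" "\<tau> \<le> 1" by auto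
            have "y * \<tau> \<in> {0..M}" using t y mult_mono[of y M \<tau> 1] by auto
            then have 1: "c * (y * \<tau>) \<le> threshold_Si (y * \<tau>)" by (rule c(2))
            have 2: "exp (-1) \<le> exp (- (\<tau> ^ 4))" using t by (simp add: power_le_one)
            have "8 * c * exp (-1) * y * \<tau> ^ 4 = (8 * \<tau> ^ 3 * exp (-1)) * (c * (y * \<tau>))"
              by (simp add: eval_nat_numeral)
            also have "\<dots> \<le> ?r \<tau>"
              using t y c(1) by (intro mult_mono 1 mult_left_mono 2) auto
            finally show ?thesis using True k by (auto split: split_indicator)
          next
            case False
            have "0 \<le> indicator {0..real k} \<tau> *\<^sub>R ?r \<tau>"
            proof (cases "\<tau> \<in> {0..real k} \<and> \<tau> \<noteq> 0")
              case True
              then have "0 < threshold_Si (y * \<tau>)" using y by (intro threshold_Si_pos) auto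
              then show ?thesis using True by simp
            qed auto
            then show ?thesis using False by simp
          qed
        qed
        finally show ?thesis .
      qed
      then show ?thesis unfolding J using g by linarith
    qed
    have "8 / 5 * c * exp (-1) * y \<le> pi * sgn_average n (y / 3) - 3 * (pi * sgn_average n (y / 2)) + 3 * (pi * sgn_average n y)"
    proof (rule tendsto_lowerbound[OF lim _ sequentially_bot])
      show "\<forall>\<^sub>F k in sequentially. 8 / 5 * c * exp (-1) * y \<le> ?J (y / 3) k - 3 * ?J (y / 2) k + 3 * ?J y k"
        by (rule eventually_mono[OF eventually_ge_at_top[of 1]]) (rule low)
    qed
    then have "8 / 5 * c * exp (-1) * y \<le> pi * ?D n y" by (simp add: algebra_simps)
    then show ?thesis by (simp add: field_simps)
  qed
  have c0: "0 < ?c" using c(1) by simp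
  have "?c * \<bar>y\<bar> \<le> \<bar>?D n y\<bar>" if n: "norm n = 1" and y: "\<bar>y\<bar> \<le> M" for n y
  proof -
    consider "0 < y" | "y = 0" | "0 < - y" by linarith
    then show ?thesis
    proof cases
      case 1
      then show ?thesis using pos[OF n, of y] y by simp
    next
      case 3
      have "?D n (- y) = - ?D n y"
        by (simp add: sgn_average_uminus[OF n])
      then show ?thesis using pos[OF n 3] y 3 by simp
    qed simp
  qed
  then show ?thesis using c0 by blast
qed


section \<open>The mass of the kernel above a graph\<close>

lemma continuous_antiderivative:
  fixes f :: "real \<Rightarrow> real"
  assumes "continuous_on UNIV f"
  shows "\<exists>F. \<forall>x. (F has_real_derivative f x) (at x)"
proof -
  have "\<exists>F. \<forall>x :: real. -\<infinity> < ereal x \<longrightarrow> ereal x < \<infinity> \<longrightarrow> (F has_vector_derivative f x) (at x)"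
    by (rule einterval_antiderivative) (use assms in \<open>auto simp: continuous_on_eq_continuous_at\<close>)
  then show ?thesis by (auto simp: has_real_derivative_iff_has_vector_derivative)
qed

lemma integral_indicator_ge_diff:
  fixes f F :: "real \<Rightarrow> real"
  assumes f: "continuous_on UNIV f" and F: "\<And>x. (F has_real_derivative f x) (at x)"
  shows "(LBINT s. f s * (indicator {a..} s - indicator {b..} s)) = F b - F a"
proof -
  have *: "(LBINT s. f s * (indicator {a..} s - indicator {b..} s)) = F b - F a" if "a \<le> b" for a b
  proof -
    have [measurable]: "f \<in> borel_measurable borel" using f by (rule borel_measurable_continuous_onI)
    have "(LBINT s. f s * (indicator {a..} s - indicator {b..} s)) = (LBINT s. indicator {a..b} s *\<^sub>R f s)"
    proof (rule integral_cong_AE)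
      show "AE s in lborel. f s * (indicator {a..} s - indicator {b..} s) = indicator {a..b} s *\<^sub>R f s"
        using AE_lborel_singleton[of b] by eventually_elim (use that in \<open>auto split: split_indicator\<close>)
    qed measurable
    also have "\<dots> = F b - F a"
    proof (rule integral_FTC_atLeastAtMost[OF that])
      show "(F has_vector_derivative f x) (at x within {a..b})" for x
        using F has_real_derivative_iff_has_vector_derivative has_vector_derivative_at_within by blast
    qed (rule continuous_on_subset[OF f], simp)
    finally show ?thesis .
  qed
  show ?thesis
  proof (cases "a \<le> b")
    case False
    then have "(LBINT s. f s * (indicator {b..} s - indicator {a..} s)) = F a - F b" by (intro *) simp
    moreover have "(LBINT s. f s * (indicator {a..} s - indicator {b..} s))
        = (LBINT s. - (f s * (indicator {b..} s - indicator {a..} s)))"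
      by (simp add: algebra_simps)
    ultimately show ?thesis by simp
  qed (rule *)
qed

lemma hyper_orthogonal: "norm \<nu> = 1 \<Longrightarrow> hyper \<nu> z \<bullet> \<nu> = 0"
  by (simp add: inner_diff_left norm_eq_1)

lemma hyper_translate: "norm \<nu> = 1 \<Longrightarrow> hyper \<nu> (z + s *\<^sub>R \<nu>) = hyper \<nu> z"
  by (simp add: inner_add_left norm_eq_1 algebra_simps)

lemma hyper_uminus: "hyper \<nu> (- z) = - hyper \<nu> z"
  by simp

lemma norm_orthogonal_le: "y \<bullet> \<nu> = 0 \<Longrightarrow> norm y \<le> norm (y + s *\<^sub>R \<nu>)"
proof -
  assume "y \<bullet> \<nu> = 0"
  then have "(norm y)\<^sup>2 \<le> (norm (y + s *\<^sub>R \<nu>))\<^sup>2"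
    unfolding power2_norm_eq_inner by (simp add: inner_add_left inner_add_right inner_commute mult.assoc[symmetric])
  then show ?thesis by (rule power2_le_imp_le) simp
qed

text \<open>
  On each line in direction \<open>\<nu>\<close> the two indicators differ by a segment, over which the kernel integrates to a difference
  of values of its primitive. This reduces the comparison of two graphs to a one-dimensional Taylor expansion.
\<close>

lemma graph_difference:
  fixes \<nu> :: "'a::euclidean_space"
  assumes \<nu>: "norm \<nu> = 1" and K: "integrable lborel K" and Kc: "continuous_on UNIV K"
    and [measurable]: "g1 \<in> borel_measurable borel" "g2 \<in> borel_measurable borel"
    and G: "\<And>y s. (G y has_real_derivative K (y + s *\<^sub>R \<nu>)) (at s)"
  shows "integrable lborel (\<lambda>z. std_normal_density (z \<bullet> \<nu>) * (G (hyper \<nu> z) (g2 (hyper \<nu> z)) - G (hyper \<nu> z) (g1 (hyper \<nu> z))))"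
    and "(LBINT z. K z * (indicator {z. g1 (hyper \<nu> z) \<le> z \<bullet> \<nu>} z - indicator {z. g2 (hyper \<nu> z) \<le> z \<bullet> \<nu>} z))
      = (LBINT z. std_normal_density (z \<bullet> \<nu>) * (G (hyper \<nu> z) (g2 (hyper \<nu> z)) - G (hyper \<nu> z) (g1 (hyper \<nu> z))))"
proof -
  let ?f = "\<lambda>z. K z * (indicator {z. g1 (hyper \<nu> z) \<le> z \<bullet> \<nu>} z - indicator {z. g2 (hyper \<nu> z) \<le> z \<bullet> \<nu>} z)"
  have [measurable]: "K \<in> borel_measurable borel" using Kc by (rule borel_measurable_continuous_onI)
  have fi: "integrable lborel ?f"
    by (rule Bochner_Integration.integrable_bound[OF K]) (auto simp: abs_mult mult_left_le split: split_indicator)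
  have inner: "(LBINT s. ?f (z + s *\<^sub>R \<nu>)) = G (hyper \<nu> z) (g2 (hyper \<nu> z)) - G (hyper \<nu> z) (g1 (hyper \<nu> z))" for z
  proof -
    let ?y = "hyper \<nu> z"
    let ?h = "\<lambda>s. K (?y + s *\<^sub>R \<nu>) * (indicator {g1 ?y..} s - indicator {g2 ?y..} s)"
    have "?f (z + s *\<^sub>R \<nu>) = ?h (s + z \<bullet> \<nu>)" for s
    proof -
      have 1: "?y + (s + z \<bullet> \<nu>) *\<^sub>R \<nu> = z + s *\<^sub>R \<nu>" by (simp add: algebra_simps)
      have 2: "(z + s *\<^sub>R \<nu>) \<bullet> \<nu> = s + z \<bullet> \<nu>" using \<nu> by (simp add: inner_add_left norm_eq_1)
      show ?thesis
        unfolding 1 indicator_def mem_Collect_eq atLeast_iff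
        unfolding hyper_translate[OF \<nu>]
        unfolding 2 by (rule refl)
    qed
    then have "(LBINT s. ?f (z + s *\<^sub>R \<nu>)) = (LBINT s. ?h (s + z \<bullet> \<nu>))" by (simp only:)
    also have "\<dots> = (LBINT s. ?h s)" by (rule lborel_integral_translate) measurable
    also have "\<dots> = G ?y (g2 ?y) - G ?y (g1 ?y)"
      by (rule integral_indicator_ge_diff[OF _ G]) (intro continuous_on_compose2[OF Kc] continuous_intros; simp)
    finally show ?thesis .
  qed
  show "integrable lborel (\<lambda>z. std_normal_density (z \<bullet> \<nu>) * (G (hyper \<nu> z) (g2 (hyper \<nu> z)) - G (hyper \<nu> z) (g1 (hyper \<nu> z))))"
    using integral_fibres(1)[OF \<nu> fi] unfolding inner .
  show "(LBINT z. ?f z)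
      = (LBINT z. std_normal_density (z \<bullet> \<nu>) * (G (hyper \<nu> z) (g2 (hyper \<nu> z)) - G (hyper \<nu> z) (g1 (hyper \<nu> z))))"
    using integral_fibres(2)[OF \<nu> fi] unfolding inner .
qed

text \<open>
  Bounds the total mass of \<open>exp (- |y| / 2)\<close> over the hyperplane, computed with the Gaussian density in the
  normal direction; \<open>exp (1 / 8)\<close> is the price for replacing this density by \<open>exp (- |s| / 2)\<close>.
\<close>

definition fibre_mass :: "'a::euclidean_space itself \<Rightarrow> real" where
  "fibre_mass _ = exp (1 / 8) * (LBINT z. exp (- (1 / 2) * norm (z::'a)))"

lemma fibre_mass_bound:
  fixes \<nu> :: "'a::euclidean_space"
  assumes \<nu>: "norm \<nu> = 1" and m: "f \<in> borel_measurable borel"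
    and f: "\<And>z. \<bar>f z\<bar> \<le> C * exp (- (1 / 2) * norm (hyper \<nu> z))"
  shows "integrable lborel (\<lambda>z. std_normal_density (z \<bullet> \<nu>) * f z)"
    and "\<bar>LBINT z. std_normal_density (z \<bullet> \<nu>) * f z\<bar> \<le> C * fibre_mass TYPE('a)"
proof -
  have C: "0 \<le> C" using order_trans[OF abs_ge_zero f[of 0]] by simp
  have e: "integrable lborel (\<lambda>z::'a. C * exp (1 / 8) * exp (- (1 / 2) * norm z))"
    by (intro integrable_mult_right integrable_exp_norm) simp
  have b: "norm (std_normal_density (z \<bullet> \<nu>) * f z) \<le> C * exp (1 / 8) * exp (- (1 / 2) * norm z)" for z
  proof -
    let ?s = "\<bar>z \<bullet> \<nu>\<bar>"
    have "std_normal_density (z \<bullet> \<nu>) \<le> exp (1 / 8 - ?s / 2)"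
    proof -
      have "1 \<le> sqrt (2 * pi)" using pi_gt3 by simp
      then have "std_normal_density (z \<bullet> \<nu>) \<le> exp (- (z \<bullet> \<nu>)\<^sup>2 / 2)"
        by (simp add: normal_density_def field_simps)
      also have "- (z \<bullet> \<nu>)\<^sup>2 / 2 \<le> 1 / 8 - ?s / 2"
      proof -
        have "0 \<le> (?s - 1 / 2)\<^sup>2" by simp
        then show ?thesis by (simp add: power2_diff) (simp add: field_simps)
      qed
      then have "exp (- (z \<bullet> \<nu>)\<^sup>2 / 2) \<le> exp (1 / 8 - ?s / 2)" by simp
      finally show ?thesis .
    qed
    moreover have "norm z \<le> norm (hyper \<nu> z) + ?s"
      using norm_triangle_ineq[of "hyper \<nu> z" "(z \<bullet> \<nu>) *\<^sub>R \<nu>"] \<nu> by simp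
    ultimately have "norm (std_normal_density (z \<bullet> \<nu>) * f z) \<le> exp (1 / 8 - ?s / 2) * (C * exp (- (1 / 2) * norm (hyper \<nu> z)))"
      unfolding norm_mult using f by (intro mult_mono) auto
    also have "\<dots> = C * exp (1 / 8) * exp (- (1 / 2) * (norm (hyper \<nu> z) + ?s))"
      by (simp add: algebra_simps flip: exp_add)
    also have "\<dots> \<le> C * exp (1 / 8) * exp (- (1 / 2) * norm z)"
      using \<open>norm z \<le> norm (hyper \<nu> z) + ?s\<close> C by (intro mult_left_mono) auto
    finally show ?thesis .
  qed
  show i: "integrable lborel (\<lambda>z. std_normal_density (z \<bullet> \<nu>) * f z)"
  proof (rule Bochner_Integration.integrable_bound[OF e])
    show "AE z in lborel. norm (std_normal_density (z \<bullet> \<nu>) * f z) \<le> norm (C * exp (1 / 8) * exp (- (1 / 2) * norm z))"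
      using b by (intro AE_I2) (metis abs_ge_self order_trans real_norm_def)
  qed (use m in measurable)
  have "norm (LBINT z. std_normal_density (z \<bullet> \<nu>) * f z) \<le> (LBINT z. C * exp (1 / 8) * exp (- (1 / 2) * norm (z::'a)))"
    by (rule Bochner_Integration.integral_norm_bound_integral[OF i e b])
  then show "\<bar>LBINT z. std_normal_density (z \<bullet> \<nu>) * f z\<bar> \<le> C * fibre_mass TYPE('a)"
    by (simp add: fibre_mass_def mult_ac)
qed

lemma half_space_centered:
  fixes m :: "'a::euclidean_space"
  assumes m: "m \<noteq> 0" and \<nu>: "norm \<nu> \<le> 1" and \<mu>: "\<bar>\<mu>\<bar> \<le> 1"
  shows "(LBINT z. kernel \<nu> \<mu> 0 z * indicator {z. 0 \<le> z \<bullet> m} z) = 1 / 2"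
proof -
  have [measurable]: "kernel \<nu> \<mu> 0 \<in> borel_measurable borel" using kernel_measurable[OF \<nu> \<mu>] by simp
  have K: "integrable lborel (kernel \<nu> \<mu> 0)" using kernel_integrable[OF \<nu> \<mu>] by simp
  have Ks: "integrable lborel (\<lambda>z. kernel \<nu> \<mu> 0 z * sgn (z \<bullet> m))"
    by (rule Bochner_Integration.integrable_bound[OF K]) (auto simp: abs_mult sgn_if)
  have z: "(LBINT z. kernel \<nu> \<mu> 0 z * sgn (z \<bullet> m)) = 0"
    by (rule lborel_integral_odd, measurable) (simp add: kernel_def kernel_c_uminus sgn_if)
  have ae: "AE z in lborel. m \<bullet> z \<noteq> 0" using m by (rule AE_off_hyperplane)
  have "(LBINT z. kernel \<nu> \<mu> 0 z * indicator {z. 0 \<le> z \<bullet> m} z)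
      = (LBINT z. kernel \<nu> \<mu> 0 z / 2 + kernel \<nu> \<mu> 0 z * sgn (z \<bullet> m) / 2)"
  proof (rule integral_cong_AE)
    show "AE z in lborel. kernel \<nu> \<mu> 0 z * indicator {z. 0 \<le> z \<bullet> m} z = kernel \<nu> \<mu> 0 z / 2 + kernel \<nu> \<mu> 0 z * sgn (z \<bullet> m) / 2"
      using ae by eventually_elim (auto simp: sgn_if inner_commute split: split_indicator)
  qed measurable
  also have "\<dots> = (LBINT z. kernel \<nu> \<mu> 0 z) / 2 + (LBINT z. kernel \<nu> \<mu> 0 z * sgn (z \<bullet> m)) / 2"
    using K Ks by simp
  finally show ?thesis by (simp add: kernel_integral_one[OF \<mu>] z)
qed

text \<open>
  At \<open>\<sigma> = 0\<close> both averages are one half by symmetry. So only the slab between the two positions of the hyperplane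
  contributes; this gains the factor \<open>\<sigma>\<close>.
\<close>

lemma half_space_perturbation:
  fixes \<nu> \<beta> :: "'a::euclidean_space"
  assumes \<nu>: "norm \<nu> = 1" and \<beta>: "\<beta> \<bullet> \<nu> = 0" and \<mu>: "\<bar>\<mu>\<bar> \<le> 1"
  shows "\<bar>(LBINT z. kernel \<nu> \<mu> 0 z * indicator {z. \<beta> \<bullet> hyper \<nu> z - \<sigma> \<le> z \<bullet> \<nu>} z)
       - (LBINT z. kernel \<nu> 0 0 z * indicator {z. \<beta> \<bullet> hyper \<nu> z - \<sigma> \<le> z \<bullet> \<nu>} z)\<bar>
    \<le> kernel_bound TYPE('a) * fibre_mass TYPE('a) * (\<bar>\<mu>\<bar> * \<bar>\<sigma>\<bar>)"
proof -
  let ?H = "\<lambda>\<sigma> z. indicator {z. \<beta> \<bullet> hyper \<nu> z - \<sigma> \<le> z \<bullet> \<nu>} z :: real"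
  let ?K = "\<lambda>z. kernel \<nu> \<mu> 0 z - kernel \<nu> 0 0 z"
  have \<nu>1: "norm \<nu> \<le> 1" using \<nu> by simp
  have K: "integrable lborel (kernel \<nu> \<mu> 0)" if "\<bar>\<mu>\<bar> \<le> 1" for \<mu> using kernel_integrable[OF \<nu>1 that] by simp
  have Kc: "continuous_on UNIV (kernel \<nu> \<mu> 0)" if "\<bar>\<mu>\<bar> \<le> 1" for \<mu> using kernel_continuous[OF \<nu>1 that] by simp
  have Km: "kernel \<nu> \<mu> 0 \<in> borel_measurable borel" if "\<bar>\<mu>\<bar> \<le> 1" for \<mu> using kernel_measurable[OF \<nu>1 that] by simp
  have KH: "integrable lborel (\<lambda>z. kernel \<nu> \<mu> 0 z * ?H \<sigma> z)" if "\<bar>\<mu>\<bar> \<le> 1" for \<sigma> \<mu>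
    using Km[OF that] by (intro Bochner_Integration.integrable_bound[OF K[OF that]]) (auto simp: abs_mult split: split_indicator)
  have mn: "\<nu> - \<beta> \<noteq> 0"
  proof
    assume "\<nu> - \<beta> = 0"
    then have "\<beta> \<bullet> \<nu> = 1" using \<nu> by (simp add: norm_eq_1)
    then show False using \<beta> by simp
  qed
  have half: "(LBINT z. kernel \<nu> \<mu> 0 z * ?H 0 z) = 1 / 2" if "\<bar>\<mu>\<bar> \<le> 1" for \<mu>
  proof -
    have "{z. \<beta> \<bullet> hyper \<nu> z - 0 \<le> z \<bullet> \<nu>} = {z. 0 \<le> z \<bullet> (\<nu> - \<beta>)}"
      using \<beta> by (auto simp: inner_diff_right inner_commute)
    then show ?thesis using half_space_centered[OF mn \<nu>1 that] by simp
  qed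
  have "\<exists>G. \<forall>y s. (G y has_real_derivative ?K (y + s *\<^sub>R \<nu>)) (at s)"
  proof -
    have "\<forall>y. \<exists>F. \<forall>s. (F has_real_derivative ?K (y + s *\<^sub>R \<nu>)) (at s)"
      by (intro allI continuous_antiderivative continuous_intros continuous_on_compose2[OF Kc] \<mu>) auto
    then show ?thesis by metis
  qed
  then obtain G where G: "\<And>y s. (G y has_real_derivative ?K (y + s *\<^sub>R \<nu>)) (at s)" by blast
  let ?d = "\<lambda>z. G (hyper \<nu> z) (\<beta> \<bullet> hyper \<nu> z) - G (hyper \<nu> z) (\<beta> \<bullet> hyper \<nu> z - \<sigma>)"
  have Ki: "integrable lborel ?K" using K[OF \<mu>] K[of 0] by simp
  have gd: "integrable lborel (\<lambda>z. std_normal_density (z \<bullet> \<nu>) * ?d z)"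
    "(LBINT z. ?K z * (?H \<sigma> z - ?H 0 z)) = (LBINT z. std_normal_density (z \<bullet> \<nu>) * ?d z)"
    using graph_difference[OF \<nu> Ki _ _ _ G, of "\<lambda>y. \<beta> \<bullet> y - \<sigma>" "\<lambda>y. \<beta> \<bullet> y"] Kc[OF \<mu>] Kc[of 0]
    by (auto simp: continuous_on_diff)
  have dm: "?d \<in> borel_measurable borel"
  proof -
    have "(\<lambda>z. std_normal_density (z \<bullet> \<nu>) * ?d z) \<in> borel_measurable borel"
      using borel_measurable_integrable[OF gd(1)] by simp
    then have "(\<lambda>z. (std_normal_density (z \<bullet> \<nu>) * ?d z) / std_normal_density (z \<bullet> \<nu>)) \<in> borel_measurable borel"
      by (intro borel_measurable_divide) auto
    moreover have "std_normal_density s \<noteq> 0" for s using normal_density_pos[of 1 0 s] by simp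
    ultimately show ?thesis by simp
  qed
  have db: "\<bar>?d z\<bar> \<le> (kernel_bound TYPE('a) * (\<bar>\<mu>\<bar> * \<bar>\<sigma>\<bar>)) * exp (- (1 / 2) * norm (hyper \<nu> z))" for z
  proof -
    let ?y = "hyper \<nu> z"
    have "norm (G ?y (\<beta> \<bullet> ?y) - G ?y (\<beta> \<bullet> ?y - \<sigma>)) \<le> (\<bar>\<mu>\<bar> * kernel_bound TYPE('a) * exp (- norm ?y)) * norm ((\<beta> \<bullet> ?y) - (\<beta> \<bullet> ?y - \<sigma>))"
    proof (rule field_differentiable_bound[OF convex_UNIV])
      show "(G ?y has_real_derivative ?K (?y + s *\<^sub>R \<nu>)) (at s within UNIV)" for s using G by simp
      fix s
      have "norm (?K (?y + s *\<^sub>R \<nu>)) \<le> \<bar>\<mu>\<bar> * kernel_bound TYPE('a) * exp (- norm (?y + s *\<^sub>R \<nu>))"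
        using kernel_perturbation[OF \<nu>1 \<mu>] by simp
      also have "\<dots> \<le> \<bar>\<mu>\<bar> * kernel_bound TYPE('a) * exp (- norm ?y)"
        using norm_orthogonal_le[OF hyper_orthogonal[OF \<nu>], of z s] kernel_bound_nonneg[where 'a='a]
        by (intro mult_left_mono) auto
      finally show "norm (?K (?y + s *\<^sub>R \<nu>)) \<le> \<bar>\<mu>\<bar> * kernel_bound TYPE('a) * exp (- norm ?y)" .
    qed auto
    also have "\<dots> = (kernel_bound TYPE('a) * (\<bar>\<mu>\<bar> * \<bar>\<sigma>\<bar>)) * exp (- norm ?y)" by simp
    also have "\<dots> \<le> (kernel_bound TYPE('a) * (\<bar>\<mu>\<bar> * \<bar>\<sigma>\<bar>)) * exp (- (1 / 2) * norm ?y)"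
      using kernel_bound_nonneg[where 'a='a] by (intro mult_left_mono) auto
    finally show ?thesis by simp
  qed
  have "(LBINT z. kernel \<nu> \<mu> 0 z * ?H \<sigma> z) - (LBINT z. kernel \<nu> 0 0 z * ?H \<sigma> z)
      = ((LBINT z. kernel \<nu> \<mu> 0 z * ?H \<sigma> z) - (LBINT z. kernel \<nu> 0 0 z * ?H \<sigma> z))
        - ((LBINT z. kernel \<nu> \<mu> 0 z * ?H 0 z) - (LBINT z. kernel \<nu> 0 0 z * ?H 0 z))"
    using half[OF \<mu>] half[of 0] by simp
  also have "\<dots> = (LBINT z. (kernel \<nu> \<mu> 0 z * ?H \<sigma> z - kernel \<nu> 0 0 z * ?H \<sigma> z) - (kernel \<nu> \<mu> 0 z * ?H 0 z - kernel \<nu> 0 0 z * ?H 0 z))"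
  proof -
    have a: "integrable lborel (\<lambda>z. kernel \<nu> \<mu> 0 z * ?H s z)" "integrable lborel (\<lambda>z. kernel \<nu> 0 0 z * ?H s z)" for s
      using KH[OF \<mu>] KH[of 0] by auto
    show ?thesis by (simp only: Bochner_Integration.integral_diff Bochner_Integration.integrable_diff a)
  qed
  also have "\<dots> = (LBINT z. ?K z * (?H \<sigma> z - ?H 0 z))"
    by (intro Bochner_Integration.integral_cong refl) (simp add: algebra_simps)
  also have "\<dots> = (LBINT z. std_normal_density (z \<bullet> \<nu>) * ?d z)" by (rule gd(2))
  finally show ?thesis
    using fibre_mass_bound(2)[OF \<nu> dm db] by (simp add: mult_ac)
qed

text \<open>
  Absorbs the polynomial weights: the cubic Taylor remainder involves the third power of a bound of degree four.
\<close>

lemma power12_exp: "0 \<le> r \<Longrightarrow> (1 + r) ^ 12 * exp (- r) \<le> 24 ^ 12 * exp (- (1 / 2) * (r::real))"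
proof -
  assume r: "0 \<le> r"
  have "1 + r / 24 \<le> exp (r / 24)" by (rule exp_ge_add_one_self)
  then have "(1 + r) ^ 12 \<le> (24 * exp (r / 24)) ^ 12"
    using r by (intro power_mono; linarith)
  also have "\<dots> = 24 ^ 12 * exp (r / 2)"
    by (simp add: power_mult_distrib exp_of_nat_mult[symmetric])
  finally have "(1 + r) ^ 12 * exp (- r) \<le> 24 ^ 12 * exp (r / 2) * exp (- r)" by (intro mult_right_mono) auto
  also have "\<dots> = 24 ^ 12 * exp (- (1 / 2) * r)" by (simp add: mult.assoc flip: exp_add)
  finally show ?thesis .
qed


text \<open>
  Taylor expansion of the primitive \<open>G\<close> along one fibre to second order in the displacement \<open>e = \<epsilon> q + \<epsilon>\<^sup>2 k + O(\<epsilon>\<^sup>3)\<close>. In the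
  correction terms the base point \<open>g - \<sigma>\<close> is replaced by \<open>g\<close> at the cost of a factor \<open>\<sigma>\<close>, and in the first-order term
  the kernel is replaced by the one with \<open>\<mu> = 0\<close>, so that this term no longer depends on \<open>\<epsilon>\<close> except for the prefactor.
\<close>

lemma graph_taylor_pointwise:
  fixes \<nu> y :: "'a::euclidean_space"
  assumes \<nu>: "norm \<nu> = 1" and y: "y \<bullet> \<nu> = 0"
    and \<mu>: "\<bar>\<mu>\<bar> \<le> 1" "\<bar>\<mu>\<bar> \<le> \<Lambda> * \<epsilon>\<^sup>2" and \<epsilon>: "0 < \<epsilon>" "\<epsilon> \<le> 1" and B: "0 \<le> B"
    and q: "\<bar>q\<bar> \<le> B * (1 + norm y) ^ 4" and k: "\<bar>k\<bar> \<le> B * (1 + norm y) ^ 4"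
    and e: "\<bar>e - \<epsilon> * q - \<epsilon>\<^sup>2 * k\<bar> \<le> B * \<epsilon> ^ 3 * (1 + norm y) ^ 4"
    and G: "\<And>s. (G has_real_derivative kernel \<nu> \<mu> 0 (y + s *\<^sub>R \<nu>)) (at s)"
  shows "\<bar>G (g - \<sigma>) - G (g - \<sigma> + e) + \<epsilon> * (q * kernel \<nu> 0 0 (y + g *\<^sub>R \<nu>))
      + \<epsilon>\<^sup>2 * (k * kernel \<nu> \<mu> 0 (y + g *\<^sub>R \<nu>) + q\<^sup>2 / 2 * kernel \<nu> \<mu> 1 (y + g *\<^sub>R \<nu>))\<bar>
    \<le> kernel_bound TYPE('a) * (27 * B ^ 3 + 9 * B\<^sup>2 + 3 * B + B * \<Lambda>) * (\<epsilon> ^ 3 + \<epsilon> * \<bar>\<sigma>\<bar>) * (24 ^ 12 * exp (- (1 / 2) * norm y))"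
proof -
  let ?b = "kernel_bound TYPE('a) * exp (- norm y)" and ?p = "(1 + norm y) ^ 4" and ?K = "\<lambda>j s. kernel \<nu> \<mu> j (y + s *\<^sub>R \<nu>)"
  define b where "b = ?b"
  define p where "p = ?p"
  let ?a = "g - \<sigma>"
  have \<nu>1: "norm \<nu> \<le> 1" using \<nu> by simp
  have b0: "0 \<le> b" unfolding b_def using kernel_bound_nonneg[where 'a='a] by simp
  have p1: "1 \<le> p" unfolding p_def by simp
  have pp: "p \<le> p\<^sup>2" "p\<^sup>2 \<le> p ^ 3" "p \<le> p ^ 3" using p1 power_increasing[of 1 2 p] power_increasing[of 2 3 p] power_increasing[of 1 3 p] by auto
  have Kb: "\<bar>?K j s\<bar> \<le> b" if "j \<le> 2" for j s
  proof -
    have "\<bar>?K j s\<bar> \<le> kernel_bound TYPE('a) * exp (- norm (y + s *\<^sub>R \<nu>))"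
      by (rule kernel_decay[OF \<nu>1 \<mu>(1) that])
    also have "\<dots> \<le> b" unfolding b_def
      using norm_orthogonal_le[OF y, of s] kernel_bound_nonneg[where 'a='a] by (intro mult_left_mono) auto
    finally show ?thesis .
  qed
  have Kd: "(?K j has_real_derivative ?K (Suc j) s) (at s)" if "j \<le> 1" for j s
    by (rule kernel_DERIV[OF \<nu>1 \<mu>(1) that])
  have Kl: "\<bar>?K j s - ?K j s'\<bar> \<le> b * \<bar>s - s'\<bar>" if "j \<le> 1" for j s s'
  proof -
    have "norm (?K j s - ?K j s') \<le> b * norm (s - s')"
      by (rule field_differentiable_bound[OF convex_UNIV, of _ "?K (Suc j)"])
        (use Kd[OF that] Kb[of "Suc j"] that in auto)
    then show ?thesis by simp
  qed
  have \<epsilon>p: "\<epsilon>\<^sup>2 \<le> \<epsilon>" "\<epsilon> ^ 3 \<le> \<epsilon>\<^sup>2" "\<epsilon> ^ 3 \<le> \<epsilon>"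
    using \<epsilon> power_decreasing[of 1 2 \<epsilon>] power_decreasing[of 2 3 \<epsilon>] power_decreasing[of 1 3 \<epsilon>] by auto
  have q': "\<bar>q\<bar> \<le> B * p" and k': "\<bar>k\<bar> \<le> B * p" and e': "\<bar>e - \<epsilon> * q - \<epsilon>\<^sup>2 * k\<bar> \<le> B * p * \<epsilon> ^ 3"
    using q k e by (auto simp: p_def mult_ac)
  have Bp: "0 \<le> B * p" using B p1 by simp
  have kk: "\<bar>\<epsilon>\<^sup>2 * k\<bar> \<le> B * p * \<epsilon>\<^sup>2" and qq: "\<bar>\<epsilon> * q\<bar> \<le> B * p * \<epsilon>"
    using mult_left_mono[OF k', of "\<epsilon>\<^sup>2"] mult_left_mono[OF q', of \<epsilon>] \<epsilon> by (auto simp: abs_mult mult_ac)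
  have Bp2: "B * p * \<epsilon>\<^sup>2 \<le> B * p * \<epsilon>" "B * p * \<epsilon> ^ 3 \<le> B * p * \<epsilon>\<^sup>2" "B * p * \<epsilon> ^ 3 \<le> B * p * \<epsilon>"
    using \<epsilon>p Bp by (auto intro: mult_left_mono)
  have e1: "\<bar>e\<bar> \<le> 3 * (B * p * \<epsilon>)" using e' kk qq Bp2 by linarith
  have e2: "\<bar>e - \<epsilon> * q\<bar> \<le> 2 * (B * p * \<epsilon>\<^sup>2)" using e' kk Bp2 by linarith
  have e3: "\<bar>\<epsilon> * q + \<epsilon>\<^sup>2 * k\<bar> \<le> 2 * (B * p * \<epsilon>)" using kk qq Bp2 by linarith
  have e4: "\<bar>e + \<epsilon> * q\<bar> \<le> 4 * (B * p * \<epsilon>)" using e1 qq by linarith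
  let ?S = "\<epsilon> ^ 3 + \<epsilon> * \<bar>\<sigma>\<bar>"
  have S: "\<epsilon> ^ 3 \<le> ?S" "\<epsilon> * \<bar>\<sigma>\<bar> \<le> ?S" "0 \<le> ?S" using \<epsilon> by auto
  have "\<bar>G (?a + e) - (G ?a + ?K 0 ?a * e + ?K 1 ?a * e\<^sup>2 / 2)\<bar> \<le> b * \<bar>e\<bar> ^ 3"
  proof -
    let ?f = "\<lambda>i. if i = (0::nat) then G else ?K (i - 1)"
    have "norm (?f 0 (?a + e) - (\<Sum>i\<le>2. ?f i ?a * ((?a + e) - ?a) ^ i / fact i)) \<le> b * norm ((?a + e) - ?a) ^ Suc 2 / fact 2"
    proof (rule field_Taylor[OF convex_UNIV])
      show "(?f i has_real_derivative ?f (Suc i) x) (at x within UNIV)" if "i \<le> 2" for i x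
      proof (cases i)
        case 0 then show ?thesis using G by simp
      next
        case (Suc j) then show ?thesis using Kd[of j x] that by simp
      qed
      show "norm (?f (Suc 2) x) \<le> b" for x using Kb[of 2 x] by simp
    qed auto
    also have "\<dots> \<le> b * \<bar>e\<bar> ^ 3" using b0 by simp
    finally show ?thesis by (simp add: numeral_2_eq_2)
  qed
  also have "\<dots> \<le> b * (3 * (B * p * \<epsilon>)) ^ 3" using e1 b0 by (intro mult_left_mono power_mono) auto
  also have "\<dots> = b * (27 * B ^ 3 * p ^ 3 * \<epsilon> ^ 3)" by (simp add: power_mult_distrib)
  also have "\<dots> \<le> b * (27 * B ^ 3 * p ^ 3 * ?S)" using S b0 B p1 by (intro mult_left_mono) auto
  finally have T1: "\<bar>G (?a + e) - (G ?a + ?K 0 ?a * e + ?K 1 ?a * e\<^sup>2 / 2)\<bar> \<le> b * (27 * B ^ 3 * p ^ 3 * ?S)" .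
  have "\<bar>?K 0 ?a * (e - \<epsilon> * q - \<epsilon>\<^sup>2 * k)\<bar> \<le> b * (B * p * \<epsilon> ^ 3)"
    unfolding abs_mult using Kb[of 0 ?a] e' b0 by (intro mult_mono) auto
  also have "\<dots> \<le> b * (B * p ^ 3 * ?S)"
    using pp S b0 B p1 \<epsilon> by (intro mult_left_mono mult_mono) auto
  finally have T2: "\<bar>?K 0 ?a * (e - \<epsilon> * q - \<epsilon>\<^sup>2 * k)\<bar> \<le> b * (B * p ^ 3 * ?S)" .
  have "\<bar>(?K 0 ?a - ?K 0 g) * (\<epsilon> * q + \<epsilon>\<^sup>2 * k)\<bar> \<le> (b * \<bar>\<sigma>\<bar>) * (2 * (B * p * \<epsilon>))"
    unfolding abs_mult using Kl[of 0 ?a g] e3 b0 by (intro mult_mono) auto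
  also have "\<dots> = b * (2 * B * p * (\<epsilon> * \<bar>\<sigma>\<bar>))" by simp
  also have "\<dots> \<le> b * (2 * B * p ^ 3 * ?S)"
    using pp S b0 B p1 \<epsilon> by (intro mult_left_mono mult_mono) auto
  finally have T3: "\<bar>(?K 0 ?a - ?K 0 g) * (\<epsilon> * q + \<epsilon>\<^sup>2 * k)\<bar> \<le> b * (2 * B * p ^ 3 * ?S)" .
  have "\<bar>\<epsilon> * q * (?K 0 g - kernel \<nu> 0 0 (y + g *\<^sub>R \<nu>))\<bar> \<le> (B * p * \<epsilon>) * (\<bar>\<mu>\<bar> * b)"
  proof -
    have "\<bar>?K 0 g - kernel \<nu> 0 0 (y + g *\<^sub>R \<nu>)\<bar> \<le> \<bar>\<mu>\<bar> * kernel_bound TYPE('a) * exp (- norm (y + g *\<^sub>R \<nu>))"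
      by (rule kernel_perturbation[OF \<nu>1 \<mu>(1)])
    also have "\<dots> \<le> \<bar>\<mu>\<bar> * b" unfolding b_def mult.assoc
      using norm_orthogonal_le[OF y, of g] kernel_bound_nonneg[where 'a='a] by (intro mult_left_mono) auto
    finally show ?thesis unfolding abs_mult[of "\<epsilon> * q"] using qq Bp \<epsilon> by (intro mult_mono) auto
  qed
  also have "\<dots> \<le> (B * p * \<epsilon>) * ((\<Lambda> * \<epsilon>\<^sup>2) * b)"
    using \<mu>(2) b0 Bp \<epsilon> by (intro mult_left_mono mult_right_mono) auto
  also have "\<dots> = b * (B * \<Lambda> * p * \<epsilon> ^ 3)" by (simp add: power2_eq_square power3_eq_cube)
  also have "\<dots> \<le> b * (B * \<Lambda> * p ^ 3 * ?S)"
  proof -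
    have "0 \<le> \<Lambda> * \<epsilon>\<^sup>2" using \<mu>(2) by linarith
    then have "0 \<le> \<Lambda>" using \<epsilon> by (simp add: zero_le_mult_iff)
    then show ?thesis using pp S b0 B p1 \<epsilon> by (intro mult_left_mono mult_mono) auto
  qed
  finally have T4: "\<bar>\<epsilon> * q * (?K 0 g - kernel \<nu> 0 0 (y + g *\<^sub>R \<nu>))\<bar> \<le> b * (B * \<Lambda> * p ^ 3 * ?S)" .
  have "\<bar>(?K 1 ?a - ?K 1 g) * (e\<^sup>2 / 2)\<bar> \<le> (b * \<bar>\<sigma>\<bar>) * ((3 * (B * p * \<epsilon>))\<^sup>2 / 2)"
  proof -
    have "e\<^sup>2 \<le> (3 * (B * p * \<epsilon>))\<^sup>2" using e1 abs_le_square_iff[of e "3 * (B * p * \<epsilon>)"] Bp \<epsilon> by simp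
    then show ?thesis unfolding abs_mult using Kl[of 1 ?a g] b0 by (intro mult_mono) auto
  qed
  also have "\<dots> = b * (9 / 2 * B\<^sup>2 * p\<^sup>2 * (\<epsilon>\<^sup>2 * \<bar>\<sigma>\<bar>))" by (simp add: power_mult_distrib)
  also have "\<dots> \<le> b * (5 * B\<^sup>2 * p ^ 3 * ?S)"
  proof -
    have "\<epsilon>\<^sup>2 * \<bar>\<sigma>\<bar> \<le> ?S" using mult_right_mono[OF \<epsilon>p(1), of "\<bar>\<sigma>\<bar>"] S(2) by linarith
    then show ?thesis using pp S b0 B p1 \<epsilon> by (intro mult_left_mono mult_mono) auto
  qed
  finally have T5: "\<bar>(?K 1 ?a - ?K 1 g) * (e\<^sup>2 / 2)\<bar> \<le> b * (5 * B\<^sup>2 * p ^ 3 * ?S)" .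
  have "\<bar>?K 1 g * ((e - \<epsilon> * q) * (e + \<epsilon> * q) / 2)\<bar> \<le> b * ((2 * (B * p * \<epsilon>\<^sup>2)) * (4 * (B * p * \<epsilon>)) / 2)"
  proof -
    have "\<bar>(e - \<epsilon> * q) * (e + \<epsilon> * q)\<bar> \<le> (2 * (B * p * \<epsilon>\<^sup>2)) * (4 * (B * p * \<epsilon>))"
      unfolding abs_mult using e2 e4 Bp \<epsilon> by (intro mult_mono) auto
    then have "\<bar>(e - \<epsilon> * q) * (e + \<epsilon> * q) / 2\<bar> \<le> (2 * (B * p * \<epsilon>\<^sup>2)) * (4 * (B * p * \<epsilon>)) / 2"
      unfolding abs_divide abs_numeral by (rule divide_right_mono) simp
    then show ?thesis unfolding abs_mult[of "?K 1 g"] using Kb[of 1 g] b0 by (intro mult_mono) auto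
  qed
  also have "\<dots> = b * (4 * B\<^sup>2 * p\<^sup>2 * \<epsilon> ^ 3)" by (simp add: power2_eq_square power3_eq_cube)
  also have "\<dots> \<le> b * (4 * B\<^sup>2 * p ^ 3 * ?S)"
    using pp S b0 B p1 \<epsilon> by (intro mult_left_mono mult_mono) auto
  finally have T6: "\<bar>?K 1 g * ((e - \<epsilon> * q) * (e + \<epsilon> * q) / 2)\<bar> \<le> b * (4 * B\<^sup>2 * p ^ 3 * ?S)" .
  have split: "G ?a - G (?a + e) + \<epsilon> * (q * kernel \<nu> 0 0 (y + g *\<^sub>R \<nu>)) + \<epsilon>\<^sup>2 * (k * ?K 0 g + q\<^sup>2 / 2 * ?K 1 g)
     = - (G (?a + e) - (G ?a + ?K 0 ?a * e + ?K 1 ?a * e\<^sup>2 / 2))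
       - ?K 0 ?a * (e - \<epsilon> * q - \<epsilon>\<^sup>2 * k) - (?K 0 ?a - ?K 0 g) * (\<epsilon> * q + \<epsilon>\<^sup>2 * k)
       - \<epsilon> * q * (?K 0 g - kernel \<nu> 0 0 (y + g *\<^sub>R \<nu>))
       - (?K 1 ?a - ?K 1 g) * (e\<^sup>2 / 2) - ?K 1 g * ((e - \<epsilon> * q) * (e + \<epsilon> * q) / 2)"
  proof -
    have "A - A' + \<epsilon> * (q * k0) + \<epsilon>\<^sup>2 * (k * kg + q\<^sup>2 / 2 * k1g) = - (A' - (A + ka * e + k1a * e\<^sup>2 / 2))
       - ka * (e - \<epsilon> * q - \<epsilon>\<^sup>2 * k) - (ka - kg) * (\<epsilon> * q + \<epsilon>\<^sup>2 * k)
       - \<epsilon> * q * (kg - k0) - (k1a - k1g) * (e\<^sup>2 / 2) - k1g * ((e - \<epsilon> * q) * (e + \<epsilon> * q) / 2)"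
      for A A' k0 kg k1g ka k1a :: real
      by (simp add: field_simps power2_eq_square)
    then show ?thesis .
  qed
  have "\<bar>G ?a - G (?a + e) + \<epsilon> * (q * kernel \<nu> 0 0 (y + g *\<^sub>R \<nu>)) + \<epsilon>\<^sup>2 * (k * ?K 0 g + q\<^sup>2 / 2 * ?K 1 g)\<bar>
     \<le> b * (27 * B ^ 3 * p ^ 3 * ?S) + b * (B * p ^ 3 * ?S) + b * (2 * B * p ^ 3 * ?S) + b * (B * \<Lambda> * p ^ 3 * ?S)
       + b * (5 * B\<^sup>2 * p ^ 3 * ?S) + b * (4 * B\<^sup>2 * p ^ 3 * ?S)"
  proof -
    have "\<bar>- t1 - t2 - t3 - t4 - t5 - t6\<bar> \<le> b1 + b2 + b3 + b4 + b5 + b6"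
      if "\<bar>t1\<bar> \<le> b1" "\<bar>t2\<bar> \<le> b2" "\<bar>t3\<bar> \<le> b3" "\<bar>t4\<bar> \<le> b4" "\<bar>t5\<bar> \<le> b5" "\<bar>t6\<bar> \<le> b6"
      for t1 t2 t3 t4 t5 t6 b1 b2 b3 b4 b5 b6 :: real
      using that by linarith
    from this[OF T1 T2 T3 T4 T5 T6] show ?thesis unfolding split .
  qed
  also have "\<dots> = (27 * B ^ 3 + 9 * B\<^sup>2 + 3 * B + B * \<Lambda>) * ?S * (b * p ^ 3)"
  proof -
    have "b * (x * r * S) + b * (B * r * S) + b * (2 * B * r * S) + b * (B * \<Lambda> * r * S) + b * (5 * z * r * S) + b * (4 * z * r * S)
       = (x + 9 * z + 3 * B + B * \<Lambda>) * S * (b * r)" for x z r S :: real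
      by (simp add: algebra_simps)
    then show ?thesis .
  qed
  also have "b * p ^ 3 = kernel_bound TYPE('a) * ((1 + norm y) ^ 12 * exp (- norm y))"
    by (simp add: b_def p_def flip: power_mult)
  also have "(27 * B ^ 3 + 9 * B\<^sup>2 + 3 * B + B * \<Lambda>) * ?S * (kernel_bound TYPE('a) * ((1 + norm y) ^ 12 * exp (- norm y)))
     \<le> (27 * B ^ 3 + 9 * B\<^sup>2 + 3 * B + B * \<Lambda>) * ?S * (kernel_bound TYPE('a) * (24 ^ 12 * exp (- (1 / 2) * norm y)))"
  proof -
    have "0 \<le> \<Lambda> * \<epsilon>\<^sup>2" using \<mu>(2) by linarith
    then have "0 \<le> \<Lambda>" using \<epsilon> by (simp add: zero_le_mult_iff)
    then show ?thesis
      using power12_exp[of "norm y"] kernel_bound_nonneg[where 'a='a] S(3) B \<epsilon>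
      by (intro mult_left_mono mult_nonneg_nonneg add_nonneg_nonneg) auto
  qed
  finally show ?thesis by (simp add: mult_ac)
qed

text \<open>
  Integrates the pointwise expansion over the hyperplane. The second-order term vanishes: \<open>c\<close> is odd and the kernel even,
  \<open>Q\<close> is even and the first derivative of the kernel odd.
\<close>

lemma graph_expansion:
  fixes \<nu> \<beta> :: "'a::euclidean_space"
  assumes \<nu>: "norm \<nu> = 1"
    and \<mu>: "\<bar>\<mu>\<bar> \<le> 1" "\<bar>\<mu>\<bar> \<le> \<Lambda> * \<epsilon>\<^sup>2" and \<epsilon>: "0 < \<epsilon>" "\<epsilon> \<le> 1" and B: "0 \<le> B"
    and Qm: "continuous_on UNIV Q" and cm: "continuous_on UNIV c" and em: "e \<in> borel_measurable borel"
    and Q: "\<And>y. \<bar>Q y\<bar> \<le> B * (1 + norm y) ^ 4" and c: "\<And>y. \<bar>c y\<bar> \<le> B * (1 + norm y) ^ 4"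
    and e: "\<And>y. y \<bullet> \<nu> = 0 \<Longrightarrow> \<bar>e y - \<epsilon> * Q y - \<epsilon>\<^sup>2 * c y\<bar> \<le> B * \<epsilon> ^ 3 * (1 + norm y) ^ 4"
    and even: "\<And>y. Q (- y) = Q y" and odd: "\<And>y. c (- y) = - c y"
  shows "\<bar>(LBINT z. kernel \<nu> \<mu> 0 z * indicator {z. \<beta> \<bullet> hyper \<nu> z - \<sigma> + e (hyper \<nu> z) \<le> z \<bullet> \<nu>} z)
      - (LBINT z. kernel \<nu> \<mu> 0 z * indicator {z. \<beta> \<bullet> hyper \<nu> z - \<sigma> \<le> z \<bullet> \<nu>} z)
      + \<epsilon> * (LBINT z. std_normal_density (z \<bullet> \<nu>) * (Q (hyper \<nu> z) * kernel \<nu> 0 0 (hyper \<nu> z + (\<beta> \<bullet> hyper \<nu> z) *\<^sub>R \<nu>)))\<bar>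
    \<le> kernel_bound TYPE('a) * (27 * B ^ 3 + 9 * B\<^sup>2 + 3 * B + B * \<Lambda>) * 24 ^ 12 * fibre_mass TYPE('a) * (\<epsilon> ^ 3 + \<epsilon> * \<bar>\<sigma>\<bar>)"
proof -
  have \<nu>1: "norm \<nu> \<le> 1" using \<nu> by simp
  let ?y = "\<lambda>z. hyper \<nu> z" and ?\<rho> = "\<lambda>z. std_normal_density (z \<bullet> \<nu>)"
  let ?w = "\<lambda>z. hyper \<nu> z + (\<beta> \<bullet> hyper \<nu> z) *\<^sub>R \<nu>"
  note [measurable] = borel_measurable_continuous_onI[OF Qm] borel_measurable_continuous_onI[OF cm] em
  have Kc: "continuous_on UNIV (kernel \<nu> \<mu> j)" if "j \<le> 2" "\<bar>\<mu>\<bar> \<le> 1" for j \<mu> using kernel_continuous[OF \<nu>1 that(2,1)] .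
  have Km: "kernel \<nu> \<mu> j \<in> borel_measurable borel" if "j \<le> 2" "\<bar>\<mu>\<bar> \<le> 1" for j \<mu> using kernel_measurable[OF \<nu>1 that(2,1)] .
  have K: "integrable lborel (kernel \<nu> \<mu> 0)" using kernel_integrable[OF \<nu>1 \<mu>(1)] by simp
  have [measurable]: "kernel \<nu> \<mu> 0 \<in> borel_measurable borel" "kernel \<nu> \<mu> 1 \<in> borel_measurable borel"
     "kernel \<nu> 0 0 \<in> borel_measurable borel" using Km[of _ \<mu>] Km[of _ 0] \<mu> by auto
  have "\<forall>y. \<exists>F. \<forall>s. (F has_real_derivative kernel \<nu> \<mu> 0 (y + s *\<^sub>R \<nu>)) (at s)"
    by (intro allI continuous_antiderivative continuous_on_compose2[OF Kc] continuous_intros \<mu>) auto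
  then obtain G where G: "\<And>y s. (G y has_real_derivative kernel \<nu> \<mu> 0 (y + s *\<^sub>R \<nu>)) (at s)" by metis
  let ?D = "\<lambda>z. G (?y z) (\<beta> \<bullet> ?y z - \<sigma>) - G (?y z) (\<beta> \<bullet> ?y z - \<sigma> + e (?y z))"
  let ?q = "\<lambda>z. Q (?y z) * kernel \<nu> 0 0 (?w z)"
  let ?o = "\<lambda>z. c (?y z) * kernel \<nu> \<mu> 0 (?w z) + (Q (?y z))\<^sup>2 / 2 * kernel \<nu> \<mu> 1 (?w z)"
  let ?C = "kernel_bound TYPE('a) * (27 * B ^ 3 + 9 * B\<^sup>2 + 3 * B + B * \<Lambda>) * (\<epsilon> ^ 3 + \<epsilon> * \<bar>\<sigma>\<bar>) * 24 ^ 12"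
  let ?H = "\<lambda>z. indicator {z. \<beta> \<bullet> hyper \<nu> z - \<sigma> + e (hyper \<nu> z) \<le> z \<bullet> \<nu>} z :: real"
  let ?I = "\<lambda>z. indicator {z. \<beta> \<bullet> hyper \<nu> z - \<sigma> \<le> z \<bullet> \<nu>} z :: real"
  have gd: "integrable lborel (\<lambda>z. ?\<rho> z * ?D z)"
    "(LBINT z. kernel \<nu> \<mu> 0 z * (?H z - ?I z)) = (LBINT z. ?\<rho> z * ?D z)"
  proof -
    have m: "(\<lambda>y. \<beta> \<bullet> y - \<sigma> + e y) \<in> borel_measurable borel" "(\<lambda>y. \<beta> \<bullet> y - \<sigma>) \<in> borel_measurable borel"
      by measurable
    have c0: "continuous_on UNIV (kernel \<nu> \<mu> 0)" using Kc \<mu> by simp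
    note gd = graph_difference[where ?g1.0 = "\<lambda>y. \<beta> \<bullet> y - \<sigma> + e y" and ?g2.0 = "\<lambda>y. \<beta> \<bullet> y - \<sigma>" and G = G, OF \<nu> K c0 m G]
    show "integrable lborel (\<lambda>z. ?\<rho> z * ?D z)"
      by (rule gd(1))
    show "(LBINT z. kernel \<nu> \<mu> 0 z * (?H z - ?I z)) = (LBINT z. ?\<rho> z * ?D z)"
      by (rule gd(2))
  qed
  have KH: "integrable lborel (\<lambda>z. kernel \<nu> \<mu> 0 z * indicator A z)" if [measurable]: "A \<in> sets borel" for A
    by (rule Bochner_Integration.integrable_bound[OF K]) (auto simp: abs_mult split: split_indicator)
  have s: "{z. \<beta> \<bullet> hyper \<nu> z - \<sigma> + e (hyper \<nu> z) \<le> z \<bullet> \<nu>} \<in> sets borel" "{z. \<beta> \<bullet> hyper \<nu> z - \<sigma> \<le> z \<bullet> \<nu>} \<in> sets borel"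
    by measurable
  have KK: "\<bar>kernel \<nu> \<mu>' j (?w z)\<bar> \<le> kernel_bound TYPE('a) * exp (- norm (?y z))" if "j \<le> 2" "\<bar>\<mu>'\<bar> \<le> 1" for j z \<mu>'
  proof -
    have "\<bar>kernel \<nu> \<mu>' j (?w z)\<bar> \<le> kernel_bound TYPE('a) * exp (- norm (?w z))"
      by (rule kernel_decay[OF \<nu>1 that(2,1)])
    also have "\<dots> \<le> kernel_bound TYPE('a) * exp (- norm (?y z))"
      using norm_orthogonal_le[OF hyper_orthogonal[OF \<nu>], of z "\<beta> \<bullet> ?y z"] kernel_bound_nonneg[where 'a='a]
      by (intro mult_left_mono) auto
    finally show ?thesis .
  qed
  have P8: "(1 + norm (?y z)) ^ 8 * exp (- norm (?y z)) \<le> 24 ^ 12 * exp (- (1 / 2) * norm (?y z))"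
   and P4: "(1 + norm (?y z)) ^ 4 * exp (- norm (?y z)) \<le> 24 ^ 12 * exp (- (1 / 2) * norm (?y z))" for z
  proof -
    have "(1 + norm (?y z)) ^ 8 * exp (- norm (?y z)) \<le> (1 + norm (?y z)) ^ 12 * exp (- norm (?y z))"
      "(1 + norm (?y z)) ^ 4 * exp (- norm (?y z)) \<le> (1 + norm (?y z)) ^ 12 * exp (- norm (?y z))"
      by (intro mult_right_mono power_increasing; simp)+
    then show "(1 + norm (?y z)) ^ 8 * exp (- norm (?y z)) \<le> 24 ^ 12 * exp (- (1 / 2) * norm (?y z))"
      "(1 + norm (?y z)) ^ 4 * exp (- norm (?y z)) \<le> 24 ^ 12 * exp (- (1 / 2) * norm (?y z))"
      using power12_exp[of "norm (?y z)", OF norm_ge_zero] order_trans by blast+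
  qed
  have qb: "\<bar>?q z\<bar> \<le> (B * kernel_bound TYPE('a) * 24 ^ 12) * exp (- (1 / 2) * norm (?y z))" for z
  proof -
    have "\<bar>?q z\<bar> \<le> (B * (1 + norm (?y z)) ^ 4) * (kernel_bound TYPE('a) * exp (- norm (?y z)))"
      unfolding abs_mult using Q KK[of 0 0] B by (intro mult_mono) auto
    also have "\<dots> = (B * kernel_bound TYPE('a)) * ((1 + norm (?y z)) ^ 4 * exp (- norm (?y z)))" by simp
    also have "\<dots> \<le> (B * kernel_bound TYPE('a)) * (24 ^ 12 * exp (- (1 / 2) * norm (?y z)))"
      using P4 B kernel_bound_nonneg[where 'a='a] by (intro mult_left_mono) auto
    finally show ?thesis by simp
  qed
  have ob: "\<bar>?o z\<bar> \<le> ((B + B\<^sup>2) * kernel_bound TYPE('a) * 24 ^ 12) * exp (- (1 / 2) * norm (?y z))" for z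
  proof -
    have 1: "\<bar>c (?y z) * kernel \<nu> \<mu> 0 (?w z)\<bar> \<le> (B * (1 + norm (?y z)) ^ 4) * (kernel_bound TYPE('a) * exp (- norm (?y z)))"
      unfolding abs_mult using c KK[of 0 \<mu>] B \<mu> by (intro mult_mono) auto
    have "(Q (?y z))\<^sup>2 \<le> (B * (1 + norm (?y z)) ^ 4)\<^sup>2"
      using abs_le_square_iff[of "Q (?y z)" "B * (1 + norm (?y z)) ^ 4"] Q[of "?y z"] B by simp
    also have "\<dots> = B\<^sup>2 * (1 + norm (?y z)) ^ 8" by (simp add: power_mult_distrib flip: power_mult)
    finally have "\<bar>(Q (?y z))\<^sup>2 / 2\<bar> \<le> B\<^sup>2 * (1 + norm (?y z)) ^ 8"
      using zero_le_power2[of "Q (?y z)"] by (subst abs_of_nonneg) linarith+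
    then have 2: "\<bar>(Q (?y z))\<^sup>2 / 2 * kernel \<nu> \<mu> 1 (?w z)\<bar> \<le> (B\<^sup>2 * (1 + norm (?y z)) ^ 8) * (kernel_bound TYPE('a) * exp (- norm (?y z)))"
      unfolding abs_mult[of "_ / 2"] using KK[of 1 \<mu>] B \<mu> by (intro mult_mono) auto
    have "\<bar>?o z\<bar> \<le> (B * kernel_bound TYPE('a)) * ((1 + norm (?y z)) ^ 4 * exp (- norm (?y z))) + (B\<^sup>2 * kernel_bound TYPE('a)) * ((1 + norm (?y z)) ^ 8 * exp (- norm (?y z)))"
      using 1 2 by (simp only: mult_ac)
    also have "\<dots> \<le> (B * kernel_bound TYPE('a)) * (24 ^ 12 * exp (- (1 / 2) * norm (?y z))) + (B\<^sup>2 * kernel_bound TYPE('a)) * (24 ^ 12 * exp (- (1 / 2) * norm (?y z)))"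
      using P4 P8 B kernel_bound_nonneg[where 'a='a] by (intro add_mono mult_left_mono) auto
    finally show ?thesis by (simp add: algebra_simps)
  qed
  have qi: "integrable lborel (\<lambda>z. ?\<rho> z * ?q z)"
    by (rule fibre_mass_bound(1)[OF \<nu> _ qb]) measurable
  have oi: "integrable lborel (\<lambda>z. ?\<rho> z * ?o z)"
    by (rule fibre_mass_bound(1)[OF \<nu> _ ob]) measurable
  have o0: "(LBINT z. ?\<rho> z * ?o z) = 0"
  proof (rule lborel_integral_odd)
    show "(\<lambda>z. ?\<rho> z * ?o z) \<in> borel_measurable borel" by measurable
    fix z
    have w: "?w (- z) = - ?w z"
      unfolding hyper_uminus by (simp only: inner_minus_right scaleR_minus_left minus_add_distrib)
    have r: "?\<rho> (- z) = ?\<rho> z" by (simp add: normal_density_def)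
    have "?o (- z) = - ?o z"
      unfolding w unfolding hyper_uminus even odd kernel_uminus[OF \<nu>1 \<mu>(1)] by simp
    then show "?\<rho> (- z) * ?o (- z) = - (?\<rho> z * ?o z)"
      unfolding r by (simp only: mult_minus_right)
  qed
  let ?\<Delta> = "\<lambda>z. ?D z + \<epsilon> * ?q z + \<epsilon>\<^sup>2 * ?o z"
  have \<Delta>i: "integrable lborel (\<lambda>z. ?\<rho> z * ?D z + \<epsilon> * (?\<rho> z * ?q z) + \<epsilon>\<^sup>2 * (?\<rho> z * ?o z))"
    using gd(1) qi oi by (intro Bochner_Integration.integrable_add integrable_mult_right)
  have \<Delta>e: "?\<rho> z * ?D z + \<epsilon> * (?\<rho> z * ?q z) + \<epsilon>\<^sup>2 * (?\<rho> z * ?o z) = ?\<rho> z * ?\<Delta> z" for z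
    by (simp only: algebra_simps)
  have \<Delta>m: "?\<Delta> \<in> borel_measurable borel"
  proof -
    have "(\<lambda>z. ?\<rho> z * ?\<Delta> z) \<in> borel_measurable borel"
      using borel_measurable_integrable[OF \<Delta>i] unfolding \<Delta>e by simp
    then have "(\<lambda>z. (?\<rho> z * ?\<Delta> z) / ?\<rho> z) \<in> borel_measurable borel"
      by (intro borel_measurable_divide) auto
    moreover have "std_normal_density s \<noteq> 0" for s using normal_density_pos[of 1 0 s] by simp
    ultimately show ?thesis by simp
  qed
  have \<Delta>b: "\<bar>?\<Delta> z\<bar> \<le> ?C * exp (- (1 / 2) * norm (?y z))" for z
    using graph_taylor_pointwise[OF \<nu> hyper_orthogonal[OF \<nu>] \<mu> \<epsilon> B Q c e[OF hyper_orthogonal[OF \<nu>]] G, of z "\<beta> \<bullet> ?y z" \<sigma>]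
    by (simp only: mult.assoc)
  have "(LBINT z. kernel \<nu> \<mu> 0 z * ?H z) - (LBINT z. kernel \<nu> \<mu> 0 z * ?I z) + \<epsilon> * (LBINT z. ?\<rho> z * ?q z)
      = (LBINT z. kernel \<nu> \<mu> 0 z * (?H z - ?I z)) + \<epsilon> * (LBINT z. ?\<rho> z * ?q z) + \<epsilon>\<^sup>2 * (LBINT z. ?\<rho> z * ?o z)"
    unfolding o0 right_diff_distrib using KH[OF s(1)] KH[OF s(2)] by (simp only: Bochner_Integration.integral_diff mult_zero_right add_0_right)
  also have "\<dots> = (LBINT z. ?\<rho> z * ?D z + \<epsilon> * (?\<rho> z * ?q z) + \<epsilon>\<^sup>2 * (?\<rho> z * ?o z))"
    unfolding gd(2) using gd(1) qi oi
    by (simp only: Bochner_Integration.integral_add Bochner_Integration.integrable_add integrable_mult_right integral_mult_right_zero)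
  also have "\<dots> = (LBINT z. ?\<rho> z * ?\<Delta> z)" by (simp only: \<Delta>e)
  finally show ?thesis
    using fibre_mass_bound(2)[OF \<nu> \<Delta>m \<Delta>b] by (simp only: mult_ac)
qed


section \<open>Taylor expansion of the graph function\<close>

text \<open>
  The \<open>k\<close>-th derivative of \<open>s \<mapsto> f (x + s *\<^sub>R v)\<close> at zero, expanded over the basis. In this form it is visibly a
  homogeneous polynomial in \<open>v\<close>, and bounds that are uniform in \<open>v\<close> reduce to finitely many continuous partial derivatives.
\<close>

primrec dir_deriv :: "nat \<Rightarrow> ('a::euclidean_space \<Rightarrow> real) \<Rightarrow> 'a \<Rightarrow> 'a \<Rightarrow> real" where
  "dir_deriv 0 f x v = f x"
| "dir_deriv (Suc k) f x v = (\<Sum>b\<in>Basis. (v \<bullet> b) * dir_deriv k (\<lambda>x. frechet_derivative f (at x) b) x v)"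

lemma C_k_continuous: "C_k k f \<Longrightarrow> continuous_on UNIV f"
  by (cases k) (auto simp: continuous_on_eq_continuous_at differentiable_imp_continuous_within)

lemma dir_deriv_1:
  fixes f :: "'a::euclidean_space \<Rightarrow> real"
  assumes "f differentiable (at x)"
  shows "frechet_derivative f (at x) v = dir_deriv 1 f x v"
proof -
  have "linear (frechet_derivative f (at x))" by (rule linear_frechet_derivative[OF assms])
  then have "frechet_derivative f (at x) (\<Sum>b\<in>Basis. (v \<bullet> b) *\<^sub>R b) = (\<Sum>b\<in>Basis. (v \<bullet> b) * frechet_derivative f (at x) b)"
    by (simp add: linear_sum linear_cmul)
  then show ?thesis by (simp add: euclidean_representation)
qed

lemma dir_deriv_DERIV:
  fixes f :: "'a::euclidean_space \<Rightarrow> real"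
  assumes "C_k k f" "j < k"
  shows "((\<lambda>s. dir_deriv j f (x + s *\<^sub>R v) v) has_real_derivative dir_deriv (Suc j) f (x + s *\<^sub>R v) v) (at s)"
  using assms
proof (induction j arbitrary: f k)
  case 0
  then obtain k' where k: "k = Suc k'" by (cases k) auto
  then have d: "f differentiable (at y)" for y using 0 by simp
  have "(f has_derivative frechet_derivative f (at (x + s *\<^sub>R v))) (at (x + s *\<^sub>R v))"
    using d frechet_derivative_works by blast
  moreover have "((\<lambda>s. x + s *\<^sub>R v) has_derivative (\<lambda>h. h *\<^sub>R v)) (at s)"
    by (auto intro!: derivative_eq_intros)
  ultimately have "((\<lambda>s. f (x + s *\<^sub>R v)) has_derivative (\<lambda>h. frechet_derivative f (at (x + s *\<^sub>R v)) (h *\<^sub>R v))) (at s)"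
    by (rule has_derivative_compose[rotated])
  moreover have "frechet_derivative f (at (x + s *\<^sub>R v)) (h *\<^sub>R v) = frechet_derivative f (at (x + s *\<^sub>R v)) v * h" for h
    using linear_frechet_derivative[OF d, of "x + s *\<^sub>R v"] by (simp add: linear_cmul)
  ultimately have "((\<lambda>s. f (x + s *\<^sub>R v)) has_real_derivative frechet_derivative f (at (x + s *\<^sub>R v)) v) (at s)"
    unfolding has_field_derivative_def by simp
  then show ?case using dir_deriv_1[OF d, of "x + s *\<^sub>R v" v] by simp
next
  case (Suc j)
  then obtain k' where k: "k = Suc k'" by (cases k) auto
  have "C_k k' (\<lambda>x. frechet_derivative f (at x) b)" for b using Suc.prems k by simp
  then have d: "((\<lambda>s. dir_deriv j (\<lambda>x. frechet_derivative f (at x) b) (x + s *\<^sub>R v) v) has_real_derivative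
     dir_deriv (Suc j) (\<lambda>x. frechet_derivative f (at x) b) (x + s *\<^sub>R v) v) (at s)" for b
    using Suc.prems k by (intro Suc.IH) auto
  show ?case
    unfolding dir_deriv.simps(2)[of j f] dir_deriv.simps(2)[of "Suc j" f]
    by (intro DERIV_sum DERIV_cmult d)
qed

lemma dir_deriv_scaleR: "dir_deriv j f x (t *\<^sub>R v) = t ^ j * dir_deriv j f x v"
  by (induction j arbitrary: f) (simp_all add: sum_distrib_left mult_ac)

lemma dir_deriv_continuous: "continuous_on UNIV (dir_deriv j f x)"
proof (induction j arbitrary: f)
  case 0 then show ?case by (simp add: fun_eq_iff)
next
  case (Suc j)
  show ?case unfolding dir_deriv.simps by (intro continuous_intros Suc)
qed

lemma dir_deriv_bound:
  fixes f :: "'a::euclidean_space \<Rightarrow> real"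
  assumes "C_k k f" "j \<le> k" "compact S"
  shows "\<exists>B\<ge>0. \<forall>x\<in>S. \<forall>v. \<bar>dir_deriv j f x v\<bar> \<le> B * norm v ^ j"
  using assms(1,2)
proof (induction j arbitrary: f k)
  case 0
  have "compact (f ` S)"
    using C_k_continuous[OF 0(1)] assms(3) by (intro compact_continuous_image) (auto intro: continuous_on_subset)
  then obtain B where "\<forall>y\<in>f ` S. norm y \<le> B" using compact_imp_bounded bounded_iff by blast
  then show ?case by (intro exI[of _ "max 0 B"]) auto
next
  case (Suc j)
  then obtain k' where k: "k = Suc k'" by (cases k) auto
  have "C_k k' (\<lambda>x. frechet_derivative f (at x) b)" for b using Suc.prems k by simp
  then have "\<forall>b. \<exists>B\<ge>0. \<forall>x\<in>S. \<forall>v. \<bar>dir_deriv j (\<lambda>x. frechet_derivative f (at x) b) x v\<bar> \<le> B * norm v ^ j"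
    using Suc.prems k by (intro allI Suc.IH) auto
  then obtain B where B: "\<And>b. 0 \<le> B b" "\<And>b x v. x \<in> S \<Longrightarrow> \<bar>dir_deriv j (\<lambda>x. frechet_derivative f (at x) b) x v\<bar> \<le> B b * norm v ^ j"
    by metis
  show ?case
  proof (intro exI[of _ "\<Sum>b\<in>(Basis::'a set). B b"] conjI ballI allI)
    show "0 \<le> (\<Sum>b\<in>(Basis::'a set). B b)" using B(1) by (simp add: sum_nonneg)
    fix x v assume x: "x \<in> S"
    have "\<bar>dir_deriv (Suc j) f x v\<bar> \<le> (\<Sum>b\<in>Basis. \<bar>(v \<bullet> b) * dir_deriv j (\<lambda>x. frechet_derivative f (at x) b) x v\<bar>)"
      by simp
    also have "\<dots> \<le> (\<Sum>b\<in>Basis. norm v * (B b * norm v ^ j))"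
      unfolding abs_mult using B x by (intro sum_mono mult_mono) (auto simp: Basis_le_norm)
    also have "\<dots> = (\<Sum>b\<in>Basis. B b) * norm v ^ Suc j" 
      unfolding power_Suc sum_distrib_right by (intro sum.cong) (simp_all only: mult_ac)
    finally show "\<bar>dir_deriv (Suc j) f x v\<bar> \<le> (\<Sum>b\<in>Basis. B b) * norm v ^ Suc j" .
  qed
qed

text \<open>
  Beyond the remainder estimate only the homogeneity of the quadratic part \<open>Q\<close> and of the cubic part \<open>c\<close> is recorded, since
  parity and size are all that the expansion of the average needs.
\<close>

definition cubic_expansion :: "('a::euclidean_space \<Rightarrow> real) \<Rightarrow> real \<Rightarrow> 'a \<Rightarrow> 'a \<Rightarrow> ('a \<Rightarrow> real) \<Rightarrow> ('a \<Rightarrow> real) \<Rightarrow> bool" where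
  "cubic_expansion f B x \<beta> Q c \<longleftrightarrow>
     norm \<beta> \<le> B \<and> continuous_on UNIV Q \<and> continuous_on UNIV c \<and>
     (\<forall>t v. Q (t *\<^sub>R v) = t ^ 2 * Q v) \<and> (\<forall>t v. c (t *\<^sub>R v) = t ^ 3 * c v) \<and>
     (\<forall>v. \<bar>Q v\<bar> \<le> B * norm v ^ 2) \<and> (\<forall>v. \<bar>c v\<bar> \<le> B * norm v ^ 3) \<and>
     (\<forall>v. norm v \<le> 1 \<longrightarrow> \<bar>f (x + v) - f x - \<beta> \<bullet> v - Q v - c v\<bar> \<le> B * norm v ^ 4)"

lemma C_k_taylor:
  fixes f :: "'a::euclidean_space \<Rightarrow> real"
  assumes f: "C_k 5 f"
  shows "\<exists>B\<ge>0. \<forall>x. norm x \<le> R \<longrightarrow> (\<exists>\<beta> Q c. cubic_expansion f B x \<beta> Q c)"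
proof -
  let ?S = "cball (0::'a) (R + 1)"
  have "\<forall>j\<in>{..4}. \<exists>B\<ge>0. \<forall>x\<in>?S. \<forall>v. \<bar>dir_deriv j f x v\<bar> \<le> B * norm v ^ j"
    using dir_deriv_bound[OF f _ compact_cball] by auto
  then obtain b where b: "\<And>j. j \<le> 4 \<Longrightarrow> 0 \<le> b j" "\<And>j x v. j \<le> 4 \<Longrightarrow> x \<in> ?S \<Longrightarrow> \<bar>dir_deriv j f x v\<bar> \<le> b j * norm v ^ j"
    by (metis atMost_iff)
  define B where "B = b 1 + b 2 + b 3 + b 4"
  have B: "b 1 \<le> B" "b 2 \<le> B" "b 3 \<le> B" "b 4 \<le> B" "0 \<le> B" unfolding B_def using b(1)[of 1] b(1)[of 2] b(1)[of 3] b(1)[of 4] by auto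
  show ?thesis
  proof (intro exI[of _ B] conjI allI impI)
    show "0 \<le> B" by (rule B)
    fix x :: 'a assume x: "norm x \<le> R"
    then have xS: "x \<in> ?S" by simp
    define \<beta> where "\<beta> = (\<Sum>b\<in>Basis. frechet_derivative f (at x) b *\<^sub>R b)"
    have \<beta>v: "dir_deriv 1 f x v = \<beta> \<bullet> v" for v
      unfolding \<beta>_def inner_sum_left by (simp add: inner_commute[of _ v] mult.commute)
    have \<beta>B: "norm \<beta> \<le> B"
    proof -
      have "\<bar>\<beta> \<bullet> \<beta>\<bar> \<le> b 1 * norm \<beta> ^ 1" using b(2)[of 1 x \<beta>] xS \<beta>v by simp
      then have "norm \<beta> * norm \<beta> \<le> b 1 * norm \<beta>" by (simp add: dot_square_norm power2_eq_square)
      then have "norm \<beta> \<le> b 1" using b(1)[of 1] by (cases "norm \<beta> = 0") auto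
      then show ?thesis using B by linarith
    qed
    have bd: "\<bar>dir_deriv j f y v\<bar> \<le> B * norm v ^ j" if "j = 2 \<or> j = 3 \<or> j = 4" "y \<in> ?S" for j y v
    proof -
      have "\<bar>dir_deriv j f y v\<bar> \<le> b j * norm v ^ j" using b(2)[of j y v] that by auto
      also have "\<dots> \<le> B * norm v ^ j" using B that by (intro mult_right_mono) auto
      finally show ?thesis .
    qed
    let ?Q = "\<lambda>v. dir_deriv 2 f x v / 2" and ?c = "\<lambda>v. dir_deriv 3 f x v / 6"
    have rem: "\<bar>f (x + v) - f x - \<beta> \<bullet> v - ?Q v - ?c v\<bar> \<le> B * norm v ^ 4" if v: "norm v \<le> 1" for v
    proof -
      let ?F = "\<lambda>j s. dir_deriv j f (x + s *\<^sub>R v) v"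
      have "norm (?F 0 1 - (\<Sum>i\<le>3. ?F i 0 * (1 - 0) ^ i / fact i)) \<le> (B * norm v ^ 4) * norm (1 - 0 :: real) ^ Suc 3 / fact 3"
      proof (rule field_Taylor[where S = "{0..1::real}"])
        show "(?F i has_real_derivative ?F (Suc i) s) (at s within {0..1})" if "i \<le> 3" for i s
          using that by (intro has_field_derivative_at_within[OF dir_deriv_DERIV[OF f]]) simp
        show "norm (?F (Suc 3) s) \<le> B * norm v ^ 4" if s: "s \<in> {0..1}" for s
        proof -
          have "norm (x + s *\<^sub>R v) \<le> norm x + norm (s *\<^sub>R v)" by (rule norm_triangle_ineq)
          also have "norm (s *\<^sub>R v) \<le> 1 * 1" unfolding norm_scaleR using s v by (intro mult_mono) auto
          finally have "x + s *\<^sub>R v \<in> ?S" using x by simp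
          then have "\<bar>dir_deriv 4 f (x + s *\<^sub>R v) v\<bar> \<le> B * norm v ^ 4" by (intro bd) auto
          then show ?thesis by (simp del: dir_deriv.simps)
        qed
      qed auto
      also have "(B * norm v ^ 4) * norm (1 - 0 :: real) ^ Suc 3 / fact 3 \<le> B * norm v ^ 4"
        using B by (simp add: fact_numeral)
      also have "(\<Sum>i\<le>3. ?F i 0 * (1 - 0) ^ i / fact i) = f x + \<beta> \<bullet> v + ?Q v + ?c v"
        using \<beta>v[of v] by (simp add: atMost_nat_numeral fact_numeral del: dir_deriv.simps(2))
      finally show ?thesis by (simp add: algebra_simps del: dir_deriv.simps(2))
    qed
    show "\<exists>\<beta> Q c. cubic_expansion f B x \<beta> Q c"
      unfolding cubic_expansion_def
    proof (rule exI[of _ \<beta>], rule exI[of _ ?Q], rule exI[of _ ?c], intro conjI allI impI)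
      show "norm \<beta> \<le> B" by (rule \<beta>B)
      show "continuous_on UNIV ?Q" "continuous_on UNIV ?c"
        by (intro continuous_intros dir_deriv_continuous; simp)+
      show "?Q (t *\<^sub>R v) = t ^ 2 * ?Q v" "?c (t *\<^sub>R v) = t ^ 3 * ?c v" for t v
        by (simp_all only: dir_deriv_scaleR times_divide_eq_right)
      show "\<bar>?Q v\<bar> \<le> B * norm v ^ 2" for v
        using bd[of 2 x v] xS B by (simp only: abs_divide abs_numeral) (auto intro: order_trans[rotated])
      show "\<bar>?c v\<bar> \<le> B * norm v ^ 3" for v
        using bd[of 3 x v] xS B by (simp only: abs_divide abs_numeral) (auto intro: order_trans[rotated])
    qed (rule rem)
  qed
qed


section \<open>The solution as an average of the indicator function\<close>

lemma G_kernel_rescaled: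
  fixes w :: "real ^ 'n"
  assumes \<epsilon>: "0 < \<epsilon>"
  shows "Re (G_kernel l w (\<epsilon> ^ 4)) = (1 / \<epsilon>) ^ CARD('n) * kernel 0 (l * \<epsilon>\<^sup>2) 0 ((1 / \<epsilon>) *\<^sub>R w)"
proof -
  let ?f = "\<lambda>\<xi>::real^'n. exp (complex_of_real (- (norm \<xi> ^ 4 + l * norm \<xi> ^ 2) * \<epsilon> ^ 4) + \<i> * complex_of_real (w \<bullet> \<xi>))"
  have "(LBINT \<xi>. ?f \<xi>) = \<bar>1 / \<epsilon>\<bar> ^ DIM(real^'n) *\<^sub>R (LBINT \<xi>. ?f (0 + (1 / \<epsilon>) *\<^sub>R \<xi>))"
    by (rule lborel_integral_affine) (use \<epsilon> in auto)
  also have "(\<lambda>\<xi>. ?f (0 + (1 / \<epsilon>) *\<^sub>R \<xi>)) = (\<lambda>\<xi>. (\<i> * of_real (\<xi> \<bullet> 0)) ^ 0 * of_real (exp (- (norm \<xi> ^ 4 + (l * \<epsilon>\<^sup>2) * (norm \<xi>)\<^sup>2))) * exp (\<i> * of_real (((1 / \<epsilon>) *\<^sub>R w) \<bullet> \<xi>)))"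
  proof
    fix \<xi> :: "real^'n"
    have "(norm ((1 / \<epsilon>) *\<^sub>R \<xi>) ^ 4 + l * norm ((1 / \<epsilon>) *\<^sub>R \<xi>) ^ 2) * \<epsilon> ^ 4 = norm \<xi> ^ 4 + (l * \<epsilon>\<^sup>2) * (norm \<xi>)\<^sup>2"
      using \<epsilon> by (simp add: power_divide field_simps eval_nat_numeral)
    then have 1: "- (norm (0 + (1 / \<epsilon>) *\<^sub>R \<xi>) ^ 4 + l * norm (0 + (1 / \<epsilon>) *\<^sub>R \<xi>) ^ 2) * \<epsilon> ^ 4 = - (norm \<xi> ^ 4 + (l * \<epsilon>\<^sup>2) * (norm \<xi>)\<^sup>2)"
      by (simp only: add_0_left minus_mult_left[symmetric])
    have 2: "w \<bullet> (0 + (1 / \<epsilon>) *\<^sub>R \<xi>) = ((1 / \<epsilon>) *\<^sub>R w) \<bullet> \<xi>" by simp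
    show "?f (0 + (1 / \<epsilon>) *\<^sub>R \<xi>) = (\<i> * of_real (\<xi> \<bullet> 0)) ^ 0 * of_real (exp (- (norm \<xi> ^ 4 + (l * \<epsilon>\<^sup>2) * (norm \<xi>)\<^sup>2))) * exp (\<i> * of_real (((1 / \<epsilon>) *\<^sub>R w) \<bullet> \<xi>))"
      unfolding 1 2 by (simp only: exp_add exp_of_real power_0 mult_1_left)
  qed
  finally have "G_kernel l w (\<epsilon> ^ 4) = of_real ((1 / \<epsilon>) ^ CARD('n)) * kernel_c 0 (l * \<epsilon>\<^sup>2) 0 ((1 / \<epsilon>) *\<^sub>R w)"
    unfolding G_kernel_def kernel_c_def using \<epsilon> by (simp add: scaleR_conv_of_real)
  then show ?thesis by (simp add: kernel_def del: of_real_power)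
qed

text \<open>
  The solution with initial datum the indicator of \<open>A\<close> at time \<open>\<epsilon>\<^sup>4\<close>, with space measured in units of \<open>\<epsilon>\<close>.
\<close>

definition blur :: "real \<Rightarrow> (real ^ 'n) set \<Rightarrow> real ^ 'n \<Rightarrow> real \<Rightarrow> real" where
  "blur l A x \<epsilon> = (LBINT z. kernel 0 (l * \<epsilon>\<^sup>2) 0 z * indicator A (x + \<epsilon> *\<^sub>R z))"

lemma u_sol_eq_blur:
  fixes A :: "(real ^ 'n) set"
  assumes \<epsilon>: "0 < \<epsilon>" and l: "\<bar>l * \<epsilon>\<^sup>2\<bar> \<le> 1" and [measurable]: "A \<in> sets borel"
  shows "u_sol l A x (\<epsilon> ^ 4) = blur l A x \<epsilon>"
proof -
  have [measurable]: "kernel (0::real^'n) (l * \<epsilon>\<^sup>2) 0 \<in> borel_measurable borel"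
    by (rule kernel_measurable) (use l in auto)
  have "u_sol l A x (\<epsilon> ^ 4) = (LBINT y. indicator A y *\<^sub>R ((1 / \<epsilon>) ^ CARD('n) * kernel 0 (l * \<epsilon>\<^sup>2) 0 ((1 / \<epsilon>) *\<^sub>R (x - y))))"
    unfolding u_sol_def set_lebesgue_integral_def G_kernel_rescaled[OF \<epsilon>] ..
  also have "\<dots> = \<bar>\<epsilon>\<bar> ^ DIM(real^'n) *\<^sub>R (LBINT z. indicator A (x + \<epsilon> *\<^sub>R z) *\<^sub>R ((1 / \<epsilon>) ^ CARD('n) * kernel 0 (l * \<epsilon>\<^sup>2) 0 ((1 / \<epsilon>) *\<^sub>R (x - (x + \<epsilon> *\<^sub>R z)))))"
    by (rule lborel_integral_affine) (use \<epsilon> in auto)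
  also have "\<dots> = \<epsilon> ^ CARD('n) * (LBINT z. (1 / \<epsilon>) ^ CARD('n) * (kernel 0 (l * \<epsilon>\<^sup>2) 0 z * indicator A (x + \<epsilon> *\<^sub>R z)))"
  proof -
    have "(1 / \<epsilon>) *\<^sub>R (x - (x + \<epsilon> *\<^sub>R z)) = - z" for z using \<epsilon> by simp
    moreover have "kernel (0::real^'n) (l * \<epsilon>\<^sup>2) 0 (- z) = kernel 0 (l * \<epsilon>\<^sup>2) 0 z" for z
      by (simp add: kernel_def kernel_c_uminus)
    ultimately show ?thesis using \<epsilon> by (simp only: real_scaleR_def mult_ac abs_of_pos DIM_cart DIM_real mult_1_right mult_1_left)
  qed
  also have "\<dots> = blur l A x \<epsilon>"
    unfolding blur_def integral_mult_right_zero using \<epsilon> by (simp add: power_one_over)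
  finally show ?thesis .
qed

lemma scaled_parameter_bound:
  fixes a h k l :: real
  assumes k: "0 < k" "k \<le> 3" and a: "0 < a" and h: "0 < h" and l: "\<bar>l\<bar> * (3 * a * h)\<^sup>2 \<le> 1"
  shows "\<bar>l\<bar> * (k * a * h)\<^sup>2 \<le> 1"
proof -
  have "(k * a * h)\<^sup>2 \<le> (3 * a * h)\<^sup>2" using k a h by (intro power_mono mult_right_mono) auto
  then have "\<bar>l\<bar> * (k * a * h)\<^sup>2 \<le> \<bar>l\<bar> * (3 * a * h)\<^sup>2" by (intro mult_left_mono) auto
  then show ?thesis using l by linarith
qed

lemma small_parameter_bound:
  fixes a h l :: real
  assumes a: "0 < a" and h: "0 < h" "h \<le> 1 / (3 * a * (1 + \<bar>l\<bar>))"
  shows "3 * a * h \<le> 1" and "\<bar>l\<bar> * (3 * a * h)\<^sup>2 \<le> 1"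
proof -
  have "3 * a * h \<le> 3 * a * (1 / (3 * a * (1 + \<bar>l\<bar>)))" using a h by (intro mult_left_mono) auto
  then have h3: "3 * a * h \<le> 1 / (1 + \<bar>l\<bar>)" using a by simp
  then show h31: "3 * a * h \<le> 1" by (rule order_trans) simp
  have "\<bar>l\<bar> * ((3 * a * h) * (3 * a * h)) \<le> \<bar>l\<bar> * ((1 / (1 + \<bar>l\<bar>)) * 1)"
    using h3 h31 a h by (intro mult_left_mono mult_mono) auto
  also have "\<dots> \<le> 1" by simp
  finally show "\<bar>l\<bar> * (3 * a * h)\<^sup>2 \<le> 1" by (simp add: power2_eq_square)
qed

lemma U_threshold_eq_blur:
  fixes A :: "(real ^ 'n) set"
  assumes h: "0 < h" and a: "0 < a" and l: "\<bar>l\<bar> * (3 * a * h)\<^sup>2 \<le> 1" and A: "A \<in> sets borel"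
  shows "U_threshold l A a x (h ^ 4) = blur l A x (3 * a * h) - 3 * blur l A x (2 * a * h) + 3 * blur l A x (a * h)"
proof -
  have "u_scaled l A (k * a) x (h ^ 4) = blur l A x (k * a * h)" if k: "0 < k" "k \<le> 3" for k
    unfolding u_scaled_def
    using u_sol_eq_blur[of "k * a * h" l A x] k h a A scaled_parameter_bound[OF k a h l]
    by (simp add: power_mult_distrib abs_mult)
  from this[of 3] this[of 2] this[of 1] show ?thesis unfolding U_threshold_def by simp
qed

definition tail_const :: "'a::euclidean_space itself \<Rightarrow> real" where
  "tail_const _ = kernel_bound TYPE('a) * (LBINT z. exp (- (1 / 2) * norm (z::'a)))"

lemma tail_const_nonneg: "0 \<le> tail_const TYPE('a::euclidean_space)"
  by (simp add: tail_const_def kernel_bound_nonneg)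

lemma kernel_tail:
  fixes \<nu> :: "'a::euclidean_space"
  assumes \<nu>: "norm \<nu> \<le> 1" and \<mu>: "\<bar>\<mu>\<bar> \<le> 1"
    and [measurable]: "f \<in> borel_measurable borel" "g \<in> borel_measurable borel"
    and f: "\<And>z. 0 \<le> f z \<and> f z \<le> 1" and g: "\<And>z. 0 \<le> g z \<and> g z \<le> 1"
    and fg: "\<And>z. norm z < R \<Longrightarrow> f z = g z"
  shows "\<bar>(LBINT z. kernel \<nu> \<mu> 0 z * f z) - (LBINT z. kernel \<nu> \<mu> 0 z * g z)\<bar> \<le> tail_const TYPE('a) * exp (- R / 2)"
proof -
  have [measurable]: "kernel \<nu> \<mu> 0 \<in> borel_measurable borel" using kernel_measurable[OF \<nu> \<mu>] by simp
  have K: "integrable lborel (kernel \<nu> \<mu> 0)" using kernel_integrable[OF \<nu> \<mu>] by simp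
  have i: "integrable lborel (\<lambda>z. kernel \<nu> \<mu> 0 z * f z)" "integrable lborel (\<lambda>z. kernel \<nu> \<mu> 0 z * g z)"
    using f g by (intro Bochner_Integration.integrable_bound[OF K]; simp add: abs_mult mult_left_le)+
  have b: "norm (kernel \<nu> \<mu> 0 z * f z - kernel \<nu> \<mu> 0 z * g z) \<le> (kernel_bound TYPE('a) * exp (- R / 2)) * exp (- (1 / 2) * norm z)" for z
  proof (cases "norm z < R")
    case True
    then show ?thesis using fg kernel_bound_nonneg[where 'a='a] by simp
  next
    case False
    have "norm (kernel \<nu> \<mu> 0 z * f z - kernel \<nu> \<mu> 0 z * g z) = \<bar>kernel \<nu> \<mu> 0 z\<bar> * \<bar>f z - g z\<bar>"
      by (simp add: abs_mult[symmetric] right_diff_distrib)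
    also have "\<dots> \<le> (kernel_bound TYPE('a) * exp (- norm z)) * 1"
    proof (rule mult_mono)
      show "\<bar>f z - g z\<bar> \<le> 1" using f[of z] g[of z] by linarith
    qed (use kernel_decay[OF \<nu> \<mu>, of 0 z] kernel_bound_nonneg[where 'a='a] in auto)
    also have "\<dots> \<le> kernel_bound TYPE('a) * exp (- R / 2 + - (1 / 2) * norm z)"
      using False kernel_bound_nonneg[where 'a='a] by (simp add: mult_left_mono)
    finally show ?thesis by (simp add: exp_add[symmetric] mult_ac)
  qed
  have e: "integrable lborel (\<lambda>z::'a. (kernel_bound TYPE('a) * exp (- R / 2)) * exp (- (1 / 2) * norm z))"
    by (intro integrable_mult_right integrable_exp_norm) simp
  have "norm (LBINT z. kernel \<nu> \<mu> 0 z * f z - kernel \<nu> \<mu> 0 z * g z)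
      \<le> (LBINT z. (kernel_bound TYPE('a) * exp (- R / 2)) * exp (- (1 / 2) * norm (z::'a)))"
    by (rule Bochner_Integration.integral_norm_bound_integral[OF Bochner_Integration.integrable_diff[OF i] e b])
  also have "\<dots> = tail_const TYPE('a) * exp (- R / 2)"
    unfolding tail_const_def by (simp only: integral_mult_right_zero mult_ac)
  finally show ?thesis by (simp only: Bochner_Integration.integral_diff[OF i] real_norm_def)
qed

text \<open>
  The kernel is Lipschitz continuous and \<open>A\<close> has finite measure.
\<close>

lemma blur_continuous:
  fixes A :: "(real ^ 'n) set"
  assumes \<epsilon>: "0 < \<epsilon>" and l: "\<bar>l * \<epsilon>\<^sup>2\<bar> \<le> 1" and A: "compact A"
  shows "continuous_on UNIV (\<lambda>x. blur l A x \<epsilon>)"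
proof -
  have Ab[measurable]: "A \<in> sets borel" using A by (simp add: borel_compact)
  let ?K = "kernel (0::real^'n) (l * \<epsilon>\<^sup>2) 0"
  have [measurable]: "?K \<in> borel_measurable borel"
    by (rule kernel_measurable) (use l in auto)
  have Ai: "integrable lborel (indicator A :: real^'n \<Rightarrow> real)"
    using A emeasure_compact_finite by (simp add: integrable_indicator_iff)
  have ei: "integrable lborel (\<lambda>y. indicator A y * ?K ((1 / \<epsilon>) *\<^sub>R (x - y)))" for x
  proof (rule Bochner_Integration.integrable_bound)
    show "integrable lborel (\<lambda>y. kernel_bound TYPE(real^'n) * indicator A y)" using Ai by simp
    have "\<bar>?K z\<bar> \<le> kernel_bound TYPE(real^'n)" for z
    proof -
      have "\<bar>?K z\<bar> \<le> kernel_bound TYPE(real^'n) * exp (- norm z)" by (rule kernel_decay) (use l in auto)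
      also have "\<dots> \<le> kernel_bound TYPE(real^'n) * 1" using kernel_bound_nonneg[where 'a="real^'n"] by (intro mult_left_mono) auto
      finally show ?thesis by simp
    qed
    then show "AE y in lborel. norm (indicator A y * ?K ((1 / \<epsilon>) *\<^sub>R (x - y))) \<le> norm (kernel_bound TYPE(real^'n) * indicator A y)"
      using kernel_bound_nonneg[where 'a="real^'n"] by (intro AE_I2) (auto split: split_indicator)
  qed measurable
  have eq: "blur l A x \<epsilon> = (1 / \<epsilon>) ^ CARD('n) * (LBINT y. indicator A y * ?K ((1 / \<epsilon>) *\<^sub>R (x - y)))" for x
  proof -
    have "blur l A x \<epsilon> = u_sol l A x (\<epsilon> ^ 4)" using u_sol_eq_blur[OF \<epsilon> l Ab] by simp
    also have "\<dots> = (LBINT y. (1 / \<epsilon>) ^ CARD('n) * (indicator A y * ?K ((1 / \<epsilon>) *\<^sub>R (x - y))))"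
      unfolding u_sol_def set_lebesgue_integral_def G_kernel_rescaled[OF \<epsilon>] by (simp only: real_scaleR_def mult_ac)
    finally show ?thesis by (simp only: integral_mult_right_zero)
  qed
  let ?L = "(1 / \<epsilon>) ^ CARD('n) * (kernel_bound TYPE(real^'n) * (1 / \<epsilon>) * (LBINT y. indicator A (y::real^'n)))"
  have "?L-lipschitz_on UNIV (\<lambda>x. blur l A x \<epsilon>)"
  proof (rule lipschitz_onI)
    show "0 \<le> ?L" using \<epsilon> kernel_bound_nonneg[where 'a="real^'n"] by simp
    fix x x' :: "real^'n"
    have Kl: "\<bar>?K z - ?K z'\<bar> \<le> kernel_bound TYPE(real^'n) * norm (z - z')" for z z'
    proof -
      have "\<bar>Re (kernel_c (0::real^'n) (l * \<epsilon>\<^sup>2) 0 z - kernel_c 0 (l * \<epsilon>\<^sup>2) 0 z')\<bar> \<le> kernel_bound TYPE(real^'n) * norm (z - z')"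
        by (rule order_trans[OF abs_Re_le_cmod kernel_c_lipschitz]) (use l in auto)
      then show ?thesis by (simp add: kernel_def)
    qed
    have "norm (LBINT y. indicator A y * ?K ((1 / \<epsilon>) *\<^sub>R (x - y)) - indicator A y * ?K ((1 / \<epsilon>) *\<^sub>R (x' - y)))
        \<le> (LBINT y. (kernel_bound TYPE(real^'n) * ((1 / \<epsilon>) * norm (x - x'))) * indicator A y)"
    proof (rule Bochner_Integration.integral_norm_bound_integral)
      fix y
      have "(1 / \<epsilon>) *\<^sub>R (x - y) - (1 / \<epsilon>) *\<^sub>R (x' - y) = (1 / \<epsilon>) *\<^sub>R (x - x')" by (simp add: scaleR_diff_right)
      then have "\<bar>?K ((1 / \<epsilon>) *\<^sub>R (x - y)) - ?K ((1 / \<epsilon>) *\<^sub>R (x' - y))\<bar> \<le> kernel_bound TYPE(real^'n) * ((1 / \<epsilon>) * norm (x - x'))"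
        using Kl[of "(1 / \<epsilon>) *\<^sub>R (x - y)" "(1 / \<epsilon>) *\<^sub>R (x' - y)"] \<epsilon> by simp
      then show "norm (indicator A y * ?K ((1 / \<epsilon>) *\<^sub>R (x - y)) - indicator A y * ?K ((1 / \<epsilon>) *\<^sub>R (x' - y)))
          \<le> (kernel_bound TYPE(real^'n) * ((1 / \<epsilon>) * norm (x - x'))) * indicator A y"
        by (auto split: split_indicator)
    qed (use ei Ai in auto)
    then have "(1 / \<epsilon>) ^ CARD('n) * \<bar>(LBINT y. indicator A y * ?K ((1 / \<epsilon>) *\<^sub>R (x - y))) - (LBINT y. indicator A y * ?K ((1 / \<epsilon>) *\<^sub>R (x' - y)))\<bar>
        \<le> (1 / \<epsilon>) ^ CARD('n) * ((kernel_bound TYPE(real^'n) * ((1 / \<epsilon>) * norm (x - x'))) * (LBINT y. indicator A (y::real^'n)))"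
      using \<epsilon> unfolding integral_mult_right_zero Bochner_Integration.integral_diff[OF ei ei] real_norm_def
      by (intro mult_left_mono) auto
    moreover have "\<bar>blur l A x \<epsilon> - blur l A x' \<epsilon>\<bar> = (1 / \<epsilon>) ^ CARD('n) * \<bar>(LBINT y. indicator A y * ?K ((1 / \<epsilon>) *\<^sub>R (x - y))) - (LBINT y. indicator A y * ?K ((1 / \<epsilon>) *\<^sub>R (x' - y)))\<bar>"
      unfolding eq right_diff_distrib[symmetric] abs_mult using \<epsilon> by (simp add: power_abs)
    ultimately show "dist (blur l A x \<epsilon>) (blur l A x' \<epsilon>) \<le> ?L * dist x x'"
      unfolding dist_real_def dist_norm by (simp only: mult_ac)
  qed
  then show ?thesis by (rule lipschitz_on_continuous_on)
qed

lemma blur_constant_near: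
  fixes A :: "(real ^ 'n) set"
  assumes \<epsilon>: "0 < \<epsilon>" and l: "\<bar>l * \<epsilon>\<^sup>2\<bar> \<le> 1" and [measurable]: "A \<in> sets borel"
    and c: "\<And>y. y \<in> ball x (\<epsilon> * R) \<Longrightarrow> (indicator A y :: real) = indicator A x"
  shows "\<bar>blur l A x \<epsilon> - indicator A x\<bar> \<le> tail_const TYPE(real^'n) * exp (- R / 2)"
proof -
  have "\<bar>(LBINT z. kernel (0::real^'n) (l * \<epsilon>\<^sup>2) 0 z * indicator A (x + \<epsilon> *\<^sub>R z)) - (LBINT z. kernel (0::real^'n) (l * \<epsilon>\<^sup>2) 0 z * indicator A x)\<bar>
      \<le> tail_const TYPE(real^'n) * exp (- R / 2)"
  proof (rule kernel_tail)
    fix z :: "real^'n" assume "norm z < R"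
    then have "x + \<epsilon> *\<^sub>R z \<in> ball x (\<epsilon> * R)" using \<epsilon> by (simp add: dist_norm)
    then show "indicator A (x + \<epsilon> *\<^sub>R z) = (indicator A x :: real)" by (rule c)
  qed (use l in \<open>auto split: split_indicator\<close>)
  moreover have "(LBINT z. kernel (0::real^'n) (l * \<epsilon>\<^sup>2) 0 z * indicator A x) = indicator A x"
    unfolding integral_mult_left_zero kernel_integral_one[OF l] by simp
  ultimately show ?thesis unfolding blur_def by (simp only:)
qed

lemma indicator_constant_off_frontier:
  fixes x :: "'a::euclidean_space"
  assumes "ball x r \<inter> frontier A = {}" "y \<in> ball x r"
  shows "(indicator A y :: real) = indicator A x"
proof -
  have "x \<in> ball x r" using assms(2) by (metis centre_in_ball dist_self dist_triangle_less_add ball_eq_empty empty_iff not_le)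
  have "\<not> (ball x r \<inter> A \<noteq> {} \<and> ball x r - A \<noteq> {})"
    using connected_Int_frontier[of "ball x r" A] assms(1) by auto
  then have "x \<in> A \<longleftrightarrow> y \<in> A" using \<open>x \<in> ball x r\<close> assms(2) by blast
  then show ?thesis by (simp add: indicator_def)
qed


section \<open>Expansion in a boundary chart\<close>

lemma exp_minus_cubic: "0 < u \<Longrightarrow> exp (- u) \<le> 27 / (u::real) ^ 3"
proof -
  assume u: "0 < u"
  have "1 + u / 3 \<le> exp (u / 3)" by (rule exp_ge_add_one_self)
  then have "(u / 3) ^ 3 \<le> exp (u / 3) ^ 3" using u by (intro power_mono; linarith)
  also have "\<dots> = exp u" by (simp flip: exp_of_nat_mult)
  finally have "u ^ 3 \<le> 27 * exp u" by (simp add: power_divide)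
  then show ?thesis using u by (simp add: exp_minus field_simps)
qed

lemma hyper_norm_le: "norm \<nu> = 1 \<Longrightarrow> norm (hyper \<nu> z) \<le> norm z"
  using norm_orthogonal_le[OF hyper_orthogonal, of \<nu> z "z \<bullet> \<nu>"] by simp

lemma hyper_add_scaleR: "hyper \<nu> (x + t *\<^sub>R z) = hyper \<nu> x + t *\<^sub>R hyper \<nu> z"
  by (simp add: inner_add_left algebra_simps)

text \<open>
  The rescaled domain around \<open>x\<close> is the region above the graph of \<open>(\<gamma> (x' + \<epsilon> y) - \<gamma> x') / \<epsilon> - \<sigma>\<close>, where
  \<open>x' = hyper \<nu> x\<close>. The tangential part \<open>\<beta>\<close> of the gradient tilts the reference half-space, whose normal \<open>m = \<nu> - \<beta>\<close>
  has norm \<open>s\<close>. The quantities \<open>n\<close>, \<open>q\<close> and \<open>s\<close> depend on \<open>x\<close> only, so that they are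
  shared by the three scales of the threshold function.
\<close>

lemma chart_expansion:
  fixes \<nu> p :: "real ^ 'n"
  assumes \<nu>: "norm \<nu> = 1" and \<gamma>: "C_k 5 \<gamma>" and r: "0 < r" and A[measurable]: "A \<in> sets borel"
    and chart: "A \<inter> ball p r = {x \<in> ball p r. x \<bullet> \<nu> \<ge> \<gamma> (hyper \<nu> x)}"
  shows "\<exists>C\<ge>0. \<exists>S\<ge>1. \<forall>x\<in>ball p (r / 2). \<exists>n::real^'n. \<exists>q s. norm n = 1 \<and> 1 \<le> s \<and> s \<le> S \<and>
    (\<forall>\<epsilon>. 0 < \<epsilon> \<and> \<epsilon> \<le> 1 \<and> \<bar>l\<bar> * \<epsilon>\<^sup>2 \<le> 1 \<longrightarrow>
       \<bar>blur l A x \<epsilon> - (1 / 2 + sgn_average n ((x \<bullet> \<nu> - \<gamma> (hyper \<nu> x)) / (\<epsilon> * s)) / 2 - \<epsilon> * q)\<bar>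
         \<le> C * (\<epsilon> ^ 3 + \<bar>x \<bullet> \<nu> - \<gamma> (hyper \<nu> x)\<bar>))"
proof -
  have \<nu>1: "norm \<nu> \<le> 1" using \<nu> by simp
  have [measurable]: "\<gamma> \<in> borel_measurable borel"
    using C_k_continuous[OF \<gamma>] by (rule borel_measurable_continuous_onI)
  obtain B where B: "0 \<le> B" and tay: "\<forall>x. norm x \<le> norm p + r \<longrightarrow> (\<exists>\<beta> Q c. cubic_expansion \<gamma> B x \<beta> Q c)"
    using C_k_taylor[OF \<gamma>, of "norm p + r"] by blast
  let ?T = "TYPE(real^'n)"
  define r' where "r' = min (r / 2) 1"
  have r': "0 < r'" "r' \<le> r / 2" "r' \<le> 1" using r by (auto simp: r'_def)
  define C1 where "C1 = tail_const ?T * (216 / r' ^ 3)"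
  define C2 where "C2 = kernel_bound ?T * (27 * (2 * B) ^ 3 + 9 * (2 * B)\<^sup>2 + 3 * (2 * B) + 2 * B * \<bar>l\<bar>) * 24 ^ 12 * fibre_mass ?T"
  define C3 where "C3 = kernel_bound ?T * fibre_mass ?T * \<bar>l\<bar>"
  have fm: "0 \<le> fibre_mass ?T" by (simp add: fibre_mass_def)
  have C: "0 \<le> C1" "0 \<le> C2" "0 \<le> C3"
    unfolding C1_def C2_def C3_def using tail_const_nonneg[where 'a="real^'n"] kernel_bound_nonneg[where 'a="real^'n"] fm B r'
    by (auto intro!: mult_nonneg_nonneg add_nonneg_nonneg)
  show ?thesis
  proof (rule exI[of _ "C1 + C2 + C3"], intro conjI, goal_cases)
    case 1 show ?case using C by simp
  next
    case 2 show ?case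
  proof (rule exI[of _ "1 + B"], intro conjI ballI)
    show "1 \<le> 1 + B" using B by auto
    fix x assume x: "x \<in> ball p (r / 2)"
    let ?x = "hyper \<nu> x"
    define \<phi> where "\<phi> = x \<bullet> \<nu> - \<gamma> ?x"
    have "norm x \<le> norm p + r"
      using x norm_triangle_ineq2[of x p] r by (simp add: dist_norm norm_minus_commute)
    then have "norm ?x \<le> norm p + r" using hyper_norm_le[OF \<nu>, of x] by simp
    then obtain \<beta>0 Q c where \<beta>0: "norm \<beta>0 \<le> B" and Qc: "continuous_on UNIV Q" "continuous_on UNIV c"
      and Qh: "\<And>t v. Q (t *\<^sub>R v) = t ^ 2 * Q v" and ch: "\<And>t v. c (t *\<^sub>R v) = t ^ 3 * c v"
      and Qb: "\<And>v. \<bar>Q v\<bar> \<le> B * norm v ^ 2" and cb: "\<And>v. \<bar>c v\<bar> \<le> B * norm v ^ 3"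
      and rem: "\<And>v. norm v \<le> 1 \<Longrightarrow> \<bar>\<gamma> (?x + v) - \<gamma> ?x - \<beta>0 \<bullet> v - Q v - c v\<bar> \<le> B * norm v ^ 4"
      using tay unfolding cubic_expansion_def by blast
    define \<beta> where "\<beta> = hyper \<nu> \<beta>0"
    have \<beta>: "\<beta> \<bullet> \<nu> = 0" unfolding \<beta>_def by (rule hyper_orthogonal[OF \<nu>])
    have \<beta>B: "norm \<beta> \<le> B" unfolding \<beta>_def using hyper_norm_le[OF \<nu>, of \<beta>0] \<beta>0 by linarith
    have \<beta>y: "\<beta> \<bullet> y = \<beta>0 \<bullet> y" if "y \<bullet> \<nu> = 0" for y
      using that unfolding \<beta>_def inner_diff_left by (simp add: inner_commute[of \<nu> y])
    define m where "m = \<nu> - \<beta>"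
    define s where "s = norm m"
    define n where "n = m /\<^sub>R s"
    have s1: "1 \<le> s"
    proof -
      have "m \<bullet> \<nu> = 1" using \<nu> \<beta> by (simp add: m_def inner_diff_left norm_eq_1)
      then show ?thesis using Cauchy_Schwarz_ineq2[of m \<nu>] \<nu> by (simp add: s_def)
    qed
    have s2: "s \<le> 1 + B" unfolding s_def m_def using norm_triangle_ineq4[of \<nu> \<beta>] \<nu> \<beta>B by simp
    have n1: "norm n = 1"
    proof -
      have "norm n = s / s" using s1 by (simp add: n_def s_def divide_inverse)
      then show ?thesis using s1 by simp
    qed
    define q where "q = (LBINT z. std_normal_density (z \<bullet> \<nu>) * (Q (hyper \<nu> z) * kernel \<nu> 0 0 (hyper \<nu> z + (\<beta> \<bullet> hyper \<nu> z) *\<^sub>R \<nu>)))"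
    have main: "\<bar>blur l A x \<epsilon> - (1 / 2 + sgn_average n (\<phi> / (\<epsilon> * s)) / 2 - \<epsilon> * q)\<bar> \<le> (C1 + C2 + C3) * (\<epsilon> ^ 3 + \<bar>\<phi>\<bar>)"
      if \<epsilon>: "0 < \<epsilon>" "\<epsilon> \<le> 1" "\<bar>l\<bar> * \<epsilon>\<^sup>2 \<le> 1" for \<epsilon>
    proof -
      define \<mu> where "\<mu> = l * \<epsilon>\<^sup>2"
      define \<sigma> where "\<sigma> = \<phi> / \<epsilon>"
      have \<mu>: "\<bar>\<mu>\<bar> \<le> 1" "\<bar>\<mu>\<bar> \<le> \<bar>l\<bar> * \<epsilon>\<^sup>2" using \<epsilon> by (auto simp: \<mu>_def abs_mult)
      have \<sigma>: "\<epsilon> * \<bar>\<sigma>\<bar> = \<bar>\<phi>\<bar>" "\<epsilon> * \<sigma> = \<phi>" using \<epsilon> by (auto simp: \<sigma>_def abs_divide)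
      \<comment> \<open>Beyond distance one in the original scale the graph may behave arbitrarily, so there the deviation from the tangent
          plane is cut off; the kernel is exponentially small at the corresponding \<open>z\<close>.\<close>
      define e where "e = (\<lambda>y. if norm (\<epsilon> *\<^sub>R y) \<le> 1 then (\<gamma> (?x + \<epsilon> *\<^sub>R y) - \<gamma> ?x) / \<epsilon> - \<beta> \<bullet> y else 0)"
      have em[measurable]: "e \<in> borel_measurable borel" unfolding e_def by measurable
      have p4: "norm y ^ j \<le> (1 + norm y) ^ 4" if "j \<le> 4" for y :: "real^'n" and j
      proof -
        have "norm y ^ j \<le> (1 + norm y) ^ j" by (intro power_mono) auto
        also have "\<dots> \<le> (1 + norm y) ^ 4" using that by (intro power_increasing) auto
        finally show ?thesis .
      qed
      have Q4: "\<bar>Q y\<bar> \<le> 2 * B * (1 + norm y) ^ 4" and c4: "\<bar>c y\<bar> \<le> 2 * B * (1 + norm y) ^ 4" for y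
      proof -
        have "B * norm y ^ 2 \<le> B * (1 + norm y) ^ 4" "B * norm y ^ 3 \<le> B * (1 + norm y) ^ 4"
          using B by (intro mult_left_mono p4; simp)+
        moreover have "0 \<le> B * (1 + norm y) ^ 4" using B by simp
        ultimately show "\<bar>Q y\<bar> \<le> 2 * B * (1 + norm y) ^ 4" "\<bar>c y\<bar> \<le> 2 * B * (1 + norm y) ^ 4"
          using Qb[of y] cb[of y] by linarith+
      qed
      have e4: "\<bar>e y - \<epsilon> * Q y - \<epsilon>\<^sup>2 * c y\<bar> \<le> 2 * B * \<epsilon> ^ 3 * (1 + norm y) ^ 4" if y: "y \<bullet> \<nu> = 0" for y
      proof -
        have "\<bar>e y - \<epsilon> * Q y - \<epsilon>\<^sup>2 * c y\<bar> \<le> 2 * B * \<epsilon> ^ 3 * norm y ^ 4"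
        proof (cases "norm (\<epsilon> *\<^sub>R y) \<le> 1")
          case True
          have "\<bar>\<gamma> (?x + \<epsilon> *\<^sub>R y) - \<gamma> ?x - \<beta>0 \<bullet> (\<epsilon> *\<^sub>R y) - Q (\<epsilon> *\<^sub>R y) - c (\<epsilon> *\<^sub>R y)\<bar> \<le> B * norm (\<epsilon> *\<^sub>R y) ^ 4"
            by (rule rem[OF True])
          then have "\<bar>\<gamma> (?x + \<epsilon> *\<^sub>R y) - \<gamma> ?x - \<epsilon> * (\<beta> \<bullet> y) - \<epsilon>\<^sup>2 * Q y - \<epsilon> ^ 3 * c y\<bar> \<le> B * (\<epsilon> ^ 4 * norm y ^ 4)"
            using \<epsilon> unfolding Qh ch inner_scaleR_right \<beta>y[OF y, symmetric] by (simp add: power_mult_distrib)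
          moreover have "\<gamma> (?x + \<epsilon> *\<^sub>R y) - \<gamma> ?x - \<epsilon> * (\<beta> \<bullet> y) - \<epsilon>\<^sup>2 * Q y - \<epsilon> ^ 3 * c y = \<epsilon> * (e y - \<epsilon> * Q y - \<epsilon>\<^sup>2 * c y)"
          proof -
            have "\<epsilon> * e y = \<gamma> (?x + \<epsilon> *\<^sub>R y) - \<gamma> ?x - \<epsilon> * (\<beta> \<bullet> y)"
              unfolding e_def if_P[OF True] right_diff_distrib using \<epsilon> by simp
            then show ?thesis by (simp only: right_diff_distrib) (simp add: power2_eq_square power3_eq_cube)
          qed
          ultimately have "\<epsilon> * \<bar>e y - \<epsilon> * Q y - \<epsilon>\<^sup>2 * c y\<bar> \<le> \<epsilon> * (B * \<epsilon> ^ 3 * norm y ^ 4)"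
            using \<epsilon> by (simp add: abs_mult eval_nat_numeral mult_ac)
          then have "\<bar>e y - \<epsilon> * Q y - \<epsilon>\<^sup>2 * c y\<bar> \<le> B * \<epsilon> ^ 3 * norm y ^ 4" using \<epsilon> by simp
          also have "\<dots> \<le> 2 * B * \<epsilon> ^ 3 * norm y ^ 4" using B \<epsilon> by (intro mult_right_mono) auto
          finally show ?thesis .
        next
          case False
          \<comment> \<open>Where the deviation is cut off, \<open>\<epsilon> * norm y > 1\<close> lets higher powers dominate the lower ones.\<close>
          let ?t = "\<epsilon> * norm y"
          have t: "1 \<le> ?t" using False \<epsilon> by simp
          have "\<bar>e y - \<epsilon> * Q y - \<epsilon>\<^sup>2 * c y\<bar> \<le> \<epsilon> * \<bar>Q y\<bar> + \<epsilon>\<^sup>2 * \<bar>c y\<bar>"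
            using False \<epsilon> abs_triangle_ineq4[of "- (\<epsilon> * Q y)" "\<epsilon>\<^sup>2 * c y"] by (simp add: e_def abs_mult)
          also have "\<dots> \<le> \<epsilon> * (B * norm y ^ 2) + \<epsilon>\<^sup>2 * (B * norm y ^ 3)"
            using Qb cb \<epsilon> by (intro add_mono mult_left_mono) auto
          also have "\<dots> = (B / \<epsilon>) * (?t ^ 2 + ?t ^ 3)"
            using \<epsilon> by (simp add: field_simps power2_eq_square power3_eq_cube)
          also have "\<dots> \<le> (B / \<epsilon>) * (?t ^ 4 + ?t ^ 4)"
            using t B \<epsilon> by (intro mult_left_mono add_mono power_increasing) auto
          also have "\<dots> = 2 * B * \<epsilon> ^ 3 * norm y ^ 4" using \<epsilon> by (simp add: field_simps eval_nat_numeral)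
          finally show ?thesis .
        qed
        also have "\<dots> \<le> 2 * B * \<epsilon> ^ 3 * (1 + norm y) ^ 4" using B \<epsilon> p4[of 4 y] by (intro mult_left_mono) auto
        finally show ?thesis .
      qed
      define H where "H = {z. \<beta> \<bullet> hyper \<nu> z - \<sigma> + e (hyper \<nu> z) \<le> z \<bullet> \<nu>}"
      define H' where "H' = {z. \<beta> \<bullet> hyper \<nu> z - \<sigma> \<le> z \<bullet> \<nu>}"
      have [measurable]: "H \<in> sets borel" unfolding H_def by measurable
      define W where "W = (LBINT z. kernel \<nu> \<mu> 0 z * indicator H z)"
      define W' where "W' = (LBINT z. kernel \<nu> \<mu> 0 z * indicator H' z)"
      define W'' where "W'' = (LBINT z. kernel \<nu> 0 0 z * indicator H' z)"
      have D1: "\<bar>blur l A x \<epsilon> - W\<bar> \<le> C1 * \<epsilon> ^ 3"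
      proof -
        have "\<bar>(LBINT z. kernel \<nu> \<mu> 0 z * indicator A (x + \<epsilon> *\<^sub>R z)) - W\<bar> \<le> tail_const ?T * exp (- (r' / \<epsilon>) / 2)"
          unfolding W_def
        proof (rule kernel_tail[OF \<nu>1 \<mu>(1)])
          fix z :: "real^'n" assume z: "norm z < r' / \<epsilon>"
          let ?y = "hyper \<nu> z"
          have ez: "norm (\<epsilon> *\<^sub>R z) < r'" using z \<epsilon> by (simp add: field_simps)
          have "\<epsilon> * norm ?y \<le> \<epsilon> * norm z" using hyper_norm_le[OF \<nu>, of z] \<epsilon> by (intro mult_left_mono) auto
          moreover have "norm (\<epsilon> *\<^sub>R ?y) = \<epsilon> * norm ?y" "norm (\<epsilon> *\<^sub>R z) = \<epsilon> * norm z"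
            using \<epsilon> by simp_all
          ultimately have ey: "norm (\<epsilon> *\<^sub>R ?y) \<le> 1" using ez r'(3) by linarith
          have xz: "x + \<epsilon> *\<^sub>R z \<in> ball p r"
            using x ez r' dist_triangle_less_add[of p x "r / 2" "x + \<epsilon> *\<^sub>R z" "r / 2"] by (simp add: dist_norm)
          have "x + \<epsilon> *\<^sub>R z \<in> A \<longleftrightarrow> \<gamma> (hyper \<nu> (x + \<epsilon> *\<^sub>R z)) \<le> (x + \<epsilon> *\<^sub>R z) \<bullet> \<nu>"
            using chart xz by blast
          also have "\<dots> \<longleftrightarrow> \<gamma> (?x + \<epsilon> *\<^sub>R ?y) - \<gamma> ?x - \<phi> \<le> \<epsilon> * (z \<bullet> \<nu>)"
            unfolding hyper_add_scaleR unfolding \<phi>_def inner_add_left inner_scaleR_left by argo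
          also have "\<dots> \<longleftrightarrow> \<epsilon> * (\<beta> \<bullet> ?y - \<sigma> + e ?y) \<le> \<epsilon> * (z \<bullet> \<nu>)"
          proof -
            have "\<epsilon> * (\<beta> \<bullet> ?y - \<sigma> + e ?y) = \<epsilon> * ((\<gamma> (?x + \<epsilon> *\<^sub>R ?y) - \<gamma> ?x) / \<epsilon>) - \<epsilon> * \<sigma>"
              using ey unfolding e_def by (simp only: if_True right_diff_distrib distrib_left)
            also have "\<dots> = \<gamma> (?x + \<epsilon> *\<^sub>R ?y) - \<gamma> ?x - \<phi>" unfolding \<sigma>(2) using \<epsilon> by simp
            finally show ?thesis by (simp only:)
          qed
          also have "\<dots> \<longleftrightarrow> z \<in> H" using \<epsilon> by (simp add: H_def)
          finally show "(indicator A (x + \<epsilon> *\<^sub>R z) :: real) = indicator H z" by (simp add: indicator_def)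
        qed (auto split: split_indicator)
        also have "exp (- (r' / \<epsilon>) / 2) \<le> 27 / (r' / (2 * \<epsilon>)) ^ 3"
          using exp_minus_cubic[of "r' / (2 * \<epsilon>)"] r' \<epsilon> by (simp add: mult.commute)
        also have "27 / (r' / (2 * \<epsilon>)) ^ 3 = 216 / r' ^ 3 * \<epsilon> ^ 3"
          using r' \<epsilon> by (simp add: power_divide power_mult_distrib)
        finally show ?thesis
          unfolding blur_def \<mu>_def[symmetric] C1_def kernel_0_indep[of 0 \<mu> \<nu>]
          using tail_const_nonneg[where 'a="real^'n"] by (simp add: mult_left_mono mult.assoc)
      qed
      have D2: "\<bar>W - W' + \<epsilon> * q\<bar> \<le> C2 * (\<epsilon> ^ 3 + \<bar>\<phi>\<bar>)"
        unfolding W_def W'_def q_def H_def H'_def C2_def \<sigma>(1)[symmetric]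
      proof (rule graph_expansion[OF \<nu> \<mu> \<epsilon>(1,2) _ Qc em Q4 c4 e4])
        show "0 \<le> 2 * B" using B by simp
        show "Q (- y) = Q y" for y using Qh[of "-1" y] by simp
        show "c (- y) = - c y" for y using ch[of "-1" y] by simp
      qed
      have D3: "\<bar>W' - W''\<bar> \<le> C3 * \<bar>\<phi>\<bar>"
      proof -
        have "\<bar>W' - W''\<bar> \<le> kernel_bound ?T * fibre_mass ?T * (\<bar>\<mu>\<bar> * \<bar>\<sigma>\<bar>)"
          unfolding W'_def W''_def H'_def by (rule half_space_perturbation[OF \<nu> \<beta> \<mu>(1)])
        also have "\<bar>\<mu>\<bar> * \<bar>\<sigma>\<bar> = \<bar>l\<bar> * \<epsilon> * \<bar>\<phi>\<bar>"
          unfolding \<sigma>(1)[symmetric] \<mu>_def by (simp add: abs_mult power2_eq_square)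
        also have "\<bar>l\<bar> * \<epsilon> * \<bar>\<phi>\<bar> \<le> \<bar>l\<bar> * 1 * \<bar>\<phi>\<bar>"
          using \<epsilon> by (intro mult_right_mono mult_left_mono) auto
        finally show ?thesis
          unfolding C3_def using kernel_bound_nonneg[where 'a="real^'n"] fm by (simp add: mult_left_mono mult.assoc)
      qed
      have D4: "W'' = 1 / 2 + sgn_average n (\<phi> / (\<epsilon> * s)) / 2"
      proof -
        have "H' = {z. - (\<phi> / (\<epsilon> * s)) \<le> z \<bullet> n}"
        proof -
          have "\<beta> \<bullet> hyper \<nu> z - \<sigma> \<le> z \<bullet> \<nu> \<longleftrightarrow> - (\<phi> / (\<epsilon> * s)) \<le> z \<bullet> n" for z
          proof -
            have "\<beta> \<bullet> hyper \<nu> z = z \<bullet> \<beta>" using \<beta> by (simp add: inner_diff_right inner_commute)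
            then have "\<beta> \<bullet> hyper \<nu> z - \<sigma> \<le> z \<bullet> \<nu> \<longleftrightarrow> - \<sigma> \<le> z \<bullet> \<nu> - z \<bullet> \<beta>" by linarith
            also have "\<dots> \<longleftrightarrow> - \<sigma> / s \<le> (z \<bullet> \<nu> - z \<bullet> \<beta>) / s" using s1 by (subst divide_le_cancel) auto
            also have "(z \<bullet> \<nu> - z \<bullet> \<beta>) / s = z \<bullet> n"
              by (simp add: n_def m_def inner_diff_right divide_inverse mult.commute)
            also have "- \<sigma> / s = - (\<phi> / (\<epsilon> * s))" by (simp add: \<sigma>_def)
            finally show ?thesis .
          qed
          then show ?thesis unfolding H'_def by blast
        qed
        then show ?thesis
          unfolding W''_def using half_space_average[OF n1, of "\<phi> / (\<epsilon> * s)"] kernel_0_indep[of \<nu> 0 n] by simp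
      qed
      have "\<bar>blur l A x \<epsilon> - (W'' - \<epsilon> * q)\<bar> \<le> C1 * \<epsilon> ^ 3 + C2 * (\<epsilon> ^ 3 + \<bar>\<phi>\<bar>) + C3 * \<bar>\<phi>\<bar>"
        using D1 D2 D3 by linarith
      also have "\<dots> \<le> C1 * (\<epsilon> ^ 3 + \<bar>\<phi>\<bar>) + C2 * (\<epsilon> ^ 3 + \<bar>\<phi>\<bar>) + C3 * (\<epsilon> ^ 3 + \<bar>\<phi>\<bar>)"
        using C \<epsilon> by (intro add_mono mult_left_mono) auto
      also have "\<dots> = (C1 + C2 + C3) * (\<epsilon> ^ 3 + \<bar>\<phi>\<bar>)" by (simp only: distrib_right)
      finally show ?thesis unfolding D4 .
    qed
    show "\<exists>n::real^'n. \<exists>q s. norm n = 1 \<and> 1 \<le> s \<and> s \<le> 1 + B \<and>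
      (\<forall>\<epsilon>. 0 < \<epsilon> \<and> \<epsilon> \<le> 1 \<and> \<bar>l\<bar> * \<epsilon>\<^sup>2 \<le> 1 \<longrightarrow>
       \<bar>blur l A x \<epsilon> - (1 / 2 + sgn_average n ((x \<bullet> \<nu> - \<gamma> (hyper \<nu> x)) / (\<epsilon> * s)) / 2 - \<epsilon> * q)\<bar>
         \<le> (C1 + C2 + C3) * (\<epsilon> ^ 3 + \<bar>x \<bullet> \<nu> - \<gamma> (hyper \<nu> x)\<bar>))"
      using n1 s1 s2 main unfolding \<phi>_def by blast
  qed
  qed
qed

text \<open>
  In the combination of the three scales the curvature terms \<open>\<epsilon> q\<close> cancel, and the profile dominates the errors.
\<close>

lemma level_set_near_graph:
  fixes \<nu> p :: "real ^ 'n"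
  assumes \<nu>: "norm \<nu> = 1" and \<gamma>: "C_k 5 \<gamma>" and r: "0 < r" and A: "A \<in> sets borel"
    and chart: "A \<inter> ball p r = {x \<in> ball p r. x \<bullet> \<nu> \<ge> \<gamma> (hyper \<nu> x)}"
    and a: "0 < a" and M: "0 < M"
  shows "\<exists>C>0. \<exists>h0>0. \<forall>h. 0 < h \<and> h < h0 \<longrightarrow> (\<forall>x\<in>ball p (r / 2).
    \<bar>x \<bullet> \<nu> - \<gamma> (hyper \<nu> x)\<bar> \<le> M * h \<and> U_threshold l A a x (h ^ 4) = 1 / 2 \<longrightarrow>
      \<bar>x \<bullet> \<nu> - \<gamma> (hyper \<nu> x)\<bar> \<le> C * h ^ 4)"
proof -
  obtain E S where E: "0 \<le> E" and S: "1 \<le> S" and ex: "\<forall>x\<in>ball p (r / 2). \<exists>n::real^'n. \<exists>q s. norm n = 1 \<and> 1 \<le> s \<and> s \<le> S \<and>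
    (\<forall>\<epsilon>. 0 < \<epsilon> \<and> \<epsilon> \<le> 1 \<and> \<bar>l\<bar> * \<epsilon>\<^sup>2 \<le> 1 \<longrightarrow>
       \<bar>blur l A x \<epsilon> - (1 / 2 + sgn_average n ((x \<bullet> \<nu> - \<gamma> (hyper \<nu> x)) / (\<epsilon> * s)) / 2 - \<epsilon> * q)\<bar>
         \<le> E * (\<epsilon> ^ 3 + \<bar>x \<bullet> \<nu> - \<gamma> (hyper \<nu> x)\<bar>))"
    using chart_expansion[OF \<nu> \<gamma> r A chart, of l] by blast
  obtain c where c: "0 < c" and low: "\<And>(n::real^'n) y. norm n = 1 \<Longrightarrow> \<bar>y\<bar> \<le> M / a \<Longrightarrow>
     c * \<bar>y\<bar> \<le> \<bar>sgn_average n (y / 3) - 3 * sgn_average n (y / 2) + 3 * sgn_average n y\<bar>"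
    using sgn_average_threshold_lower[of "M / a", where 'a="real^'n"] M a by auto
  define K where "K = c / (a * S)"
  have K: "0 < K" unfolding K_def using c a S by simp
  \<comment> \<open>The second bound lets the error proportional to \<open>\<phi>\<close> be absorbed into half of the profile term.\<close>
  define h0 where "h0 = min (1 / (3 * a * (1 + \<bar>l\<bar>))) (K / (28 * E + 1))"
  define C where "C = (756 * E * a ^ 3 + 1) / K"
  have h0: "0 < h0" unfolding h0_def using a K E by auto
  have C: "0 < C" unfolding C_def using E a K by (intro divide_pos_pos add_nonneg_pos) auto
  show ?thesis
  proof (rule exI[of _ C], rule conjI[OF C], rule exI[of _ h0], rule conjI[OF h0], intro allI impI ballI)
    fix h x assume h: "0 < h \<and> h < h0" and x: "x \<in> ball p (r / 2)"
      and as: "\<bar>x \<bullet> \<nu> - \<gamma> (hyper \<nu> x)\<bar> \<le> M * h \<and> U_threshold l A a x (h ^ 4) = 1 / 2"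
    define \<phi> where "\<phi> = x \<bullet> \<nu> - \<gamma> (hyper \<nu> x)"
    have "h \<le> 1 / (3 * a * (1 + \<bar>l\<bar>))" using h by (simp add: h0_def)
    then have h31: "3 * a * h \<le> 1" and lh: "\<bar>l\<bar> * (3 * a * h)\<^sup>2 \<le> 1"
      using small_parameter_bound[OF a] h by auto
    obtain n :: "real^'n" and q s where nqs: "norm n = 1 \<and> 1 \<le> s \<and> s \<le> S \<and> (\<forall>\<epsilon>. 0 < \<epsilon> \<and> \<epsilon> \<le> 1 \<and> \<bar>l\<bar> * \<epsilon>\<^sup>2 \<le> 1 \<longrightarrow>
       \<bar>blur l A x \<epsilon> - (1 / 2 + sgn_average n (\<phi> / (\<epsilon> * s)) / 2 - \<epsilon> * q)\<bar> \<le> E * (\<epsilon> ^ 3 + \<bar>\<phi>\<bar>))"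
      using bspec[OF ex x, folded \<phi>_def] by blast
    have n: "norm n = 1" and s: "1 \<le> s" "s \<le> S" using nqs by auto
    have est: "\<bar>blur l A x \<epsilon> - (1 / 2 + sgn_average n (\<phi> / (\<epsilon> * s)) / 2 - \<epsilon> * q)\<bar> \<le> E * (\<epsilon> ^ 3 + \<bar>\<phi>\<bar>)"
      if "0 < \<epsilon> \<and> \<epsilon> \<le> 1 \<and> \<bar>l\<bar> * \<epsilon>\<^sup>2 \<le> 1" for \<epsilon> using nqs that by blast
    define F where "F = E * (27 * a ^ 3 * h ^ 3 + \<bar>\<phi>\<bar>)"
    define y where "y = \<phi> / (a * h * s)"
    have est': "\<bar>blur l A x (k * a * h) - (1 / 2 + sgn_average n (y / k) / 2 - k * a * h * q)\<bar> \<le> F"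
      if k: "0 < k" "k \<le> 3" for k
    proof -
      have k3: "k * a * h \<le> 3 * a * h" using k a h by (intro mult_right_mono) auto
      have "\<bar>l\<bar> * (k * a * h)\<^sup>2 \<le> 1" using scaled_parameter_bound[OF k a _ lh] h by simp
      then have "\<bar>blur l A x (k * a * h) - (1 / 2 + sgn_average n (\<phi> / (k * a * h * s)) / 2 - k * a * h * q)\<bar> \<le> E * ((k * a * h) ^ 3 + \<bar>\<phi>\<bar>)"
        using k a h order_trans[OF k3 h31] by (intro est) auto
      also have "\<dots> \<le> E * ((3 * a * h) ^ 3 + \<bar>\<phi>\<bar>)"
        using k3 k a h E by (intro mult_left_mono add_mono power_mono) auto
      also have "\<dots> = F" by (simp add: F_def power_mult_distrib)
      also have "\<phi> / (k * a * h * s) = y / k" by (simp add: y_def mult_ac)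
      finally show ?thesis .
    qed
    have U: "blur l A x (3 * a * h) - 3 * blur l A x (2 * a * h) + 3 * blur l A x (a * h) = 1 / 2"
    proof -
      have "0 < h" using h by simp
      then show ?thesis using U_threshold_eq_blur[of h a l A x] a lh A as by simp
    qed
    let ?D = "sgn_average n (y / 3) - 3 * sgn_average n (y / 2) + 3 * sgn_average n y"
    have "\<bar>?D\<bar> \<le> 14 * F"
    proof -
      have e1: "\<bar>blur l A x (a * h) - (1 / 2 + sgn_average n y / 2 - a * h * q)\<bar> \<le> F" using est'[of 1] by simp
      have qs: "3 * a * h * q - 3 * (2 * a * h * q) + 3 * (a * h * q) = 0" by simp
      show ?thesis
        using est'[of 3] est'[of 2] e1 U qs by (simp add: abs_le_iff)
    qed
    moreover have "c * \<bar>y\<bar> \<le> \<bar>?D\<bar>"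
    proof (rule low[OF n])
      have "\<bar>y\<bar> = \<bar>\<phi>\<bar> / (a * h * s)" unfolding y_def using a h s by simp
      also have "\<dots> \<le> (M * h) / (a * h * 1)"
        using as a h s M unfolding \<phi>_def by (intro frac_le mult_left_mono) auto
      also have "\<dots> = M / a" using h by simp
      finally show "\<bar>y\<bar> \<le> M / a" .
    qed
    moreover have "K * \<bar>\<phi>\<bar> / h \<le> c * \<bar>y\<bar>"
    proof -
      have "K * \<bar>\<phi>\<bar> / h = c * (\<bar>\<phi>\<bar> / (a * h * S))" by (simp add: K_def)
      also have "\<dots> \<le> c * (\<bar>\<phi>\<bar> / (a * h * s))"
        using a h s c by (intro mult_left_mono divide_left_mono mult_pos_pos) auto
      also have "\<dots> = c * \<bar>y\<bar>" unfolding y_def using a h s by simp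
      finally show ?thesis .
    qed
    ultimately have "K * \<bar>\<phi>\<bar> / h \<le> 14 * F" by linarith
    then have "K * \<bar>\<phi>\<bar> \<le> 14 * F * h" using h by (simp add: field_simps)
    then have 1: "K * \<bar>\<phi>\<bar> \<le> 378 * E * a ^ 3 * h ^ 4 + (14 * E * h) * \<bar>\<phi>\<bar>"
      by (simp add: F_def algebra_simps eval_nat_numeral)
    have "14 * E * h \<le> K / 2"
    proof -
      have "(28 * E + 1) * h \<le> (28 * E + 1) * (K / (28 * E + 1))"
        using h E unfolding h0_def by (intro mult_left_mono) auto
      also have "\<dots> = K" using E by simp
      finally show ?thesis using h by (simp add: algebra_simps)
    qed
    then have "(14 * E * h) * \<bar>\<phi>\<bar> \<le> K / 2 * \<bar>\<phi>\<bar>" by (intro mult_right_mono) auto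
    with 1 have "K * \<bar>\<phi>\<bar> \<le> 756 * E * a ^ 3 * h ^ 4" by linarith
    also have "\<dots> \<le> (756 * E * a ^ 3 + 1) * h ^ 4" by (simp add: distrib_right)
    finally have "\<bar>\<phi>\<bar> \<le> C * h ^ 4" unfolding C_def using K by (simp add: field_simps)
    then show "\<bar>x \<bullet> \<nu> - \<gamma> (hyper \<nu> x)\<bar> \<le> C * h ^ 4" by (simp add: \<phi>_def)
  qed
qed

section \<open>The level set lies near the boundary\<close>

text \<open>
  The function \<open>x \<bullet> \<nu> - \<gamma> (hyper \<nu> x)\<close> has slope one in the direction \<open>\<nu>\<close>, so its zeros are limits of points outside \<open>A\<close>.
\<close>

lemma frontier_in_chart:
  fixes \<nu> p :: "'a::euclidean_space"
  assumes \<nu>: "norm \<nu> = 1" and \<gamma>: "continuous_on UNIV \<gamma>" and A: "closed A"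
    and chart: "A \<inter> ball p r = {x \<in> ball p r. x \<bullet> \<nu> \<ge> \<gamma> (hyper \<nu> x)}" and x: "x \<in> ball p r"
  shows "x \<in> frontier A \<longleftrightarrow> x \<bullet> \<nu> = \<gamma> (hyper \<nu> x)"
proof -
  let ?\<phi> = "\<lambda>x. x \<bullet> \<nu> - \<gamma> (hyper \<nu> x)"
  have \<phi>: "continuous_on UNIV ?\<phi>"
    by (intro continuous_intros continuous_on_compose2[OF \<gamma>]) auto
  have op: "open {x. 0 < ?\<phi> x}"
    by (rule open_Collect_less[OF continuous_on_const \<phi>])
  have inA: "z \<in> A \<longleftrightarrow> 0 \<le> ?\<phi> z" if z: "z \<in> ball p r" for z
  proof -
    have "z \<in> A \<longleftrightarrow> z \<in> A \<inter> ball p r" using z by simp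
    also have "\<dots> \<longleftrightarrow> 0 \<le> ?\<phi> z" unfolding chart using z by simp
    finally show ?thesis .
  qed
  note xA = inA[OF x]
  have fA: "x \<in> frontier A \<longleftrightarrow> x \<in> A \<and> x \<notin> interior A" using A by (simp add: frontier_def)
  show ?thesis
  proof
    assume f: "x \<in> frontier A"
    then have "0 \<le> ?\<phi> x" using fA xA by blast
    moreover have "\<not> 0 < ?\<phi> x"
    proof
      assume "0 < ?\<phi> x"
      then have "x \<in> {x. 0 < ?\<phi> x} \<inter> ball p r" using x by simp
      moreover have "{x. 0 < ?\<phi> x} \<inter> ball p r \<subseteq> A"
        using inA by (intro subsetI) (metis (mono_tags, lifting) IntE less_imp_le mem_Collect_eq)
      ultimately have "x \<in> interior A" by (intro interiorI[OF open_Int[OF op open_ball]])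
      then show False using f fA by blast
    qed
    ultimately show "x \<bullet> \<nu> = \<gamma> (hyper \<nu> x)" by simp
  next
    assume e: "x \<bullet> \<nu> = \<gamma> (hyper \<nu> x)"
    have "x \<notin> interior A"
    proof
      assume "x \<in> interior A"
      then have "x \<in> interior A \<inter> ball p r" using x by simp
      then obtain d where d: "0 < d" "cball x d \<subseteq> interior A \<inter> ball p r"
        using open_contains_cball[of "interior A \<inter> ball p r"] by (metis open_Int open_ball open_interior)
      let ?x = "x + (- d) *\<^sub>R \<nu>"
      have "?x \<in> cball x d" using d \<nu> by (simp add: dist_norm)
      then have "?x \<in> A \<inter> ball p r" using d interior_subset by blast
      then have "\<gamma> (hyper \<nu> ?x) \<le> ?x \<bullet> \<nu>" unfolding chart by blast
      then have "\<gamma> (hyper \<nu> x) \<le> x \<bullet> \<nu> - d"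
        unfolding hyper_translate[OF \<nu>] using \<nu> by (simp add: inner_diff_left norm_eq_1)
      then show False using e d by simp
    qed
    moreover have "x \<in> A" using xA e by simp
    ultimately show "x \<in> frontier A" using fA by blast
  qed
qed

lemma C_k_lipschitz_local:
  fixes f :: "'a::euclidean_space \<Rightarrow> real"
  assumes f: "C_k 5 f"
  shows "\<exists>L\<ge>0. \<forall>x y. norm x \<le> R \<and> dist x y \<le> 1 \<longrightarrow> \<bar>f x - f y\<bar> \<le> L * dist x y"
proof -
  obtain B where B: "0 \<le> B" and tay: "\<forall>x. norm x \<le> R \<longrightarrow> (\<exists>\<beta> Q c. cubic_expansion f B x \<beta> Q c)"
    using C_k_taylor[OF f, of R] by blast
  show ?thesis
  proof (intro exI[of _ "4 * B"] conjI allI impI)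
    show "0 \<le> 4 * B" using B by simp
    fix x y :: 'a assume xy: "norm x \<le> R \<and> dist x y \<le> 1"
    then obtain \<beta> Q c where \<beta>: "norm \<beta> \<le> B" and Qb: "\<And>v. \<bar>Q v\<bar> \<le> B * norm v ^ 2" and cb: "\<And>v. \<bar>c v\<bar> \<le> B * norm v ^ 3"
      and rem: "\<And>v. norm v \<le> 1 \<Longrightarrow> \<bar>f (x + v) - f x - \<beta> \<bullet> v - Q v - c v\<bar> \<le> B * norm v ^ 4"
      using tay unfolding cubic_expansion_def by metis
    let ?v = "y - x"
    have v: "norm ?v \<le> 1" using xy by (simp add: dist_norm norm_minus_commute)
    have "norm ?v ^ j \<le> norm ?v ^ 1" if "1 \<le> j" for j using v that by (intro power_decreasing) auto
    then have p: "B * norm ?v ^ j \<le> B * norm ?v" if "1 \<le> j" for j using B that by (intro mult_left_mono) auto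
    have "\<bar>\<beta> \<bullet> ?v\<bar> \<le> B * norm ?v"
      using Cauchy_Schwarz_ineq2[of \<beta> ?v] \<beta> mult_right_mono[OF \<beta>, of "norm ?v"] by simp
    moreover have "\<bar>f (x + ?v) - f x - \<beta> \<bullet> ?v - Q ?v - c ?v\<bar> \<le> B * norm ?v" using rem[OF v] p[of 4] by linarith
    moreover have "\<bar>Q ?v\<bar> \<le> B * norm ?v" "\<bar>c ?v\<bar> \<le> B * norm ?v" using Qb[of ?v] cb[of ?v] p[of 2] p[of 3] by linarith+
    ultimately have "\<bar>f (x + ?v) - f x\<bar> \<le> 4 * (B * norm ?v)" by linarith
    then show "\<bar>f x - f y\<bar> \<le> 4 * B * dist x y" by (simp add: dist_norm norm_minus_commute abs_minus_commute)
  qed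
qed

text \<open>
  A point \<open>x\<close> within \<open>M h\<close> of the boundary has vertical distance \<open>\<phi> = O(h)\<close>, because \<open>\<phi>\<close> is Lipschitz continuous and vanishes
  on the boundary. Conversely the boundary point below or above \<open>x\<close> shows that the distance of \<open>x\<close> to the boundary is at most \<open>|\<phi>|\<close>.
\<close>

lemma level_set_near_boundary_point:
  fixes p :: "real ^ 'n"
  assumes A: "compact A" and bd: "C_k_boundary 5 A" and p: "p \<in> frontier A" and a: "0 < a" and M: "0 < M"
  shows "\<exists>\<rho>>0. \<exists>C>0. \<exists>h0>0. \<forall>h x. 0 < h \<and> h < h0 \<and> U_threshold l A a x (h ^ 4) = 1 / 2 \<and>
    (\<exists>q\<in>frontier A \<inter> ball p \<rho>. dist x q \<le> M * h) \<longrightarrow> infdist x (frontier A) \<le> C * h ^ 4"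
proof -
  obtain r \<nu> \<gamma> where r: "0 < r" and \<nu>: "norm \<nu> = 1" and \<gamma>: "C_k 5 (\<gamma> :: real^'n \<Rightarrow> real)"
    and chart: "A \<inter> ball p r = {x \<in> ball p r. x \<bullet> \<nu> \<ge> \<gamma> (hyper \<nu> x)}"
    using bd p unfolding C_k_boundary_def by blast
  have Ab: "A \<in> sets borel" and Ac: "closed A" using A by (auto simp: borel_compact compact_imp_closed)
  note fr = frontier_in_chart[OF \<nu> C_k_continuous[OF \<gamma>] Ac chart]
  obtain L where L: "0 \<le> L" "\<And>x y. norm x \<le> norm p + r \<Longrightarrow> dist x y \<le> 1 \<Longrightarrow> \<bar>\<gamma> x - \<gamma> y\<bar> \<le> L * dist x y"
    using C_k_lipschitz_local[OF \<gamma>, of "norm p + r"] by blast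
  define M' where "M' = (1 + L) * M"
  have M': "0 < M'" unfolding M'_def using M L(1) by (intro mult_pos_pos add_pos_nonneg) auto
  have MM': "M \<le> M'" unfolding M'_def using M L(1) by (simp add: distrib_right)
  obtain C h1 where C: "0 < C" and h1: "0 < h1" and near: "\<And>h x. 0 < h \<Longrightarrow> h < h1 \<Longrightarrow> x \<in> ball p (r / 2) \<Longrightarrow>
     \<bar>x \<bullet> \<nu> - \<gamma> (hyper \<nu> x)\<bar> \<le> M' * h \<Longrightarrow> U_threshold l A a x (h ^ 4) = 1 / 2 \<Longrightarrow> \<bar>x \<bullet> \<nu> - \<gamma> (hyper \<nu> x)\<bar> \<le> C * h ^ 4"
    using level_set_near_graph[OF \<nu> \<gamma> r Ab chart a M', of l] by blast
  define h0 where "h0 = min h1 (min (r / 4) 1 / M')"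
  have h0: "0 < h0" unfolding h0_def using h1 r M' by simp
  have r4: "0 < r / 4" using r by simp
  show ?thesis
  proof (rule exI[of _ "r / 4"], rule conjI[OF r4], rule exI[of _ C], rule conjI[OF C], rule exI[of _ h0], rule conjI[OF h0],
      intro allI impI)
    fix h x assume as: "0 < h \<and> h < h0 \<and> U_threshold l A a x (h ^ 4) = 1 / 2 \<and> (\<exists>q\<in>frontier A \<inter> ball p (r / 4). dist x q \<le> M * h)"
    then obtain q where q: "q \<in> frontier A" "dist p q < r / 4" "dist x q \<le> M * h" by auto
    have h: "0 < h" "h < h1" using as by (auto simp: h0_def)
    have "h < min (r / 4) 1 / M'" using as by (simp add: h0_def)
    then have M'h: "M' * h < r / 4" "M' * h < 1" using M' by (simp_all add: field_simps)
    have "M * h \<le> M' * h" using MM' h by (intro mult_right_mono) auto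
    then have xq: "dist x q < r / 4" "dist x q \<le> 1" using q(3) M'h by linarith+
    have px: "dist p x < r / 2" using dist_triangle[of p x q] q(2) xq(1) by (simp add: dist_commute)
    let ?\<phi> = "x \<bullet> \<nu> - \<gamma> (hyper \<nu> x)"
    have q\<phi>: "q \<bullet> \<nu> = \<gamma> (hyper \<nu> q)" using fr[of q] q r by simp
    have hd: "dist (hyper \<nu> q) (hyper \<nu> x) \<le> dist x q"
    proof -
      have "hyper \<nu> q - hyper \<nu> x = hyper \<nu> (q - x)" by (simp add: inner_diff_left algebra_simps)
      then have "norm (hyper \<nu> q - hyper \<nu> x) \<le> norm (q - x)"
        using hyper_norm_le[OF \<nu>, of "q - x"] by (simp only:)
      then show ?thesis by (simp only: dist_norm norm_minus_commute[of x q])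
    qed
    have "norm q \<le> norm p + r" using q(2) r norm_triangle_ineq2[of q p] by (simp add: dist_norm norm_minus_commute)
    then have "norm (hyper \<nu> q) \<le> norm p + r" using hyper_norm_le[OF \<nu>, of q] by linarith
    then have "\<bar>\<gamma> (hyper \<nu> q) - \<gamma> (hyper \<nu> x)\<bar> \<le> L * dist (hyper \<nu> q) (hyper \<nu> x)"
      using hd xq by (intro L(2)) auto
    also have "\<dots> \<le> L * dist x q" using hd L(1) by (intro mult_left_mono) auto
    finally have g: "\<bar>\<gamma> (hyper \<nu> q) - \<gamma> (hyper \<nu> x)\<bar> \<le> L * dist x q" .
    have "\<bar>x \<bullet> \<nu> - q \<bullet> \<nu>\<bar> \<le> dist x q"
      using Cauchy_Schwarz_ineq2[of "x - q" \<nu>] \<nu> by (simp add: inner_diff_left dist_norm)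
    then have "\<bar>?\<phi>\<bar> \<le> (1 + L) * dist x q" using g q\<phi> by (simp add: algebra_simps)
    also have "\<dots> \<le> (1 + L) * (M * h)" using q(3) L(1) by (intro mult_left_mono) auto
    finally have \<phi>M: "\<bar>?\<phi>\<bar> \<le> M' * h" by (simp add: M'_def)
    have \<phi>C: "\<bar>?\<phi>\<bar> \<le> C * h ^ 4" using near[OF h _ \<phi>M] px as by simp
    let ?x = "x + (- ?\<phi>) *\<^sub>R \<nu>"
    have d: "dist x ?x = \<bar>?\<phi>\<bar>" using \<nu> by (simp add: dist_norm)
    have "?x \<in> ball p r" using dist_triangle[of p ?x x] d px \<phi>M M'h by simp
    moreover have "?x \<bullet> \<nu> = \<gamma> (hyper \<nu> ?x)"
      unfolding hyper_translate[OF \<nu>] using \<nu> by (simp add: inner_add_left norm_eq_1)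
    ultimately have "?x \<in> frontier A" using fr by blast
    then have "infdist x (frontier A) \<le> dist x ?x" by (rule infdist_le)
    then show "infdist x (frontier A) \<le> C * h ^ 4" using d \<phi>C by linarith
  qed
qed

text \<open>
  The indicator is constant on a ball of radius \<open>M h\<close> around \<open>x\<close>. So each of the three averages differs from 0 or 1 by a kernel tail, and
  the coefficients \<open>1, -3, 3\<close>, whose absolute values sum up to 7, keep the total deviation below one half if \<open>M\<close> is large.
\<close>

lemma U_threshold_far:
  fixes A :: "(real ^ 'n) set"
  assumes a: "0 < a" and A: "A \<in> sets borel"
  shows "\<exists>M>0. \<forall>h x. 0 < h \<and> \<bar>l\<bar> * (3 * a * h)\<^sup>2 \<le> 1 \<and> ball x (M * h) \<inter> frontier A = {} \<longrightarrow> U_threshold l A a x (h ^ 4) \<noteq> 1 / 2"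
proof -
  let ?T = "tail_const TYPE(real^'n)"
  have T: "0 \<le> ?T" by (rule tail_const_nonneg)
  \<comment> \<open>The inequality \<open>u < exp u\<close> then makes \<open>7 * ?T * exp (- u)\<close> smaller than one half, and the factor 6 below turns
      the largest scale \<open>3 * a * h\<close> into a tail of size \<open>exp (- u)\<close>.\<close>
  define u where "u = 14 * ?T + 1"
  have u: "1 \<le> u" using T by (simp add: u_def)
  define M where "M = 6 * a * u"
  have M: "0 < M" unfolding M_def using a u by simp
  have small: "7 * (?T * exp (- u)) < 1 / 2"
  proof -
    have "14 * ?T < exp u" using exp_ge_add_one_self[of u] by (simp add: u_def)
    then have "14 * ?T * exp (- u) < exp u * exp (- u)" by (intro mult_strict_right_mono) auto
    then have "14 * ?T * exp (- u) < 1" by (simp flip: exp_add)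
    then show ?thesis by simp
  qed
  show ?thesis
  proof (intro exI[of _ M] conjI allI impI M notI)
    fix h x assume as: "0 < h \<and> \<bar>l\<bar> * (3 * a * h)\<^sup>2 \<le> 1 \<and> ball x (M * h) \<inter> frontier A = {}"
      and U: "U_threshold l A a x (h ^ 4) = 1 / 2"
    have h: "0 < h" using as by simp
    have near: "\<bar>blur l A x (k * a * h) - indicator A x\<bar> \<le> ?T * exp (- u)" if k: "0 < k" "k \<le> 3" for k
    proof -
      have l: "\<bar>l * (k * a * h)\<^sup>2\<bar> \<le> 1" using scaled_parameter_bound[OF k a h] as by (simp add: abs_mult)
      let ?R = "M / (k * a)"
      have eR: "k * a * h * ?R = M * h" using k a by simp
      have "\<bar>blur l A x (k * a * h) - indicator A x\<bar> \<le> ?T * exp (- ?R / 2)"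
      proof (rule blur_constant_near[OF _ l A])
        show "0 < k * a * h" using k a h by simp
        show "(indicator A y :: real) = indicator A x" if "y \<in> ball x (k * a * h * ?R)" for y
          using that unfolding eR using as by (intro indicator_constant_off_frontier) auto
      qed
      also have "\<dots> \<le> ?T * exp (- u)"
      proof -
        have "u * (k * a) \<le> u * (3 * a)" using u k a by (intro mult_left_mono mult_right_mono) auto
        then have "u \<le> ?R / 2" using k a by (simp add: M_def field_simps)
        then show ?thesis using T by (intro mult_left_mono) auto
      qed
      finally show ?thesis .
    qed
    have "U_threshold l A a x (h ^ 4) = blur l A x (3 * a * h) - 3 * blur l A x (2 * a * h) + 3 * blur l A x (1 * a * h)"
      using U_threshold_eq_blur[OF h a _ A, of l x] as by simp
    then have "\<bar>1 / 2 - indicator A x\<bar> \<le> 7 * (?T * exp (- u))"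
      unfolding U using near[of 3] near[of 2] near[of 1] by (simp add: abs_le_iff)
    then have "\<bar>1 / 2 - indicator A x\<bar> < (1 / 2 :: real)" using small by linarith
    then show False by (cases "x \<in> A") auto
  qed
qed

lemma frontier_Omega:
  fixes A :: "(real ^ 'n) set"
  assumes h: "0 < h" and a: "0 < a" and l: "\<bar>l\<bar> * (3 * a * h)\<^sup>2 \<le> 1" and A: "compact A"
    and x: "x \<in> frontier (Omega l A a (h ^ 4))"
  shows "U_threshold l A a x (h ^ 4) = 1 / 2"
proof -
  let ?U = "\<lambda>x. U_threshold l A a x (h ^ 4)"
  have Ab: "A \<in> sets borel" using A by (simp add: borel_compact)
  have bc: "continuous_on UNIV (\<lambda>x. blur l A x (k * a * h))" if k: "0 < k" "k \<le> 3" for k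
  proof (rule blur_continuous[OF _ _ A])
    show "\<bar>l * (k * a * h)\<^sup>2\<bar> \<le> 1" using scaled_parameter_bound[OF k a h l] by (simp add: abs_mult)
  qed (use k a h in simp)
  have "?U = (\<lambda>x. blur l A x (3 * a * h) - 3 * blur l A x (2 * a * h) + 3 * blur l A x (1 * a * h))"
    using U_threshold_eq_blur[OF h a l Ab] by (simp add: fun_eq_iff)
  then have U: "continuous_on UNIV ?U"
    by (simp only:) (intro continuous_intros bc; simp)
  have cl: "closed (Omega l A a (h ^ 4))"
    unfolding Omega_def by (intro closed_Collect_le continuous_intros U)
  have op: "open {x. 1 / 2 < ?U x}" by (intro open_Collect_less continuous_intros U)
  have "x \<in> Omega l A a (h ^ 4)" "x \<notin> interior (Omega l A a (h ^ 4))"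
    using x cl by (auto simp: frontier_def)
  moreover have "{x. 1 / 2 < ?U x} \<subseteq> interior (Omega l A a (h ^ 4))"
    using op by (intro interior_maximal) (auto simp: Omega_def)
  ultimately show ?thesis by (force simp: Omega_def)
qed

lemma level_set_near_boundary:
  fixes A :: "(real ^ 'n) set"
  assumes A: "compact A" and bd: "C_k_boundary 5 A" and a: "0 < a"
  shows "\<exists>C>0. \<exists>h0>0. \<forall>h x. 0 < h \<and> h < h0 \<and> x \<in> frontier (Omega l A a (h ^ 4)) \<longrightarrow> infdist x (frontier A) \<le> C * h ^ 4"
proof -
  have Ab: "A \<in> sets borel" using A by (simp add: borel_compact)
  have fc: "compact (frontier A)" using A by (rule compact_frontier)
  obtain M where M: "0 < M" and far: "\<And>h x. 0 < h \<Longrightarrow> \<bar>l\<bar> * (3 * a * h)\<^sup>2 \<le> 1 \<Longrightarrow> ball x (M * h) \<inter> frontier A = {} \<Longrightarrow> U_threshold l A a x (h ^ 4) \<noteq> 1 / 2"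
    using U_threshold_far[OF a Ab, of l] by blast
  have "\<forall>p\<in>frontier A. \<exists>\<rho> C h0. 0 < \<rho> \<and> 0 < C \<and> 0 < h0 \<and> (\<forall>h x. 0 < h \<and> h < h0 \<and> U_threshold l A a x (h ^ 4) = 1 / 2 \<and>
    (\<exists>q\<in>frontier A \<inter> ball p \<rho>. dist x q \<le> M * h) \<longrightarrow> infdist x (frontier A) \<le> C * h ^ 4)"
    (is "\<forall>p\<in>_. ?P p")
  proof
    fix p assume "p \<in> frontier A"
    from level_set_near_boundary_point[OF A bd this a M, of l] show "?P p" by metis
  qed
  then obtain \<rho> C h0 where loc: "\<And>p. p \<in> frontier A \<Longrightarrow> 0 < \<rho> p \<and> 0 < C p \<and> 0 < h0 p \<and> (\<forall>h x. 0 < h \<and> h < h0 p \<and> U_threshold l A a x (h ^ 4) = 1 / 2 \<and>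
    (\<exists>q\<in>frontier A \<inter> ball p (\<rho> p). dist x q \<le> M * h) \<longrightarrow> infdist x (frontier A) \<le> C p * h ^ 4)"
    by metis
  obtain F where F: "F \<subseteq> frontier A" "finite F" "frontier A \<subseteq> (\<Union>p\<in>F. ball p (\<rho> p))"
  proof (rule compactE_image[OF fc, of "frontier A" "\<lambda>p. ball p (\<rho> p)"])
    show "frontier A \<subseteq> (\<Union>p\<in>frontier A. ball p (\<rho> p))"
    proof
      fix p assume "p \<in> frontier A"
      moreover from this have "0 < \<rho> p" using loc by blast
      ultimately show "p \<in> (\<Union>p\<in>frontier A. ball p (\<rho> p))" by (metis UN_I centre_in_ball)
    qed
  qed auto
  define C' where "C' = 1 + (\<Sum>p\<in>F. C p)"
  define h1 where "h1 = Min (insert (1 / (3 * a * (1 + \<bar>l\<bar>))) (h0 ` F))"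
  have Cp: "0 \<le> C p" if "p \<in> F" for p using loc[of p] F(1) that by auto
  have C': "0 < C'" unfolding C'_def using Cp by (intro add_pos_nonneg sum_nonneg) auto
  have h1: "0 < h1" unfolding h1_def using F(1,2) loc a by (subst Min_gr_iff) auto
  show ?thesis
  proof (rule exI[of _ C'], rule conjI[OF C'], rule exI[of _ h1], rule conjI[OF h1], intro allI impI)
    fix h x assume as: "0 < h \<and> h < h1 \<and> x \<in> frontier (Omega l A a (h ^ 4))"
    then have h: "0 < h" by simp
    have hF: "h < h0 p" if "p \<in> F" for p
      using as F(2) that unfolding h1_def by (subst (asm) Min_gr_iff) auto
    have hl: "h < 1 / (3 * a * (1 + \<bar>l\<bar>))"
      using as F(2) unfolding h1_def by (subst (asm) Min_gr_iff) auto
    then have l: "\<bar>l\<bar> * (3 * a * h)\<^sup>2 \<le> 1" using small_parameter_bound(2)[OF a h] by simp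
    have U: "U_threshold l A a x (h ^ 4) = 1 / 2"
      using frontier_Omega[OF h a l A] as by blast
    then have "ball x (M * h) \<inter> frontier A \<noteq> {}" using far[OF h l] by blast
    then obtain q where "q \<in> ball x (M * h)" "q \<in> frontier A" by blast
    then have q: "q \<in> frontier A" "dist x q \<le> M * h" by simp_all
    then obtain p where p: "p \<in> F" "q \<in> ball p (\<rho> p)" using F(3) by blast
    have "infdist x (frontier A) \<le> C p * h ^ 4"
      using loc[of p] p F(1) q h hF[OF p(1)] U by blast
    also have "\<dots> \<le> C' * h ^ 4"
    proof -
      have "C p \<le> (\<Sum>p\<in>F. C p)" using p(1) F(2) Cp by (intro member_le_sum) auto
      then show ?thesis unfolding C'_def using h by (intro mult_right_mono) auto
    qed
    finally show "infdist x (frontier A) \<le> C' * h ^ 4" .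
  qed
qed

theorem theorem4p10:
  fixes l a :: real and \<Omega>\<^sub>0 :: "(real ^ 'n) set"
  assumes "CARD('n) \<ge> 2"
    and "compact \<Omega>\<^sub>0"
    and "C_k_boundary 5 \<Omega>\<^sub>0"
    and "a > 0"
    and "18 * a ^ 4 / 11 = 1"
  shows "\<exists>C\<^sub>0>0. \<forall>\<^sub>F t in at_right 0.
           (SUP x\<in>frontier (Omega l \<Omega>\<^sub>0 a t). ereal \<bar>signed_dist \<Omega>\<^sub>0 x\<bar>) \<le> ereal (C\<^sub>0 * t)"
proof -
  obtain C h0 where C: "0 < C" and h0: "0 < h0"
    and near: "\<And>h x. 0 < h \<Longrightarrow> h < h0 \<Longrightarrow> x \<in> frontier (Omega l \<Omega>\<^sub>0 a (h ^ 4)) \<Longrightarrow> infdist x (frontier \<Omega>\<^sub>0) \<le> C * h ^ 4"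
    using level_set_near_boundary[OF assms(2-4), of l] by blast
  have "\<forall>\<^sub>F t in at_right 0. 0 < t \<and> t < h0 ^ 4"
    using h0 by (auto simp: eventually_at_right_field intro!: exI[of _ "h0 ^ 4"])
  then have "\<forall>\<^sub>F t in at_right 0.
           (SUP x\<in>frontier (Omega l \<Omega>\<^sub>0 a t). ereal \<bar>signed_dist \<Omega>\<^sub>0 x\<bar>) \<le> ereal (C * t)"
  proof eventually_elim
    case (elim t)
    define h where "h = root 4 t"
    have h: "0 < h" "h ^ 4 = t" using elim by (simp_all add: h_def)
    have "h < h0"
    proof (rule power_less_imp_less_base)
      show "h ^ 4 < h0 ^ 4" using h elim by simp
    qed (use h0 in simp)
    show ?case
    proof (rule SUP_least)
      fix x assume "x \<in> frontier (Omega l \<Omega>\<^sub>0 a t)"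
      then have "infdist x (frontier \<Omega>\<^sub>0) \<le> C * t" using near[OF h(1) \<open>h < h0\<close>] h(2) by simp
      moreover have "\<bar>signed_dist \<Omega>\<^sub>0 x\<bar> = infdist x (frontier \<Omega>\<^sub>0)"
        by (simp add: signed_dist_def infdist_nonneg)
      ultimately show "ereal \<bar>signed_dist \<Omega>\<^sub>0 x\<bar> \<le> ereal (C * t)" by simp
    qed
  qed
  then show ?thesis using C by blast
qed

end
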